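(* Fix rates $R_0,R_1,R_2\ge 0$, a source distribution $P_X$, distortion functions $d_1:\mathcal{X}\times\mathcal{Y}_{(2)}\to\mathbb{R}$ and $d_2:\mathcal{X}\times\mathcal{Y}_{(3)}\to\mathbb{R}$, distortion levels $D_1,D_2$, and a subset $\mathcal{S}\subset\{X,Y_{(2)},Y_{(3)}\}$. Consider the supremum of the equivocation $$\frac1n H(\mathcal{S}^n|M_1,M_2)$$ over all block-lengths $n$ and all valid $(R_0,R_1,R_2)$ communication systems of block-length $n$ for the cascade network (as defined in the context) that satisfy the distortion constraints $$\mathbb{E}\,\frac1n\sum_{t=1}^n d_1(X_t,Y_{(2),t})\le D_1,\qquad \mathbb{E}\,\frac1n\sum_{t=1}^n d_2(X_t,Y_{(3),t})\le D_2 .$$ This supremum (the maximum achievable equivocation of $\mathcal{S}$ under distortion constraints $D_1,D_2$) equals $$\max_{\mathcal{P}}\Big(H(\mathcal{S})-\big[I(\mathcal{S};V_1)-R_0\big]_+\Big),$$ where $[a]_+=\max\{0,a\}$ and $\mathcal{P}$ is the set of joint distributions $P_{X,Y_{(2)},Y_{(3)},V_1,V_2}$ (with finite-valued auxiliary random variables $V_1,V_2$) satisfying 1. $X\sim P_X$; 2. the Markov chain $X-V_1-Y_{(2)}$; 3. the Markov chain $(X,V_1,Y_{(2)})-V_2-Y_{(3)}$; 4. $H(V_2|V_1)=0$; 5. $\mathbb{E}\,d_1(X,Y_{(2)})\le D_1$ and $\mathbb{E}\,d_2(X,Y_{(3)})\le D_2$; 6. $I(X;V_1)\le R_1$ and $I(X;V_2)\le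 R_2$.
   Context: Conventions: for real $a\ge 1$, $[a]=\{1,\dots,\lfloor a\rfloor\}$. A superscript $n$ denotes a sequence of length $n$. $A-B-C$ means that $A$ and $C$ are conditionally independent given $B$. $H$ and $I$ denote Shannon entropy and mutual information (base 2). The alphabets $\mathcal{X},\mathcal{Y}_{(2)},\mathcal{Y}_{(3)}$ are finite. Communication system: Fix rates $R_0,R_1,R_2\ge 0$ and a block-length $n$. The source $X^n=(X_1,\dots,X_n)$ is i.i.d. with distribution $P_X$ on $\mathcal{X}$, and is observed by node 1. A secret key $K$, uniform on $[2^{nR_0}]$ and independent of $X^n$, is available to all three nodes. Node 1 sends $M_1$ to node 2, node 2 sends $M_2$ to node 3; node 2 produces $Y_{(2)}^n\in\mathcal{Y}_{(2)}^n$ and node 3 produces $Y_{(3)}^n\in\mathcal{Y}_{(3)}^n$. A valid $(R_0,R_1,R_2)$ communication system of block-length $n$ is a joint distribution of $(X^n,K,M_1,M_2,Y_{(2)}^n,Y_{(3)}^n)$ such that: $X^n$ and $K$ are distributed as just described; $M_1\in[2^{nR_1}]$ and $M_2\in[2^{nR_2}]$; and the Markov chains $X^n-(M_1,K)-(M_2,Y_{(2)}^n)$ and $(X^n,M_1,Y_{(2)}^n)-(M_2,K)-Y_{(3)}^n$ hold. The set $\mathcal{S}$ designates which of the three signals are to be kept secret from an adversary who observes $(M_1,M_2)$. In single-letter expressions, $\mathcal{S}$ denotes the tuple of the selected random variables among $X,Y_{(2)},Y_{(3)}$; $\mathcal{S}^n$ denotes the tuple of the corresponding length-$n$ sequences among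 $X^n,Y_{(2)}^n,Y_{(3)}^n$.
   Formalization: The equality can fail for boundary (D1,D2), so it is proved when 𝒫 stays nonempty after lowering both levels by some ε>0; in general it is proved for the limit as ε→0 of the suprema at (D1+ε,D2+ε). The maximum is attained when 𝒫 is nonempty. *)

theory Defs
  imports "HOL-Probability.Probability"
begin

text \<open>
  Shannon information measures (base 2) of discrete random variables on the probability space
  of a pmf. The reference measure is the counting measure on the (countable) value type, so
  these are the usual sums over the probability mass functions.
\<close>

abbreviation entropy2 :: "'w pmf \<Rightarrow> ('w \<Rightarrow> 'a) \<Rightarrow> real" where
  "entropy2 p A \<equiv> prob_space.entropy (measure_pmf p) 2 (count_space UNIV) A"

abbreviation cond_entropy2 :: "'w pmf \<Rightarrow> ('w \<Rightarrow> 'a) \<Rightarrow> ('w \<Rightarrow> 'b) \<Rightarrow> real" where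
  "cond_entropy2 p A B \<equiv>
     prob_space.conditional_entropy (measure_pmf p) 2 (count_space UNIV) (count_space UNIV) A B"

abbreviation mutual_info2 :: "'w pmf \<Rightarrow> ('w \<Rightarrow> 'a) \<Rightarrow> ('w \<Rightarrow> 'b) \<Rightarrow> real" where
  "mutual_info2 p A B \<equiv>
     prob_space.mutual_information (measure_pmf p) 2 (count_space UNIV) (count_space UNIV) A B"

lemma information_space_pmf: "information_space (measure_pmf p) 2"
  by unfold_locales auto

lemma distributed_pmf:
  fixes A :: "'w \<Rightarrow> 'a"
  shows "distributed (measure_pmf p) (count_space UNIV) A (\<lambda>a. ennreal (pmf (map_pmf A p) a))"
  unfolding distributed_def
  by (auto simp: map_pmf_rep_eq[symmetric] measure_pmf_eq_density[of "map_pmf A p", symmetric])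

lemma pair_count_space_UNIV: "count_space (UNIV::'a::countable set) \<Otimes>\<^sub>M count_space (UNIV::'b::countable set) = count_space UNIV"
  by (subst pair_measure_countable) auto

lemma sigma_finite_count_space_UNIV: "sigma_finite_measure (count_space (UNIV::'a::countable set))"
  by (rule sigma_finite_measure_count_space_countable) auto

lemma integral_count_space_pmf:
  assumes "finite (set_pmf q)"
  shows "(\<integral>x. pmf q x * f x \<partial>count_space UNIV) = (\<Sum>x\<in>set_pmf q. pmf q x * f x :: real)"
proof -
  have "(\<integral>x. pmf q x *\<^sub>R f x \<partial>count_space UNIV) = measure_pmf.expectation q f"
    by (simp add: measure_pmf_eq_density integral_density)
  also have "\<dots> = (\<Sum>x\<in>set_pmf q. pmf q x * f x)"
    by (subst integral_measure_pmf[OF assms]) auto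
  finally show ?thesis by simp
qed

lemma entropy2_eq:
  fixes A :: "'w \<Rightarrow> 'a::countable"
  assumes "finite (A ` set_pmf p)"
  shows "entropy2 p A = - (\<Sum>a\<in>A ` set_pmf p. pmf (map_pmf A p) a * log 2 (pmf (map_pmf A p) a))"
proof -
  interpret information_space "measure_pmf p" 2 by (rule information_space_pmf)
  have "entropy2 p A = - (\<integral>a. pmf (map_pmf A p) a * log 2 (pmf (map_pmf A p) a) \<partial>count_space UNIV)"
    by (rule entropy_distr[OF distributed_pmf]) simp
  then show ?thesis using integral_count_space_pmf[of "map_pmf A p"] assms by simp
qed

lemma cond_entropy2_eq:
  fixes A :: "'w \<Rightarrow> 'a::countable" and B :: "'w \<Rightarrow> 'b::countable"
  assumes "finite ((\<lambda>w. (A w, B w)) ` set_pmf p)"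
  shows "cond_entropy2 p A B = - (\<Sum>(a,b)\<in>(\<lambda>w. (A w, B w)) ` set_pmf p.
     pmf (map_pmf (\<lambda>w. (A w, B w)) p) (a,b) *
     log 2 (pmf (map_pmf (\<lambda>w. (A w, B w)) p) (a,b) / pmf (map_pmf B p) b))"
proof -
  interpret information_space "measure_pmf p" 2 by (rule information_space_pmf)
  have "cond_entropy2 p A B = - (\<integral>(a,b). pmf (map_pmf (\<lambda>w. (A w, B w)) p) (a,b) *
     log 2 (pmf (map_pmf (\<lambda>w. (A w, B w)) p) (a,b) / pmf (map_pmf B p) b) \<partial>(count_space UNIV \<Otimes>\<^sub>M count_space UNIV))"
    by (rule conditional_entropy_generic_eq[OF sigma_finite_count_space_UNIV sigma_finite_count_space_UNIV distributed_pmf _ distributed_pmf[of _ "\<lambda>w. (A w, B w)", folded pair_count_space_UNIV]]) simp_all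
  then show ?thesis using integral_count_space_pmf[of "map_pmf (\<lambda>w. (A w, B w)) p" "\<lambda>(a,b). log 2 (pmf (map_pmf (\<lambda>w. (A w, B w)) p) (a,b) / pmf (map_pmf B p) b)"] assms
    by (simp add: pair_count_space_UNIV case_prod_unfold)
qed

lemma mutual_info2_eq:
  fixes A :: "'w \<Rightarrow> 'a::countable" and B :: "'w \<Rightarrow> 'b::countable"
  assumes "finite ((\<lambda>w. (A w, B w)) ` set_pmf p)"
  shows "mutual_info2 p A B = (\<Sum>(a,b)\<in>(\<lambda>w. (A w, B w)) ` set_pmf p.
     pmf (map_pmf (\<lambda>w. (A w, B w)) p) (a,b) *
     log 2 (pmf (map_pmf (\<lambda>w. (A w, B w)) p) (a,b) / (pmf (map_pmf A p) a * pmf (map_pmf B p) b)))"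
proof -
  interpret information_space "measure_pmf p" 2 by (rule information_space_pmf)
  have "mutual_info2 p A B = (\<integral>(a,b). pmf (map_pmf (\<lambda>w. (A w, B w)) p) (a,b) *
     log 2 (pmf (map_pmf (\<lambda>w. (A w, B w)) p) (a,b) / (pmf (map_pmf A p) a * pmf (map_pmf B p) b)) \<partial>(count_space UNIV \<Otimes>\<^sub>M count_space UNIV))"
    by (subst mutual_information_distr[OF sigma_finite_count_space_UNIV sigma_finite_count_space_UNIV distributed_pmf _ distributed_pmf _ distributed_pmf[of _ "\<lambda>w. (A w, B w)", folded pair_count_space_UNIV]]) (simp_all add: case_prod_unfold)
  then show ?thesis using integral_count_space_pmf[of "map_pmf (\<lambda>w. (A w, B w)) p" "\<lambda>(a,b). log 2 (pmf (map_pmf (\<lambda>w. (A w, B w)) p) (a,b) / (pmf (map_pmf A p) a * pmf (map_pmf B p) b))"] assms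
    by (simp add: pair_count_space_UNIV case_prod_unfold)
qed

text \<open>Conditional independence of \<open>A\<close> and \<open>C\<close> given \<open>B\<close>, multiplied out so that values
  of \<open>B\<close> of probability zero impose no condition.\<close>

definition markov_chain ::
    "'w pmf \<Rightarrow> ('w \<Rightarrow> 'a) \<Rightarrow> ('w \<Rightarrow> 'b) \<Rightarrow> ('w \<Rightarrow> 'c) \<Rightarrow> bool" where
  "markov_chain p A B C \<longleftrightarrow>
     (\<forall>a b c. \<P>(w in measure_pmf p. A w = a \<and> B w = b \<and> C w = c) * \<P>(w in measure_pmf p. B w = b)
            = \<P>(w in measure_pmf p. A w = a \<and> B w = b) * \<P>(w in measure_pmf p. B w = b \<and> C w = c))"

definition index_set :: "real \<Rightarrow> nat set" where
  "index_set a = {1..nat \<lfloor>a\<rfloor>}"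

datatype signal = Src | Rec2 | Rec3

text \<open>The tuple of the signals selected by \<open>S\<close>; unselected components are the constant \<open>None\<close>.
  It is used both for single letters and for whole sequences.\<close>

definition select ::
    "signal set \<Rightarrow> 'a \<Rightarrow> 'b \<Rightarrow> 'c \<Rightarrow> 'a option \<times> 'b option \<times> 'c option" where
  "select S x y z =
     (if Src \<in> S then Some x else None,
      if Rec2 \<in> S then Some y else None,
      if Rec3 \<in> S then Some z else None)"


subsection \<open>Communication systems on the cascade network\<close>

datatype ('x, 'y, 'z) block =
  Block (srcs: "'x list") (key: nat) (msg1: nat) (msg2: nat) (recs2: "'y list") (recs3: "'z list")

definition valid_system ::
    "real \<Rightarrow> real \<Rightarrow> real \<Rightarrow> 'x pmf \<Rightarrow> nat \<Rightarrow> ('x, 'y, 'z) block pmf \<Rightarrow> bool" where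
  "valid_system R0 R1 R2 PX n p \<longleftrightarrow>
     map_pmf (\<lambda>w. (srcs w, key w)) p
       = pair_pmf (replicate_pmf n PX) (pmf_of_set (index_set (2 powr (real n * R0)))) \<and>
     (\<forall>w\<in>set_pmf p.
        msg1 w \<in> index_set (2 powr (real n * R1)) \<and>
        msg2 w \<in> index_set (2 powr (real n * R2)) \<and>
        length (recs2 w) = n \<and> length (recs3 w) = n) \<and>
     markov_chain p srcs (\<lambda>w. (msg1 w, key w)) (\<lambda>w. (msg2 w, recs2 w)) \<and>
     markov_chain p (\<lambda>w. (srcs w, msg1 w, recs2 w)) (\<lambda>w. (msg2 w, key w)) recs3"

definition distortion2 :: "('x \<Rightarrow> 'y \<Rightarrow> real) \<Rightarrow> nat \<Rightarrow> ('x, 'y, 'z) block pmf \<Rightarrow> real" where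
  "distortion2 d n p =
     measure_pmf.expectation p (\<lambda>w. (1 / real n) * (\<Sum>t<n. d (srcs w ! t) (recs2 w ! t)))"

definition distortion3 :: "('x \<Rightarrow> 'z \<Rightarrow> real) \<Rightarrow> nat \<Rightarrow> ('x, 'y, 'z) block pmf \<Rightarrow> real" where
  "distortion3 d n p =
     measure_pmf.expectation p (\<lambda>w. (1 / real n) * (\<Sum>t<n. d (srcs w ! t) (recs3 w ! t)))"

definition equivocation :: "signal set \<Rightarrow> nat \<Rightarrow> ('x, 'y, 'z) block pmf \<Rightarrow> real" where
  "equivocation S n p =
     (1 / real n) *
     cond_entropy2 p (\<lambda>w. select S (srcs w) (recs2 w) (recs3 w)) (\<lambda>w. (msg1 w, msg2 w))"

text \<open>
  Taken in the extended reals, so that the supremum is \<open>-\<infinity>\<close> when no system qualifies.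
  When \<open>(D1, D2)\<close> lies on the boundary of the feasible region, this can happen although the
  single-letter problem is feasible: with Hamming distortion and \<open>D1 = 0\<close>, a block code must
  separate all source sequences of positive probability, which rates between the entropy and
  the logarithm of the alphabet size do not allow. There the supremum has to be read as the
  limit of the suprema under distortion constraints \<open>D1 + \<epsilon>\<close>, \<open>D2 + \<epsilon>\<close>.
\<close>

definition sup_equivocation ::
    "real \<Rightarrow> real \<Rightarrow> real \<Rightarrow> 'x pmf \<Rightarrow> ('x \<Rightarrow> 'y \<Rightarrow> real) \<Rightarrow> ('x \<Rightarrow> 'z \<Rightarrow> real)
      \<Rightarrow> signal set \<Rightarrow> real \<Rightarrow> real \<Rightarrow> ereal" where
  "sup_equivocation R0 R1 R2 PX d1 d2 S D1 D2 =
     Sup {ereal (equivocation S n p) | n (p :: ('x, 'y, 'z) block pmf).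
            1 \<le> n \<and> valid_system R0 R1 R2 PX n p \<and>
            distortion2 d1 n p \<le> D1 \<and> distortion3 d2 n p \<le> D2}"


subsection \<open>Single-letter characterisation\<close>

text \<open>Finite-valued auxiliary random variables are, up to relabelling, natural-number-valued.\<close>

datatype ('x, 'y, 'z) letter =
  Letter (src: 'x) (rec2: 'y) (rec3: 'z) (aux1: nat) (aux2: nat)

definition letter_laws ::
    "real \<Rightarrow> real \<Rightarrow> 'x pmf \<Rightarrow> ('x \<Rightarrow> 'y \<Rightarrow> real) \<Rightarrow> ('x \<Rightarrow> 'z \<Rightarrow> real)
      \<Rightarrow> real \<Rightarrow> real \<Rightarrow> ('x, 'y, 'z) letter pmf set" where
  "letter_laws R1 R2 PX d1 d2 D1 D2 =
     {q. finite (aux1 ` set_pmf q) \<and> finite (aux2 ` set_pmf q) \<and>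
         map_pmf src q = PX \<and>
         markov_chain q src aux1 rec2 \<and>
         markov_chain q (\<lambda>w. (src w, aux1 w, rec2 w)) aux2 rec3 \<and>
         cond_entropy2 q aux2 aux1 = 0 \<and>
         measure_pmf.expectation q (\<lambda>w. d1 (src w) (rec2 w)) \<le> D1 \<and>
         measure_pmf.expectation q (\<lambda>w. d2 (src w) (rec3 w)) \<le> D2 \<and>
         mutual_info2 q src aux1 \<le> R1 \<and>
         mutual_info2 q src aux2 \<le> R2}"

definition secrecy_value :: "real \<Rightarrow> signal set \<Rightarrow> ('x, 'y, 'z) letter pmf \<Rightarrow> real" where
  "secrecy_value R0 S q =
     (let sel = (\<lambda>w. select S (src w) (rec2 w) (rec3 w))
      in entropy2 q sel - max 0 (mutual_info2 q sel aux1 - R0))"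

end

theory Submission
  imports Defs
begin

text \<open>
  Given the value of \<open>V1\<close>, the signals \<open>X\<close>, \<open>Y2\<close>, \<open>Y3\<close> are independent, so a law enters the problem only
  through the law of \<open>(X, Y2, Y3)\<close> and the four conditional entropies \<open>H(X|V1)\<close>, \<open>H(Y2|V1)\<close>, \<open>H(Y3|V2)\<close>,
  \<open>H(X|V2)\<close>. The set of these tuples is an iterated convex hull of compact sets, hence compact and
  convex; this yields the maximum and its right-continuity in the distortion levels without bounding the
  alphabets of \<open>V1\<close> and \<open>V2\<close>.

  Converse: the letters of a block system with \<open>V1 = (M1, M2, K)\<close> and \<open>V2 = (M2, K)\<close> satisfy the Markov
  conditions, and averaging their tuples over time stays in the convex region.

  Achievability: random superposition codewords indexed by \<open>(k, i, j)\<close>, a likelihood encoder, \<open>M1 = (i, j)\<close> and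
  \<open>M2 = i\<close>. By Jensen's inequality the expected log-likelihood of a codebook output is governed by the
  conditional mean of that output given one codeword. Applied over \<open>(i, j)\<close>, it shows that the source
  seen through the codebook is nearly the true source; applied over \<open>k\<close>, it bounds the equivocation
  from below by \<open>min (n H(S)) (n R0 + H(S^n|V1^n))\<close> up to \<open>o(n)\<close>.
\<close>

section \<open>Finite expectations and entropy\<close>

text \<open>Two obstacles shape the proof. Time averaging and mixing must stay inside the problem.
  They do because the objective, written as the minimum of H(S) and R0 + H(S|V1), is concave in the
  tuple while every constraint is affine in it; so a plain average of tuples takes the place of a
  time-sharing variable, in the converse as well as in the perturbations that create slack. Next, a
  single codebook has to serve four aims at once: a nearly correct source law, two distortions and
  secrecy. All are controlled by expectations over the random codebook, so one weighted sum of them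
  is optimised, and a large fixed weight forces each penalty down. Exponential decay of the source
  error requires mutual information strictly below the rate, which is impossible at rate zero;
  there, independence of X and the auxiliary variable removes the offending term. The codes
  constructed here meet the distortion constraints only up to a small excess. Hence achievability is
  proved at levels D1 + \<epsilon>, D2 + \<epsilon>, and the final statement follows either from a
  law with room in its distortions or by letting \<epsilon> tend to zero.\<close>

definition ex :: "'a pmf \<Rightarrow> ('a \<Rightarrow> real) \<Rightarrow> real" where
  "ex p f = (\<Sum>a\<in>set_pmf p. pmf p a * f a)"

lemma ex_cong: "p = q \<Longrightarrow> (\<And>a. a \<in> set_pmf q \<Longrightarrow> f a = g a) \<Longrightarrow> ex p f = ex q g"
  unfolding ex_def by (auto intro!: sum.cong)

lemma ex_eq_sum: "finite A \<Longrightarrow> set_pmf p \<subseteq> A \<Longrightarrow> ex p f = (\<Sum>a\<in>A. pmf p a * f a)"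
  unfolding ex_def by (rule sum.mono_neutral_left) (auto simp: set_pmf_iff)

lemma ex_eq_expectation: "finite (set_pmf p) \<Longrightarrow> ex p f = measure_pmf.expectation p f"
  unfolding ex_def by (subst integral_measure_pmf_real[of "set_pmf p"]) (auto simp: mult.commute)

text \<open>The linearity rules carry no finiteness hypothesis: over an infinite support all these
  sums are 0 by convention.\<close>

lemma ex_add: "ex p (\<lambda>a. f a + g a) = ex p f + ex p g"
  unfolding ex_def by (simp add: distrib_left sum.distrib)

lemma ex_diff: "ex p (\<lambda>a. f a - g a) = ex p f - ex p g"
  unfolding ex_def by (simp add: right_diff_distrib sum_subtractf)

lemma ex_cmult: "ex p (\<lambda>a. c * f a) = c * ex p f"
  unfolding ex_def by (simp add: sum_distrib_left mult.left_commute)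

lemma ex_cmult_right: "ex p (\<lambda>a. f a * c) = ex p f * c"
  unfolding ex_def by (simp add: sum_distrib_right mult.assoc)

lemma ex_divide: "ex p (\<lambda>a. f a / c) = ex p f / c"
  using ex_cmult_right[of p f "inverse c"] by (simp add: field_simps)

lemma ex_minus: "ex p (\<lambda>a. - f a) = - ex p f"
  using ex_cmult[of p "-1" f] by simp

lemma ex_sum: "ex p (\<lambda>a. \<Sum>i\<in>I. f i a) = (\<Sum>i\<in>I. ex p (f i))"
  unfolding ex_def by (simp add: sum_distrib_left) (rule sum.swap)

lemma ex_mono: "(\<And>a. a \<in> set_pmf p \<Longrightarrow> f a \<le> g a) \<Longrightarrow> ex p f \<le> ex p g"
  unfolding ex_def by (intro sum_mono mult_left_mono) auto

lemma ex_nonneg: "(\<And>a. a \<in> set_pmf p \<Longrightarrow> 0 \<le> f a) \<Longrightarrow> 0 \<le> ex p f"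
  unfolding ex_def by (intro sum_nonneg mult_nonneg_nonneg) auto

lemma ex_const: "finite (set_pmf p) \<Longrightarrow> ex p (\<lambda>_. c) = c"
  unfolding ex_def by (simp add: sum_distrib_right[symmetric] sum_pmf_eq_1)

lemma ex_return [simp]: "ex (return_pmf x) f = f x"
  unfolding ex_def by simp

lemma ex_map:
  assumes "finite (set_pmf p)"
  shows "ex (map_pmf g p) f = ex p (\<lambda>a. f (g a))"
  using assms by (simp add: ex_eq_expectation)

lemma ex_bind:
  assumes "finite (set_pmf p)" "\<And>x. x \<in> set_pmf p \<Longrightarrow> finite (set_pmf (k x))"
  shows "ex (bind_pmf p k) f = ex p (\<lambda>x. ex (k x) f)"
proof -
  \<comment> \<open>\<open>k\<close> is known to be finitely supported on \<open>set_pmf p\<close>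
    only; \<open>k'\<close> is so everywhere.\<close>
  define k' where "k' x = (if x \<in> set_pmf p then k x else return_pmf undefined)" for x
  have [simp]: "bind_pmf p k = bind_pmf p k'"
    by (rule bind_pmf_cong) (auto simp: k'_def)
  have fin: "finite (set_pmf (k' x))" for x
    using assms by (auto simp: k'_def)
  have "ex (bind_pmf p k) f = measure_pmf.expectation (bind_pmf p k') f"
    using assms fin by (subst ex_eq_expectation) (auto simp del: set_bind_pmf simp: set_bind_pmf[of p k'])
  also have "\<dots> = (\<Sum>a\<in>set_pmf p. pmf p a *\<^sub>R measure_pmf.expectation (k' a) f)"
    using assms fin by (intro pmf_expectation_bind) auto
  also have "\<dots> = ex p (\<lambda>x. ex (k x) f)"
    using assms(2) unfolding ex_def[of p] by (intro sum.cong) (simp_all add: ex_eq_expectation k'_def)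
  finally show ?thesis .
qed

lemma ex_pair:
  assumes "finite (set_pmf p)" "finite (set_pmf q)"
  shows "ex (pair_pmf p q) f = ex p (\<lambda>x. ex q (\<lambda>y. f (x, y)))"
  unfolding pair_pmf_def using assms by (simp add: ex_bind)

lemma ex_swap: "ex p (\<lambda>x. ex q (\<lambda>y. f x y)) = ex q (\<lambda>y. ex p (\<lambda>x. f x y))"
  unfolding ex_def by (simp add: sum_distrib_left) (subst sum.swap, simp add: mult.left_commute)

lemma ex_pmf_of_set:
  assumes "finite A" "A \<noteq> {}"
  shows "ex (pmf_of_set A) f = (\<Sum>a\<in>A. f a) / card A"
  unfolding ex_def using assms by (simp add: sum_divide_distrib)

lemma pmf_bind_ex:
  assumes "finite (set_pmf p)"
  shows "pmf (bind_pmf p k) y = ex p (\<lambda>x. pmf (k x) y)"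
  using assms by (simp add: pmf_bind ex_eq_expectation)

lemma pmf_map_ex:
  assumes "finite (set_pmf p)"
  shows "pmf (map_pmf g p) y = ex p (\<lambda>x. if g x = y then 1 else 0)"
  unfolding map_pmf_def using assms by (auto simp: pmf_bind_ex pmf_return intro!: ex_cong)

lemma pmf_map_ge: "w \<in> set_pmf p \<Longrightarrow> pmf p w \<le> pmf (map_pmf A p) (A w)"
  by (simp add: pmf_map pmf.rep_eq measure_pmf.finite_measure_mono)

lemma pmf_map_pos: "w \<in> set_pmf p \<Longrightarrow> 0 < pmf (map_pmf A p) (A w)"
  by (simp add: pmf_positive)

text \<open>Stands in for Jensen's inequality: for a suitable \<open>m\<close> the last summand has nonpositive mean.\<close>

lemma log2_le_tangent:
  assumes "0 < y" "0 < m"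
  shows "log 2 y \<le> log 2 m + (y / m - 1) / ln 2"
proof -
  have "ln (y / m) \<le> y / m - 1" using assms by (intro ln_le_minus_one) auto
  then have "ln y - ln m \<le> y / m - 1" using assms by (simp add: ln_div)
  then have "(ln y - ln m) / ln 2 \<le> (y / m - 1) / ln 2" by (intro divide_right_mono) auto
  then show ?thesis by (simp add: log_def diff_divide_distrib)
qed

section \<open>Entropy of finitely supported laws\<close>

definition Hp :: "'a pmf \<Rightarrow> real" where
  "Hp p = ex p (\<lambda>a. - log 2 (pmf p a))"

text \<open>Working with the law of \<open>A\<close> leaves its value type free of countability
  constraints, as the abstract coding locales below require.\<close>

abbreviation ent :: "'w pmf \<Rightarrow> ('w \<Rightarrow> 'a) \<Rightarrow> real" where
  "ent p A \<equiv> Hp (map_pmf A p)"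

lemma ent_ex: "finite (set_pmf p) \<Longrightarrow> ent p A = ex p (\<lambda>w. - log 2 (pmf (map_pmf A p) (A w)))"
  unfolding Hp_def by (simp add: ex_map)

text \<open>Gibbs' inequality for subprobability weights: tangents at \<open>pmf p a\<close> bound
  the difference of the two sides by \<open>(sum r - 1) / ln 2\<close>, up to sign nonpositive.
  Submodularity and the cardinality bound both come from a choice of \<open>r\<close>.\<close>

lemma gibbs:
  assumes "finite (set_pmf p)" "\<And>a. a \<in> set_pmf p \<Longrightarrow> 0 < r a" "(\<Sum>a\<in>set_pmf p. r a) \<le> 1"
  shows "Hp p \<le> ex p (\<lambda>a. - log 2 (r a))"
proof -
  have "ex p (\<lambda>a. log 2 (r a)) \<le> ex p (\<lambda>a. log 2 (pmf p a) + (r a / pmf p a - 1) / ln 2)"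
    using assms by (intro ex_mono log2_le_tangent) (auto simp: pmf_positive)
  also have "\<dots> = ex p (\<lambda>a. log 2 (pmf p a)) + (ex p (\<lambda>a. r a / pmf p a) - 1) / ln 2"
    using assms by (simp add: ex_add ex_divide ex_diff ex_const)
  also have "ex p (\<lambda>a. r a / pmf p a) = (\<Sum>a\<in>set_pmf p. r a)"
    unfolding ex_def by (intro sum.cong) (auto simp: set_pmf_iff)
  finally have "ex p (\<lambda>a. log 2 (r a)) \<le> ex p (\<lambda>a. log 2 (pmf p a)) + ((\<Sum>a\<in>set_pmf p. r a) - 1) / ln 2" .
  moreover have "((\<Sum>a\<in>set_pmf p. r a) - 1) / ln 2 \<le> 0"
    using assms by (simp add: divide_nonpos_pos)
  ultimately show ?thesis by (simp add: Hp_def ex_minus)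
qed

lemma Hp_nonneg: "0 \<le> Hp p"
  unfolding Hp_def by (intro ex_nonneg) (simp add: pmf_le_1 pmf_positive)

lemma Hp_le_log_card:
  assumes "finite T" "set_pmf p \<subseteq> T"
  shows "Hp p \<le> log 2 (card T)"
proof -
  have fin: "finite (set_pmf p)" using assms finite_subset by auto
  have "T \<noteq> {}" using assms set_pmf_not_empty by fastforce
  then have c: "0 < card T" using assms by (simp add: card_gt_0_iff)
  have "Hp p \<le> ex p (\<lambda>a. - log 2 (1 / card T))"
    using assms c card_mono[OF assms] by (intro gibbs fin) auto
  then show ?thesis using fin c by (simp add: ex_const log_divide)
qed

lemma Hp_map_inj: "inj_on f (set_pmf p) \<Longrightarrow> finite (set_pmf p) \<Longrightarrow> Hp (map_pmf f p) = Hp p"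
  by (subst ent_ex) (auto simp: Hp_def pmf_map_inj intro!: ex_cong)

lemma Hp_pair:
  assumes "finite (set_pmf p)" "finite (set_pmf q)"
  shows "Hp (pair_pmf p q) = Hp p + Hp q"
proof -
  have "Hp (pair_pmf p q) = ex (pair_pmf p q) (\<lambda>(x, y). - log 2 (pmf p x) + - log 2 (pmf q y))"
    unfolding Hp_def by (intro ex_cong) (auto simp: pmf_pair log_mult pmf_positive set_pmf_iff)
  also have "\<dots> = Hp p + Hp q"
    using assms by (simp add: ex_pair ex_add ex_diff ex_minus ex_const Hp_def)
  finally show ?thesis .
qed

text \<open>Holds pointwise: on the support, the event that fixes \<open>B w\<close> is contained in
  the one that fixes \<open>A w\<close>.\<close>

lemma ent_mono:
  assumes "finite (set_pmf p)" "\<And>w. w \<in> set_pmf p \<Longrightarrow> A w = g (B w)"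
  shows "ent p A \<le> ent p B"
proof -
  have *: "map_pmf A p = map_pmf g (map_pmf B p)"
    unfolding pmf.map_comp by (rule map_pmf_cong) (use assms in auto)
  show ?thesis
    unfolding ent_ex[OF assms(1)]
  proof (intro ex_mono)
    fix w assume w: "w \<in> set_pmf p"
    have "pmf (map_pmf B p) (B w) \<le> pmf (map_pmf A p) (A w)"
      unfolding * assms(2)[OF w] by (rule pmf_map_ge) (use w in auto)
    then show "- log 2 (pmf (map_pmf A p) (A w)) \<le> - log 2 (pmf (map_pmf B p) (B w))"
      using w by (simp add: pmf_map_pos)
  qed
qed

lemma ent_cong_fun:
  assumes "finite (set_pmf p)" "\<And>w. w \<in> set_pmf p \<Longrightarrow> A w = g (B w)"
    "\<And>w. w \<in> set_pmf p \<Longrightarrow> B w = h (A w)"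
  shows "ent p A = ent p B"
  by (rule antisym[OF ent_mono[of p A g B] ent_mono[of p B h A]]) (rule assms; assumption)+

lemma sum_pmf_map_pair:
  assumes "finite A"
    and "finite (set_pmf p)"
  shows "(\<Sum>a\<in>A. pmf (map_pmf (\<lambda>w. (f w, g w)) p) (a, c)) \<le> pmf (map_pmf g p) c"
proof -
  have "(\<Sum>a\<in>A. pmf (map_pmf (\<lambda>w. (f w, g w)) p) (a, c))
      = ex p (\<lambda>w. \<Sum>a\<in>A. if (f w, g w) = (a, c) then 1 else 0)"
    using assms by (simp add: pmf_map_ex ex_sum)
  also have "\<dots> \<le> ex p (\<lambda>w. if g w = c then 1 else 0)"
    using assms(1) by (intro ex_mono) (auto simp: sum.delta' if_distrib cong: if_cong)
  finally show ?thesis using assms by (simp add: pmf_map_ex)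
qed

text \<open>Gibbs' inequality against the weights \<open>r\<close> that keep the laws of (A, C) and
  (B, C) and make A and B independent given C.\<close>

lemma ent_submod:
  assumes fin: "finite (set_pmf p)"
  shows "ent p (\<lambda>w. (A w, B w, C w)) + ent p C \<le> ent p (\<lambda>w. (A w, C w)) + ent p (\<lambda>w. (B w, C w))"
proof -
  let ?P = "map_pmf (\<lambda>w. (A w, B w, C w)) p"
  let ?a = "\<lambda>a c. pmf (map_pmf (\<lambda>w. (A w, C w)) p) (a, c)"
  let ?b = "\<lambda>b c. pmf (map_pmf (\<lambda>w. (B w, C w)) p) (b, c)"
  let ?c = "\<lambda>c. pmf (map_pmf C p) c"
  define r where "r = (\<lambda>(a, b, c). ?a a c * ?b b c / ?c c)"
  have pos: "0 < ?a (A w) (C w)" "0 < ?b (B w) (C w)" "0 < ?c (C w)" if "w \<in> set_pmf p" for w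
    using that pmf_map_pos[of w p "\<lambda>w. (A w, C w)"] pmf_map_pos[of w p "\<lambda>w. (B w, C w)"]
      pmf_map_pos[of w p C] by auto
  let ?SA = "A ` set_pmf p" and ?SB = "B ` set_pmf p" and ?SC = "C ` set_pmf p"
  have rn: "0 \<le> r x" for x by (auto simp: r_def split: prod.splits)
  have "(\<Sum>x\<in>set_pmf ?P. r x) \<le> (\<Sum>x\<in>?SA \<times> ?SB \<times> ?SC. r x)"
    using fin rn by (intro sum_mono2) auto
  also have "\<dots> = (\<Sum>c\<in>?SC. \<Sum>a\<in>?SA. \<Sum>b\<in>?SB. r (a, b, c))"
  proof -
    have "(\<Sum>x\<in>?SA \<times> ?SB \<times> ?SC. r x) = (\<Sum>a\<in>?SA. \<Sum>b\<in>?SB. \<Sum>c\<in>?SC. r (a, b, c))"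
      by (simp add: sum.cartesian_product')
    also have "\<dots> = (\<Sum>a\<in>?SA. \<Sum>c\<in>?SC. \<Sum>b\<in>?SB. r (a, b, c))"
      by (intro sum.cong refl sum.swap)
    finally show ?thesis by (simp add: sum.swap[of _ ?SC])
  qed
  also have "\<dots> = (\<Sum>c\<in>?SC. (\<Sum>a\<in>?SA. ?a a c) * (\<Sum>b\<in>?SB. ?b b c) / ?c c)"
    unfolding r_def by (simp add: sum_product sum_divide_distrib)
  also have "\<dots> \<le> (\<Sum>c\<in>?SC. ?c c * ?c c / ?c c)"
    using fin by (intro sum_mono divide_right_mono mult_mono sum_pmf_map_pair sum_nonneg) auto
  also have "\<dots> = (\<Sum>c\<in>?SC. ?c c)" by (intro sum.cong) auto
  also have "\<dots> = 1" using fin by (intro sum_pmf_eq_1) auto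
  finally have "Hp ?P \<le> ex ?P (\<lambda>x. - log 2 (r x))"
    using fin pos by (intro gibbs) (auto simp: r_def)
  also have "\<dots> = ex p (\<lambda>w. - log 2 (?a (A w) (C w)) + - log 2 (?b (B w) (C w)) - - log 2 (?c (C w)))"
    using fin pos by (subst ex_map) (auto simp: r_def log_mult log_divide order_less_imp_not_eq2 intro!: ex_cong)
  also have "\<dots> = ent p (\<lambda>w. (A w, C w)) + ent p (\<lambda>w. (B w, C w)) - ent p C"
    using fin by (simp only: ex_add ex_diff ent_ex)
  finally show ?thesis by simp
qed

lemma Hp_return [simp]: "Hp (return_pmf x) = 0"
  by (simp add: Hp_def)

lemma ent_subadd:
  assumes fin: "finite (set_pmf p)"
  shows "ent p (\<lambda>w. (A w, B w)) \<le> ent p A + ent p B"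
proof -
  have "ent p (\<lambda>w. (A w, B w)) \<le> ent p (\<lambda>w. (A w, B w, ()))"
    by (rule ent_mono[OF fin, where g="\<lambda>(a,b,_). (a,b)"]) simp
  moreover have "ent p (\<lambda>w. (A w, ())) \<le> ent p A" "ent p (\<lambda>w. (B w, ())) \<le> ent p B"
    by (rule ent_mono[OF fin, where g="\<lambda>a. (a,())"], simp)+
  moreover have "0 \<le> ent p (\<lambda>_. ())" by (rule Hp_nonneg)
  ultimately show ?thesis using ent_submod[OF fin, of A B "\<lambda>_. ()"] by linarith
qed

section \<open>Markov chains, and the information measures of the statement in terms of
  \<open>ent\<close>\<close>

lemma pmf_map_prob: "pmf (map_pmf A p) a = \<P>(w in measure_pmf p. A w = a)"
  by (simp add: pmf_map vimage_def)

lemma markov_chain_pmf: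
  "markov_chain p A B C \<longleftrightarrow>
     (\<forall>a b c. pmf (map_pmf (\<lambda>w. (A w, B w, C w)) p) (a, b, c) * pmf (map_pmf B p) b
            = pmf (map_pmf (\<lambda>w. (A w, B w)) p) (a, b) * pmf (map_pmf (\<lambda>w. (B w, C w)) p) (b, c))"
  unfolding markov_chain_def pmf_map_prob by simp

text \<open>The equality case of \<open>ent_submod\<close>: the factorisation makes the logarithms
  agree pointwise.\<close>

lemma ent_markov:
  assumes fin: "finite (set_pmf p)" and m: "markov_chain p A B C"
  shows "ent p (\<lambda>w. (A w, B w, C w)) + ent p B = ent p (\<lambda>w. (A w, B w)) + ent p (\<lambda>w. (B w, C w))"
  unfolding ent_ex[OF fin] ex_add[symmetric]
proof (rule ex_cong[OF refl])
  fix w assume w: "w \<in> set_pmf p"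
  note pos = pmf_map_pos[OF w]
  have "pmf (map_pmf (\<lambda>w. (A w, B w, C w)) p) (A w, B w, C w) * pmf (map_pmf B p) (B w)
      = pmf (map_pmf (\<lambda>w. (A w, B w)) p) (A w, B w) * pmf (map_pmf (\<lambda>w. (B w, C w)) p) (B w, C w)"
    using m unfolding markov_chain_pmf by blast
  then have "log 2 (pmf (map_pmf (\<lambda>w. (A w, B w, C w)) p) (A w, B w, C w) * pmf (map_pmf B p) (B w))
      = log 2 (pmf (map_pmf (\<lambda>w. (A w, B w)) p) (A w, B w) * pmf (map_pmf (\<lambda>w. (B w, C w)) p) (B w, C w))" by simp
  then show "- log 2 (pmf (map_pmf (\<lambda>w. (A w, B w, C w)) p) (A w, B w, C w)) + - log 2 (pmf (map_pmf B p) (B w))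
     = - log 2 (pmf (map_pmf (\<lambda>w. (A w, B w)) p) (A w, B w)) + - log 2 (pmf (map_pmf (\<lambda>w. (B w, C w)) p) (B w, C w))"
    using pos[of "\<lambda>w. (A w, B w, C w)"] pos[of B] pos[of "\<lambda>w. (A w, B w)"] pos[of "\<lambda>w. (B w, C w)"]
    by (simp add: log_mult)
qed

lemma markov_chain_map:
  "markov_chain (map_pmf h p) A B C \<longleftrightarrow> markov_chain p (\<lambda>w. A (h w)) (\<lambda>w. B (h w)) (\<lambda>w. C (h w))"
  unfolding markov_chain_pmf by (simp add: pmf.map_comp o_def)

lemma entropy2_ent:
  fixes A :: "'w \<Rightarrow> 'a::countable"
  assumes "finite (set_pmf p)"
  shows "entropy2 p A = ent p A"
  using assms by (simp add: entropy2_eq Hp_def ex_def sum_negf)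

lemma cond_entropy2_ent:
  fixes A :: "'w \<Rightarrow> 'a::countable" and B :: "'w \<Rightarrow> 'b::countable"
  assumes fin: "finite (set_pmf p)"
  shows "cond_entropy2 p A B = ent p (\<lambda>w. (A w, B w)) - ent p B"
proof -
  let ?P = "map_pmf (\<lambda>w. (A w, B w)) p"
  have "cond_entropy2 p A B = - ex ?P (\<lambda>x. log 2 (pmf ?P x / pmf (map_pmf B p) (snd x)))"
    using fin by (simp add: cond_entropy2_eq ex_def case_prod_unfold)
  also have "\<dots> = - ex p (\<lambda>w. log 2 (pmf ?P (A w, B w) / pmf (map_pmf B p) (B w)))"
    using fin by (simp add: ex_map)
  also have "\<dots> = - ex p (\<lambda>w. - (- log 2 (pmf ?P (A w, B w))) - - (- log 2 (pmf (map_pmf B p) (B w))))"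
  proof (intro arg_cong[of _ _ uminus] ex_cong refl)
    fix w assume w: "w \<in> set_pmf p"
    show "log 2 (pmf ?P (A w, B w) / pmf (map_pmf B p) (B w))
      = - (- log 2 (pmf ?P (A w, B w))) - - (- log 2 (pmf (map_pmf B p) (B w)))"
      using pmf_map_pos[OF w, of "\<lambda>w. (A w, B w)"] pmf_map_pos[OF w, of B]
      by (simp add: log_divide)
  qed
  also have "\<dots> = ent p (\<lambda>w. (A w, B w)) - ent p B"
    using fin by (simp only: ex_diff ent_ex ex_minus)
  finally show ?thesis .
qed

lemma mutual_info2_ent:
  fixes A :: "'w \<Rightarrow> 'a::countable" and B :: "'w \<Rightarrow> 'b::countable"
  assumes fin: "finite (set_pmf p)"
  shows "mutual_info2 p A B = ent p A + ent p B - ent p (\<lambda>w. (A w, B w))"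
proof -
  let ?P = "map_pmf (\<lambda>w. (A w, B w)) p"
  have "mutual_info2 p A B = ex ?P (\<lambda>x. log 2 (pmf ?P x / (pmf (map_pmf A p) (fst x) * pmf (map_pmf B p) (snd x))))"
    using fin by (simp add: mutual_info2_eq ex_def case_prod_unfold)
  also have "\<dots> = ex p (\<lambda>w. log 2 (pmf ?P (A w, B w) / (pmf (map_pmf A p) (A w) * pmf (map_pmf B p) (B w))))"
    using fin by (simp add: ex_map)
  also have "\<dots> = ex p (\<lambda>w. (- log 2 (pmf (map_pmf A p) (A w)) + - log 2 (pmf (map_pmf B p) (B w)))
         - - log 2 (pmf ?P (A w, B w)))"
  proof (intro ex_cong refl)
    fix w assume w: "w \<in> set_pmf p"
    show "log 2 (pmf ?P (A w, B w) / (pmf (map_pmf A p) (A w) * pmf (map_pmf B p) (B w)))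
      = (- log 2 (pmf (map_pmf A p) (A w)) + - log 2 (pmf (map_pmf B p) (B w)))
         - - log 2 (pmf ?P (A w, B w))"
      using pmf_map_pos[OF w, of "\<lambda>w. (A w, B w)"] pmf_map_pos[OF w, of B] pmf_map_pos[OF w, of A]
      by (simp add: log_divide log_mult)
  qed
  also have "\<dots> = ent p A + ent p B - ent p (\<lambda>w. (A w, B w))"
    using fin by (simp only: ex_diff ex_add ent_ex)
  finally show ?thesis .
qed

section \<open>Structured single-letter laws\<close>

lemma pmf_bind_Pair:
  assumes "finite (set_pmf P)"
  shows "pmf (bind_pmf P (\<lambda>u. map_pmf (Pair u) (k u))) (u, x) = pmf P u * pmf (k u) x"
proof -
  have "pmf (map_pmf (Pair u') (k u')) (u, x) = (if u' = u then pmf (k u) x else 0)" for u'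
    using pmf_map_inj'[of "Pair u'" "k u'" x] by (auto simp: inj_def intro!: pmf_map_outside)
  then show ?thesis
    unfolding pmf_bind_ex[OF assms] ex_def using assms
    by (simp only: if_distrib[of "\<lambda>t. _ * t"] mult_zero_right sum.delta) (simp add: set_pmf_iff)
qed

text \<open>The chain rule H(U, X) = H(U) + H(X|U) for a law given by sampling.\<close>

lemma Hp_bind_Pair:
  assumes fin: "finite (set_pmf P)" "\<And>u. u \<in> set_pmf P \<Longrightarrow> finite (set_pmf (k u))"
  shows "Hp (bind_pmf P (\<lambda>u. map_pmf (Pair u) (k u))) = Hp P + ex P (\<lambda>u. Hp (k u))"
proof -
  have "Hp (bind_pmf P (\<lambda>u. map_pmf (Pair u) (k u)))
      = ex P (\<lambda>u. ex (k u) (\<lambda>x. - log 2 (pmf P u * pmf (k u) x)))"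
    unfolding Hp_def[of "bind_pmf _ _"] using fin
    by (simp add: ex_bind ex_map pmf_bind_Pair cong: ex_cong)
  also have "\<dots> = ex P (\<lambda>u. ex (k u) (\<lambda>x. - log 2 (pmf P u) + - log 2 (pmf (k u) x)))"
    by (intro ex_cong refl) (simp add: log_mult pmf_positive set_pmf_iff)
  also have "\<dots> = Hp P + ex P (\<lambda>u. Hp (k u))"
    using fin by (simp add: ex_add ex_diff ex_const Hp_def ex_minus cong: ex_cong)
  finally show ?thesis .
qed

lemma pmf_kernel:
  assumes fin: "finite (set_pmf r)"
  shows "pmf (bind_pmf r (\<lambda>s. map_pmf (\<lambda>c. (a s, b s, c)) (k (b s)))) (x, y, z)
    = pmf (map_pmf (\<lambda>s. (a s, b s)) r) (x, y) * pmf (k y) z"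
proof -
  have "pmf (map_pmf (\<lambda>c. (a s, b s, c)) (k (b s))) (x, y, z) = (if (a s, b s) = (x, y) then 1 else 0) * pmf (k y) z" for s
    using pmf_map_inj'[of "\<lambda>c. (a s, b s, c)" "k (b s)" z]
    by (auto simp: inj_def intro!: pmf_map_outside)
  then show ?thesis using fin by (simp only: pmf_bind_ex ex_cmult_right pmf_map_ex)
qed

text \<open>Sampling criterion: a last coordinate drawn from a kernel that sees only the middle one
  is independent of the first given the middle one. Markov conditions of constructed laws thereby
  reduce to rewriting with \<open>bind_pmf\<close>.\<close>

lemma markov_kernel:
  assumes fin: "finite (set_pmf r)"
    and eq: "map_pmf (\<lambda>w. (A w, B w, C w)) p = bind_pmf r (\<lambda>s. map_pmf (\<lambda>c. (a s, b s, c)) (k (b s)))"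
  shows "markov_chain p A B C"
proof -
  have 1: "map_pmf (\<lambda>w. (A w, B w)) p = map_pmf (\<lambda>s. (a s, b s)) r"
  proof -
    have "map_pmf (\<lambda>w. (A w, B w)) p = map_pmf (\<lambda>(a, b, c). (a, b)) (map_pmf (\<lambda>w. (A w, B w, C w)) p)"
      by (simp add: pmf.map_comp o_def)
    then show ?thesis by (simp add: eq map_bind_pmf pmf.map_comp o_def map_pmf_def[symmetric] map_pmf_const)
  qed
  have 2: "map_pmf B p = map_pmf b r"
  proof -
    have "map_pmf B p = map_pmf snd (map_pmf (\<lambda>w. (A w, B w)) p)"
      by (simp add: pmf.map_comp o_def)
    then show ?thesis by (simp add: 1 pmf.map_comp o_def)
  qed
  have 3: "pmf (map_pmf (\<lambda>w. (A w, B w, C w)) p) (x, y, z) = pmf (map_pmf (\<lambda>s. (a s, b s)) r) (x, y) * pmf (k y) z" for x y z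
    unfolding eq by (rule pmf_kernel[OF fin])
  have 4: "pmf (map_pmf (\<lambda>w. (B w, C w)) p) (y, z) = pmf (map_pmf b r) y * pmf (k y) z" for y z
  proof -
    have "map_pmf (\<lambda>w. (B w, C w)) p = map_pmf snd (map_pmf (\<lambda>w. (A w, B w, C w)) p)"
      by (simp add: pmf.map_comp o_def)
    then have *: "map_pmf (\<lambda>w. (B w, C w)) p = bind_pmf r (\<lambda>s. map_pmf (Pair (b s)) (k (b s)))"
      by (simp add: eq map_bind_pmf pmf.map_comp o_def)
    have "pmf (map_pmf (Pair (b s)) (k (b s))) (y, z) = (if b s = y then 1 else 0) * pmf (k y) z" for s
      using pmf_map_inj'[of "Pair (b s)" "k (b s)" z]
      by (auto simp: inj_def intro!: pmf_map_outside)
    then show ?thesis using fin by (simp only: * pmf_bind_ex ex_cmult_right pmf_map_ex)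
  qed
  show ?thesis
    unfolding markov_chain_pmf 1 2 3 4 by simp
qed

text \<open>The point mass off the support turns the conditional law into a total kernel that is
  finitely supported everywhere.\<close>

definition cond_law :: "'w pmf \<Rightarrow> ('w \<Rightarrow> 'a) \<Rightarrow> ('w \<Rightarrow> 'b) \<Rightarrow> 'b \<Rightarrow> 'a pmf" where
  "cond_law q A B v =
     (if v \<in> B ` set_pmf q then map_pmf A (cond_pmf q {w. B w = v}) else return_pmf undefined)"

lemma finite_cond_law [simp]:
  assumes "finite (set_pmf q)" shows "finite (set_pmf (cond_law q A B v))"
proof (cases "v \<in> B ` set_pmf q")
  case True
  then have "set_pmf q \<inter> {w. B w = v} \<noteq> {}" by auto
  then show ?thesis using assms True by (simp add: cond_law_def)
qed (simp add: cond_law_def)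

text \<open>The product form of Bayes' rule also covers values \<open>v\<close> of probability zero,
  where both sides vanish.\<close>

lemma pmf_cond_law:
  assumes fin: "finite (set_pmf q)"
  shows "pmf (map_pmf B q) v * pmf (cond_law q A B v) x = pmf (map_pmf (\<lambda>w. (A w, B w)) q) (x, v)"
proof (cases "v \<in> B ` set_pmf q")
  case True
  then have ne: "set_pmf q \<inter> {w. B w = v} \<noteq> {}" by auto
  let ?m = "measure (measure_pmf q) {w. B w = v}"
  have m: "pmf (map_pmf B q) v = ?m" by (simp add: pmf_map_prob)
  have pos: "?m \<noteq> 0" using True unfolding m[symmetric] by (simp add: set_pmf_iff[symmetric])
  have "pmf (cond_law q A B v) x = ex (cond_pmf q {w. B w = v}) (\<lambda>w. if A w = x then 1 else 0)"
    using True fin ne by (simp add: cond_law_def pmf_map_ex)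
  also have "\<dots> = (\<Sum>w\<in>set_pmf q. pmf (cond_pmf q {w. B w = v}) w * (if A w = x then 1 else 0))"
    using fin ne by (intro ex_eq_sum) auto
  also have "\<dots> = (\<Sum>w\<in>set_pmf q. pmf q w * (if (A w, B w) = (x, v) then 1 else 0) / ?m)"
    using ne by (intro sum.cong) (auto simp: pmf_cond)
  also have "\<dots> = pmf (map_pmf (\<lambda>w. (A w, B w)) q) (x, v) / ?m"
    using fin by (simp only: pmf_map_ex ex_def sum_divide_distrib)
  finally show ?thesis using pos by (simp add: m)
next
  case False
  then have "pmf (map_pmf B q) v = 0" by (simp add: set_pmf_iff[symmetric] pmf_eq_0_set_pmf)
  moreover have "pmf (map_pmf (\<lambda>w. (A w, B w)) q) (x, v) = 0"
    using False by (auto simp: pmf_eq_0_set_pmf)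
  ultimately show ?thesis by simp
qed

lemma cond_law_subset: "v \<in> B ` set_pmf q \<Longrightarrow> set_pmf (cond_law q A B v) \<subseteq> A ` (set_pmf q \<inter> {w. B w = v})"
  unfolding cond_law_def by (subst if_P, assumption, subst set_map_pmf, subst set_cond_pmf) auto

text \<open>The generic law: V2 = u, then V1 = v given u, then X and Y2 from v and Y3 from u, all
  independently. Both Markov conditions are built into the order of sampling.\<close>

definition joint_law ::
  "nat pmf \<Rightarrow> (nat \<Rightarrow> nat pmf) \<Rightarrow> (nat \<Rightarrow> 'x pmf) \<Rightarrow> (nat \<Rightarrow> 'y pmf) \<Rightarrow> (nat \<Rightarrow> 'z pmf)
    \<Rightarrow> (nat \<times> nat \<times> 'x \<times> 'y \<times> 'z) pmf" where
  "joint_law P2 P1 a b c = bind_pmf P2 (\<lambda>u. map_pmf (Pair u) (bind_pmf (P1 u)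
     (\<lambda>v. map_pmf (Pair v) (pair_pmf (a v) (pair_pmf (b v) (c u))))))"

definition letter_law ::
  "nat pmf \<Rightarrow> (nat \<Rightarrow> nat pmf) \<Rightarrow> (nat \<Rightarrow> 'x pmf) \<Rightarrow> (nat \<Rightarrow> 'y pmf) \<Rightarrow> (nat \<Rightarrow> 'z pmf)
    \<Rightarrow> ('x, 'y, 'z) letter pmf" where
  "letter_law P2 P1 a b c = map_pmf (\<lambda>(u, v, x, y, z). Letter x y z v u) (joint_law P2 P1 a b c)"

lemma pmf_letter_law:
  assumes "finite (set_pmf P2)" "\<And>u. finite (set_pmf (P1 u))"
  shows "pmf (letter_law P2 P1 a b c) (Letter x y z v u)
     = pmf P2 u * (pmf (P1 u) v * (pmf (a v) x * (pmf (b v) y * pmf (c u) z)))"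
proof -
  have "inj (\<lambda>(u, v, x, y, z). Letter x y z v u)" by (auto simp: inj_def)
  from pmf_map_inj'[OF this, of "joint_law P2 P1 a b c" "(u, v, x, y, z)"] show ?thesis
    using assms by (simp add: letter_law_def joint_law_def pmf_bind_Pair pmf_pair)
qed

text \<open>A vanishing mean of nonnegative terms makes each term vanish, so P(v2, v1) = P(v1) on
  the support; two values of V2 over one value of V1 would exceed that mass.\<close>

lemma aux2_fun_of_aux1:
  fixes q :: "('x, 'y, 'z) letter pmf"
  assumes fin: "finite (set_pmf q)" and "cond_entropy2 q aux2 aux1 = 0"
  obtains f where "\<And>w. w \<in> set_pmf q \<Longrightarrow> aux2 w = f (aux1 w)"
proof -
  let ?J = "map_pmf (\<lambda>w. (aux2 w, aux1 w)) q" and ?M = "map_pmf aux1 q"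
  have le: "pmf ?J (aux2 w, aux1 w) \<le> pmf ?M (aux1 w)" for w
    using fin by (auto simp: pmf_map_ex intro!: ex_mono)
  have "ex q (\<lambda>w. - log 2 (pmf ?J (aux2 w, aux1 w)) - - log 2 (pmf ?M (aux1 w))) = 0"
    using assms(2) unfolding cond_entropy2_ent[OF fin] ent_ex[OF fin] ex_diff .
  moreover have nn: "0 \<le> - log 2 (pmf ?J (aux2 w, aux1 w)) - - log 2 (pmf ?M (aux1 w))" if "w \<in> set_pmf q" for w
    using le[of w] pmf_map_pos[OF that, of "\<lambda>w. (aux2 w, aux1 w)"] by simp
  ultimately have z: "- log 2 (pmf ?J (aux2 w, aux1 w)) - - log 2 (pmf ?M (aux1 w)) = 0" if "w \<in> set_pmf q" for w
    using that fin unfolding ex_def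
    by (subst (asm) sum_nonneg_eq_0_iff) (auto simp: set_pmf_iff)
  have eq: "pmf ?J (aux2 w, aux1 w) = pmf ?M (aux1 w)" if w: "w \<in> set_pmf q" for w
  proof (rule inj_onD[OF log_inj[of 2]])
    show "log 2 (pmf ?J (aux2 w, aux1 w)) = log 2 (pmf ?M (aux1 w))"
      using z[OF w] by linarith
  qed (use pmf_map_pos[OF w, of "\<lambda>w. (aux2 w, aux1 w)"] pmf_map_pos[OF w, of aux1] in simp_all)
  have uniq: "aux2 w = aux2 w'" if w: "w \<in> set_pmf q" and w': "w' \<in> set_pmf q" and e: "aux1 w = aux1 w'" for w w'
  proof (rule ccontr)
    assume ne: "aux2 w \<noteq> aux2 w'"
    have "pmf ?J (aux2 w, aux1 w) + pmf ?J (aux2 w', aux1 w) \<le> pmf ?M (aux1 w)"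
      using fin ne by (auto simp: pmf_map_ex ex_add[symmetric] intro!: ex_mono)
    then show False using eq[OF w] pmf_map_pos[OF w', of "\<lambda>w. (aux2 w, aux1 w)"] e by simp
  qed
  define f where "f v = aux2 (SOME w. w \<in> set_pmf q \<and> aux1 w = v)" for v
  have "aux2 w = f (aux1 w)" if w: "w \<in> set_pmf q" for w
    unfolding f_def using someI[of "\<lambda>w'. w' \<in> set_pmf q \<and> aux1 w' = aux1 w" w] w
    by (intro uniq) auto
  then show ?thesis by (rule that)
qed

text \<open>The two Markov conditions factor the joint pmf, and V2 being a function of V1 lets the
  chain start at V2 and continue to V1.\<close>

lemma eq_letter_law:
  fixes q :: "('x, 'y, 'z) letter pmf"
  assumes fin: "finite (set_pmf q)"
    and m1: "markov_chain q src aux1 rec2"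
    and m2: "markov_chain q (\<lambda>w. (src w, aux1 w, rec2 w)) aux2 rec3"
    and f: "\<And>w. w \<in> set_pmf q \<Longrightarrow> aux2 w = f (aux1 w)"
  shows "q = letter_law (map_pmf aux2 q) (cond_law q aux1 aux2) (cond_law q src aux1)
      (cond_law q rec2 aux1) (cond_law q rec3 aux2)" (is "q = ?l")
proof (rule pmf_eqI)
  fix l :: "('x, 'y, 'z) letter"
  obtain x y z v u where l: "l = Letter x y z v u" by (cases l)
  note cl = pmf_cond_law[OF fin]
  let ?P = "\<lambda>A a. pmf (map_pmf A q) a"
  have ql: "pmf q l = ?P (\<lambda>w. ((src w, aux1 w, rec2 w), aux2 w, rec3 w)) ((x, v, y), u, z)"
    using pmf_map_inj'[of "\<lambda>w. ((src w, aux1 w, rec2 w), aux2 w, rec3 w)" q l]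
    by (simp add: l inj_def letter.expand)
  have pl: "pmf ?l l = ?P aux2 u * (pmf (cond_law q aux1 aux2 u) v * (pmf (cond_law q src aux1 v) x
     * (pmf (cond_law q rec2 aux1 v) y * pmf (cond_law q rec3 aux2 u) z)))"
    using fin by (simp add: l pmf_letter_law)
  show "pmf q l = pmf ?l l"
  proof (cases "\<exists>w\<in>set_pmf q. aux1 w = v \<and> aux2 w = u")
    case False
    then have "?P (\<lambda>w. (aux1 w, aux2 w)) (v, u) = 0" by (auto simp: pmf_eq_0_set_pmf)
    then have "pmf ?l l = 0" using cl[of aux2 u aux1 v] by (auto simp: pl)
    moreover have "pmf q l = 0" using False by (force simp: pmf_eq_0_set_pmf l)
    ultimately show ?thesis by simp
  next
    case True
    then obtain w0 where w0: "w0 \<in> set_pmf q" "aux1 w0 = v" "aux2 w0 = u" by auto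
    have u: "u = f v" using f w0 by auto
    have pv: "?P aux1 v > 0" using pmf_map_pos[OF w0(1), of aux1] w0 by simp
    have pu: "?P aux2 u > 0" using pmf_map_pos[OF w0(1), of aux2] w0 by simp
    have e1: "?P (\<lambda>w. (aux1 w, aux2 w)) (v, u) = ?P aux1 v"
      using fin f by (auto simp: pmf_map_ex u intro!: ex_cong)
    have e2: "?P (\<lambda>w. ((src w, aux1 w, rec2 w), aux2 w)) ((x, v, y), u) = ?P (\<lambda>w. (src w, aux1 w, rec2 w)) (x, v, y)"
      using fin f by (auto simp: pmf_map_ex u intro!: ex_cong)
    have e3: "?P (\<lambda>w. (rec3 w, aux2 w)) (z, u) = ?P (\<lambda>w. (aux2 w, rec3 w)) (u, z)"
      "?P (\<lambda>w. (rec2 w, aux1 w)) (y, v) = ?P (\<lambda>w. (aux1 w, rec2 w)) (v, y)"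
      using fin by (auto simp: pmf_map_ex intro!: ex_cong)
    have k1: "?P (\<lambda>w. (src w, aux1 w, rec2 w)) (x, v, y) * ?P aux1 v
      = ?P (\<lambda>w. (src w, aux1 w)) (x, v) * ?P (\<lambda>w. (aux1 w, rec2 w)) (v, y)"
      using m1 unfolding markov_chain_pmf by blast
    have k2: "pmf q l * ?P aux2 u
      = ?P (\<lambda>w. (src w, aux1 w, rec2 w)) (x, v, y) * ?P (\<lambda>w. (aux2 w, rec3 w)) (u, z)"
      using m2 unfolding markov_chain_pmf ql e2[symmetric] by blast
    define a b c d where "a = pmf (cond_law q src aux1 v) x" and "b = pmf (cond_law q rec2 aux1 v) y"
      and "c = pmf (cond_law q rec3 aux2 u) z" and "d = pmf (cond_law q aux1 aux2 u) v"
    have A: "?P aux1 v * a = ?P (\<lambda>w. (src w, aux1 w)) (x, v)" unfolding a_def by (rule cl)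
    have B: "?P aux1 v * b = ?P (\<lambda>w. (aux1 w, rec2 w)) (v, y)" unfolding b_def cl e3 ..
    have C: "?P aux2 u * c = ?P (\<lambda>w. (aux2 w, rec3 w)) (u, z)" unfolding c_def cl e3 ..
    have D: "?P aux2 u * d = ?P aux1 v" unfolding d_def cl e1 ..
    have "?P (\<lambda>w. (src w, aux1 w, rec2 w)) (x, v, y) = ?P aux1 v * a * b"
      using k1 pv unfolding A[symmetric] B[symmetric] by simp
    then have "pmf q l = ?P aux1 v * a * b * c"
      using k2 pu unfolding C[symmetric] by simp
    then show ?thesis unfolding pl using D
      by (simp add: a_def b_def c_def d_def mult.assoc[symmetric])
  qed
qed

lemma finite_letter_law:
  assumes "finite (set_pmf P2)" "\<And>u. finite (set_pmf (P1 u))"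
    "\<And>v. finite (set_pmf (a v))" "\<And>v. finite (set_pmf (b v))" "\<And>v. finite (set_pmf (c v))"
  shows "finite (set_pmf (letter_law P2 P1 a b c))"
  using assms unfolding letter_law_def joint_law_def by (auto simp: set_pair_pmf)

text \<open>\<open>sep\<close> lets the value of V2 be read off that of V1, which is the condition
  H(V2|V1) = 0.\<close>

locale kernels =
  fixes P2 :: "nat pmf" and P1 :: "nat \<Rightarrow> nat pmf"
    and a :: "nat \<Rightarrow> 'x::finite pmf" and b :: "nat \<Rightarrow> 'y::finite pmf" and c :: "nat \<Rightarrow> 'z::finite pmf"
    and f :: "nat \<Rightarrow> nat"
  assumes fin2 [simp]: "finite (set_pmf P2)" and fin1 [simp]: "\<And>u. finite (set_pmf (P1 u))"
    and sep: "\<And>u v. u \<in> set_pmf P2 \<Longrightarrow> v \<in> set_pmf (P1 u) \<Longrightarrow> f v = u"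
begin

abbreviation "q \<equiv> letter_law P2 P1 a b c"

lemma fin_q [simp]: "finite (set_pmf q)"
  by (rule finite_letter_law) auto

lemma map_q: "map_pmf g q = bind_pmf P2 (\<lambda>u. bind_pmf (P1 u)
     (\<lambda>v. map_pmf (\<lambda>(x, y, z). g (Letter x y z v u)) (pair_pmf (a v) (pair_pmf (b v) (c u)))))"
  unfolding letter_law_def joint_law_def
  by (simp add: map_bind_pmf pmf.map_comp o_def case_prod_unfold)

lemma aux2_q: "w \<in> set_pmf q \<Longrightarrow> aux2 w = f (aux1 w)"
  using sep by (auto simp: letter_law_def joint_law_def)

lemma map_fst_pair: "map_pmf (\<lambda>(x, y). h x) (pair_pmf p r) = map_pmf h p"
  using pmf.map_comp[of h fst "pair_pmf p r"] by (simp add: map_fst_pair_pmf o_def case_prod_unfold)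

lemma map_fst_pair3: "map_pmf (\<lambda>(x, y, z). h x) (pair_pmf p r) = map_pmf h p"
  using map_fst_pair[of h p r] by (simp add: case_prod_unfold)

lemma map_q_aux1:
  "map_pmf (\<lambda>w. (aux1 w, g (src w) (rec2 w) (rec3 w))) q
    = bind_pmf (bind_pmf P2 P1) (\<lambda>v. map_pmf (Pair v)
        (map_pmf (\<lambda>(x, y, z). g x y z) (pair_pmf (a v) (pair_pmf (b v) (c (f v))))))"
  unfolding map_q bind_assoc_pmf
  by (intro bind_pmf_cong refl) (simp add: sep pmf.map_comp o_def case_prod_unfold)

lemma map_q_src: "map_pmf src q = bind_pmf P2 (\<lambda>u. bind_pmf (P1 u) a)"
  unfolding map_q by (simp add: map_fst_pair3)

lemma map_q_src_aux2: "map_pmf (\<lambda>w. (aux2 w, src w)) q = bind_pmf P2 (\<lambda>u. map_pmf (Pair u) (bind_pmf (P1 u) a))"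
  unfolding map_q by (simp add: map_fst_pair3 map_bind_pmf)

lemma map_q_aux1': "map_pmf aux1 q = bind_pmf P2 P1"
  unfolding map_q by (simp add: case_prod_unfold map_pmf_const bind_return_pmf')

lemma map_q_aux2: "map_pmf aux2 q = P2"
  unfolding map_q by (simp add: case_prod_unfold map_pmf_const bind_return_pmf')

lemma markov1: "markov_chain q src aux1 rec2"
proof (rule markov_kernel)
  let ?r = "bind_pmf P2 (\<lambda>u. bind_pmf (P1 u) (\<lambda>v. map_pmf (\<lambda>x. (x, v)) (a v)))"
  show "finite (set_pmf ?r)" by auto
  have "map_pmf (\<lambda>(x, y, z). (x, v, y)) (pair_pmf (a v) (pair_pmf (b v) (c u)))
      = bind_pmf (a v) (\<lambda>x. map_pmf (\<lambda>y. (x, v, y)) (b v))" for u v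
    unfolding map_pmf_def pair_pmf_def by (simp add: bind_assoc_pmf bind_return_pmf)
  then show "map_pmf (\<lambda>w. (src w, aux1 w, rec2 w)) q
      = bind_pmf ?r (\<lambda>s. map_pmf (\<lambda>c. (fst s, snd s, c)) (b (snd s)))"
    unfolding map_q by (simp add: bind_assoc_pmf bind_map_pmf)
qed

lemma markov2: "markov_chain q (\<lambda>w. (src w, aux1 w, rec2 w)) aux2 rec3"
proof (rule markov_kernel)
  let ?r = "bind_pmf P2 (\<lambda>u. bind_pmf (P1 u) (\<lambda>v. map_pmf (\<lambda>(x, y). ((x, v, y), u)) (pair_pmf (a v) (b v))))"
  show "finite (set_pmf ?r)" by (auto simp: set_pair_pmf)
  show "map_pmf (\<lambda>w. ((src w, aux1 w, rec2 w), aux2 w, rec3 w)) q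
      = bind_pmf ?r (\<lambda>s. map_pmf (\<lambda>c. (fst s, snd s, c)) (c (snd s)))"
    unfolding map_q
    unfolding map_pmf_def pair_pmf_def by (simp add: bind_assoc_pmf bind_return_pmf)
qed

lemma cond_entropy_q: "cond_entropy2 q aux2 aux1 = 0"
  unfolding cond_entropy2_ent[OF fin_q]
  by (simp add: ent_cong_fun[OF fin_q, where A="\<lambda>w. (aux2 w, aux1 w)" and B=aux1 and g="\<lambda>v. (f v, v)" and h=snd] aux2_q)

lemma ex_bind_P: "ex (bind_pmf P2 P1) g = ex P2 (\<lambda>u. ex (P1 u) g)"
  by (rule ex_bind) auto

lemma ent_q_aux1:
  "ent q (\<lambda>w. (g (src w) (rec2 w) (rec3 w), aux1 w)) = ent q aux1
    + ex P2 (\<lambda>u. ex (P1 u) (\<lambda>v. Hp (map_pmf (\<lambda>(x, y, z). g x y z) (pair_pmf (a v) (pair_pmf (b v) (c u))))))"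
proof -
  have "ent q (\<lambda>w. (g (src w) (rec2 w) (rec3 w), aux1 w)) = ent q (\<lambda>w. (aux1 w, g (src w) (rec2 w) (rec3 w)))"
    by (rule ent_cong_fun[where g="\<lambda>(a,b). (b,a)" and h="\<lambda>(a,b). (b,a)"]) auto
  also have "\<dots> = ent q aux1 + ex (bind_pmf P2 P1) (\<lambda>v. Hp (map_pmf (\<lambda>(x, y, z). g x y z) (pair_pmf (a v) (pair_pmf (b v) (c (f v))))))"
    unfolding map_q_aux1 map_q_aux1' by (rule Hp_bind_Pair) (auto simp: set_pair_pmf)
  also have "ex (bind_pmf P2 P1) (\<lambda>v. Hp (map_pmf (\<lambda>(x, y, z). g x y z) (pair_pmf (a v) (pair_pmf (b v) (c (f v))))))
    = ex P2 (\<lambda>u. ex (P1 u) (\<lambda>v. Hp (map_pmf (\<lambda>(x, y, z). g x y z) (pair_pmf (a v) (pair_pmf (b v) (c u))))))"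
    unfolding ex_bind_P by (intro ex_cong refl) (simp add: sep)
  finally show ?thesis .
qed

lemma mutual_aux1: "mutual_info2 q src aux1 = Hp (map_pmf src q) - ex P2 (\<lambda>u. ex (P1 u) (\<lambda>v. Hp (a v)))"
proof -
  have "ent q (\<lambda>w. (src w, aux1 w)) = ent q aux1 + ex P2 (\<lambda>u. ex (P1 u) (\<lambda>v. Hp (a v)))"
    using ent_q_aux1[of "\<lambda>x y z. x"] by (simp add: map_fst_pair3)
  then show ?thesis by (simp add: mutual_info2_ent)
qed

lemma mutual_aux2: "mutual_info2 q src aux2 = Hp (map_pmf src q) - ex P2 (\<lambda>u. Hp (bind_pmf (P1 u) a))"
proof -
  have "ent q (\<lambda>w. (src w, aux2 w)) = ent q (\<lambda>w. (aux2 w, src w))"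
    by (rule ent_cong_fun[where g="\<lambda>(a,b). (b,a)" and h="\<lambda>(a,b). (b,a)"]) auto
  also have "\<dots> = Hp P2 + ex P2 (\<lambda>u. Hp (bind_pmf (P1 u) a))"
    unfolding map_q_src_aux2 by (rule Hp_bind_Pair) auto
  finally show ?thesis by (simp add: mutual_info2_ent map_q_aux2)
qed

end

text \<open>Given \<open>V1\<close> the three signals are independent, so their joint entropy splits.\<close>

definition sel_sum :: "signal set \<Rightarrow> real \<Rightarrow> real \<Rightarrow> real \<Rightarrow> real" where
  "sel_sum S \<alpha> \<beta> \<gamma> = (if Src \<in> S then \<alpha> else 0) + (if Rec2 \<in> S then \<beta> else 0) + (if Rec3 \<in> S then \<gamma> else 0)"

lemma Hp_map_opt:
  fixes p :: "'a pmf"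
  assumes "finite (set_pmf p)"
  shows "Hp (map_pmf (\<lambda>x. if B then Some x else None) p) = (if B then Hp p else 0)"
  using assms by (auto simp: map_pmf_const Hp_map_inj)

lemma Hp_select:
  assumes "finite (set_pmf p)" "finite (set_pmf q)" "finite (set_pmf r)"
  shows "Hp (map_pmf (\<lambda>(x, y, z). select S x y z) (pair_pmf p (pair_pmf q r)))
    = sel_sum S (Hp p) (Hp q) (Hp r)"
proof -
  have "map_pmf (\<lambda>(x, y, z). select S x y z) (pair_pmf p (pair_pmf q r))
    = pair_pmf (map_pmf (\<lambda>x. if Src \<in> S then Some x else None) p)
       (pair_pmf (map_pmf (\<lambda>x. if Rec2 \<in> S then Some x else None) q)
          (map_pmf (\<lambda>x. if Rec3 \<in> S then Some x else None) r))"
    unfolding select_def by (simp add: pair_map_pmf1 pair_map_pmf2 pmf.map_comp o_def case_prod_unfold)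
  then show ?thesis using assms by (simp add: Hp_pair Hp_map_opt sel_sum_def)
qed

section \<open>The region of single-letter tuples\<close>

text \<open>Laws become points of a Euclidean space, where compactness and convex hulls are
  available.\<close>

definition vecp :: "'a::finite pmf \<Rightarrow> real ^ 'a" where
  "vecp p = (\<chi> i. pmf p i)"

definition prob_simplex :: "(real ^ 'a::finite) set" where
  "prob_simplex = {v. (\<forall>i. 0 \<le> v $ i) \<and> (\<Sum>i\<in>UNIV. v $ i) = 1}"

lemma range_vecp: "range vecp = (prob_simplex :: (real ^ 'a::finite) set)"
proof
  show "range vecp \<subseteq> (prob_simplex :: (real ^ 'a) set)"
    by (auto simp: vecp_def prob_simplex_def sum_pmf_eq_1)
  show "(prob_simplex :: (real ^ 'a) set) \<subseteq> range vecp"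
  proof
    fix v :: "real ^ 'a" assume v: "v \<in> prob_simplex"
    have nn: "0 \<le> v $ i" for i using v by (simp add: prob_simplex_def)
    have "(\<integral>\<^sup>+i. ennreal (v $ i) \<partial>count_space UNIV) = 1"
      using v nn by (simp add: nn_integral_count_space_finite prob_simplex_def)
    then have "v = vecp (embed_pmf (\<lambda>i. v $ i))"
      using nn by (simp add: vecp_def vec_eq_iff pmf_embed_pmf)
    then show "v \<in> range vecp" by (rule range_eqI)
  qed
qed

lemma compact_prob_simplex: "compact (prob_simplex :: (real ^ 'a::finite) set)"
  unfolding compact_eq_bounded_closed
proof
  show "bounded (prob_simplex :: (real ^ 'a) set)"
    unfolding bounded_iff
  proof (intro exI ballI)
    fix v :: "real ^ 'a" assume v: "v \<in> prob_simplex"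
    have "norm v \<le> (\<Sum>i\<in>UNIV. \<bar>v $ i\<bar>)" by (rule norm_le_l1_cart)
    also have "\<dots> = 1" using v by (simp add: prob_simplex_def)
    finally show "norm v \<le> 1" .
  qed
  show "closed (prob_simplex :: (real ^ 'a) set)"
    unfolding prob_simplex_def
    by (intro closed_Collect_conj closed_Collect_all closed_Collect_le closed_Collect_eq continuous_intros)
qed

section \<open>Continuity and concavity of entropy in the probability vector\<close>

definition eta :: "real \<Rightarrow> real" where
  "eta t = - (t * log 2 t)"

lemma eta_0 [simp]: "eta 0 = 0"
  by (simp add: eta_def)

text \<open>From \<open>ln (1 / sqrt t) \<le> 1 / sqrt t - 1\<close>. The bound tends to 0 with t
  and yields continuity of \<open>eta\<close> at 0, where the logarithm diverges.\<close>

lemma eta_bound: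
  assumes "0 \<le> t" "t \<le> 1" shows "\<bar>eta t\<bar> \<le> 2 / ln 2 * sqrt t"
proof (cases "t = 0")
  case False
  then have t: "0 < t" using assms by simp
  have "ln (1 / sqrt t) \<le> 1 / sqrt t - 1" using t by (intro ln_le_minus_one) auto
  then have "- ln t \<le> 2 / sqrt t" using t by (simp add: ln_div ln_sqrt)
  then have "t * - ln t \<le> t * (2 / sqrt t)" using t by (intro mult_left_mono) auto
  also have "\<dots> = 2 * sqrt t" using t by (simp add: field_simps)
  finally have "- (t * ln t) / ln 2 \<le> 2 * sqrt t / ln 2" by (intro divide_right_mono) auto
  moreover have "0 \<le> - (t * ln t) / ln 2" using t assms by (intro divide_nonneg_pos) (auto simp: mult_nonneg_nonpos)
  ultimately show ?thesis by (simp add: eta_def log_def)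
qed simp

lemma continuous_on_eta: "continuous_on {0..} eta"
  unfolding continuous_on
proof
  fix t :: real assume "t \<in> {0..}"
  then consider "t > 0" | "t = 0" by fastforce
  then show "(eta \<longlongrightarrow> eta t) (at t within {0..})"
  proof cases
    case 1
    then have "isCont eta t" unfolding eta_def[abs_def] by (intro continuous_intros) auto
    then show ?thesis unfolding isCont_def by (rule tendsto_within_subset) simp
  next
    case 2
    have "((\<lambda>t. 2 / ln 2 * sqrt t) \<longlongrightarrow> 2 / ln 2 * sqrt 0) (at 0 within {0..})"
      by (intro tendsto_intros)
    then have "((\<lambda>t. 2 / ln 2 * sqrt t) \<longlongrightarrow> 0) (at 0 within {0..})" by simp
    moreover have "\<forall>\<^sub>F t in at 0 within {0..}. norm (eta t) \<le> 2 / ln 2 * sqrt t"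
      unfolding eventually_at using eta_bound by (intro exI[of _ 1]) (auto simp: dist_real_def)
    ultimately have "(eta \<longlongrightarrow> 0) (at 0 within {0..})" by (rule Lim_null_comparison[rotated])
    then show ?thesis using 2 by simp
  qed
qed

lemma continuous_on_eta_comp:
  assumes "continuous_on A g" "\<And>x. x \<in> A \<Longrightarrow> 0 \<le> g x"
  shows "continuous_on A (\<lambda>x. eta (g x))"
  using continuous_on_compose2[OF continuous_on_eta assms(1)] assms(2) by auto

lemma eta_jensen:
  assumes "finite I" "\<And>i. i \<in> I \<Longrightarrow> 0 \<le> w i" "\<And>i. i \<in> I \<Longrightarrow> 0 \<le> t i" "sum w I = 1"
  shows "(\<Sum>i\<in>I. w i * eta (t i)) \<le> eta (\<Sum>i\<in>I. w i * t i)"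
proof -
  define m where "m = (\<Sum>i\<in>I. w i * t i)"
  have m0: "0 \<le> m" unfolding m_def using assms by (intro sum_nonneg mult_nonneg_nonneg) auto
  show ?thesis
  proof (cases "m = 0")
    case True
    then have "\<forall>i\<in>I. w i * t i = 0"
      unfolding m_def using assms by (subst (asm) sum_nonneg_eq_0_iff) auto
    then have "(\<Sum>i\<in>I. w i * eta (t i)) = 0" by (intro sum.neutral) auto
    then show ?thesis using True by (simp add: m_def[symmetric])
  next
    case False
    then have m: "0 < m" using m0 by simp
    \<comment> \<open>The tangent line of \<open>eta\<close> at the mean m. It does not exist at m =
      0, hence the separate case.\<close>
    have "eta s \<le> - s * log 2 m + (m - s) / ln 2" if s: "0 \<le> s" for s
    proof (cases "s = 0")
      case False
      then have s: "0 < s" using s by simp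
      have "s * log 2 m \<le> s * (log 2 s + (m / s - 1) / ln 2)"
        using s m by (intro mult_left_mono log2_le_tangent) auto
      then show ?thesis using s by (simp add: eta_def distrib_left right_diff_distrib)
    qed (use m in simp)
    then have "(\<Sum>i\<in>I. w i * eta (t i)) \<le> (\<Sum>i\<in>I. w i * (- t i * log 2 m + (m - t i) / ln 2))"
      using assms by (intro sum_mono mult_left_mono) auto
    also have "\<dots> = (\<Sum>i\<in>I. w i * t i) * - log 2 m + (sum w I * m - (\<Sum>i\<in>I. w i * t i)) / ln 2"
      unfolding sum_distrib_right sum_subtractf[symmetric] sum_divide_distrib sum.distrib[symmetric]
      by (intro sum.cong) (auto simp: algebra_simps diff_divide_distrib)
    also have "\<dots> = eta m" using assms by (simp add: m_def[symmetric] eta_def)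
    finally show ?thesis by (simp add: m_def)
  qed
qed

lemma Hp_eq_eta: "finite A \<Longrightarrow> set_pmf p \<subseteq> A \<Longrightarrow> Hp p = (\<Sum>a\<in>A. eta (pmf p a))"
  unfolding Hp_def by (subst ex_eq_sum) (auto simp: eta_def)

definition Hv :: "real ^ 'a::finite \<Rightarrow> real" where
  "Hv v = (\<Sum>i\<in>UNIV. eta (v $ i))"

lemma Hv_vecp [simp]: "Hv (vecp p) = Hp p"
  by (simp add: Hv_def vecp_def Hp_eq_eta[of UNIV])

lemma continuous_on_Hv:
  assumes "continuous_on A g" "\<And>x i. x \<in> A \<Longrightarrow> 0 \<le> g x $ i"
  shows "continuous_on A (\<lambda>x. Hv (g x))"
  unfolding Hv_def using assms by (intro continuous_intros continuous_on_eta_comp) auto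

definition sel3 :: "signal set \<Rightarrow> 'x \<times> 'y \<times> 'z \<Rightarrow> 'x option \<times> 'y option \<times> 'z option" where
  "sel3 S = (\<lambda>(x, y, z). select S x y z)"

definition HS :: "signal set \<Rightarrow> real ^ ('x::finite \<times> 'y::finite \<times> 'z::finite) \<Rightarrow> real" where
  "HS S w = (\<Sum>s\<in>range (sel3 S :: 'x \<times> 'y \<times> 'z \<Rightarrow> _). eta (\<Sum>t | sel3 S t = s. w $ t))"

lemma HS_vecp: "HS S (vecp p) = Hp (map_pmf (sel3 S) p)"
proof -
  have "(\<Sum>t | sel3 S t = s. vecp p $ t) = pmf (map_pmf (sel3 S) p) s" for s
    by (simp add: pmf_map vecp_def measure_measure_pmf_finite vimage_def)
  then show ?thesis
    by (subst Hp_eq_eta[of "range (sel3 S)"]) (auto simp: HS_def)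
qed

lemma continuous_on_HS:
  assumes "continuous_on A g" "\<And>x i. x \<in> A \<Longrightarrow> 0 \<le> g x $ i"
  shows "continuous_on A (\<lambda>x. HS S (g x))"
  unfolding HS_def using assms by (intro continuous_intros continuous_on_eta_comp sum_nonneg) auto

text \<open>Concavity of H(S) in the joint law, fibre by fibre. It supports both the time average in
  the converse and the mixtures that create slack.\<close>

lemma HS_jensen:
  fixes w :: "'i \<Rightarrow> real ^ ('x::finite \<times> 'y::finite \<times> 'z::finite)"
  assumes "finite I" "\<And>i. i \<in> I \<Longrightarrow> 0 \<le> u i" "\<And>i t. i \<in> I \<Longrightarrow> 0 \<le> w i $ t" "sum u I = 1"
  shows "(\<Sum>i\<in>I. u i * HS S (w i)) \<le> HS S (\<Sum>i\<in>I. u i *\<^sub>R w i)"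
proof -
  have "(\<Sum>i\<in>I. u i * HS S (w i))
    = (\<Sum>s\<in>range (sel3 S). \<Sum>i\<in>I. u i * eta (\<Sum>t | sel3 S t = s. w i $ t))"
    unfolding HS_def sum_distrib_left by (rule sum.swap)
  also have "\<dots> \<le> (\<Sum>s\<in>range (sel3 S). eta (\<Sum>i\<in>I. u i * (\<Sum>t | sel3 S t = s. w i $ t)))"
    using assms by (intro sum_mono eta_jensen sum_nonneg) auto
  also have "\<dots> = HS S (\<Sum>i\<in>I. u i *\<^sub>R w i)"
    unfolding HS_def sum_distrib_left
  proof (rule sum.cong[OF refl], rule arg_cong[of _ _ eta])
    fix s :: "'x option \<times> 'y option \<times> 'z option"
    show "(\<Sum>i\<in>I. \<Sum>t | sel3 S t = s. u i * w i $ t) = (\<Sum>t | sel3 S t = s. (\<Sum>i\<in>I. u i *\<^sub>R w i) $ t)"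
      by (subst sum.swap) simp
  qed
  finally show ?thesis .
qed

lemma HS_nonneg:
  assumes "\<And>t. 0 \<le> w $ t" "(\<Sum>t\<in>UNIV. w $ t) = 1"
  shows "0 \<le> HS S w"
proof -
  have "w \<in> range vecp" unfolding range_vecp prob_simplex_def using assms by simp
  then show ?thesis by (auto simp: HS_vecp Hp_nonneg)
qed

subsection \<open>Mixtures and convex hulls\<close>

definition mixv :: "nat pmf \<Rightarrow> (nat \<Rightarrow> 'v::real_vector) \<Rightarrow> 'v" where
  "mixv P pt = (\<Sum>i\<in>set_pmf P. pmf P i *\<^sub>R pt i)"

lemma mixv_real: "mixv P f = ex P f"
  by (simp add: mixv_def ex_def)

lemma mixv_Pair: "mixv P (\<lambda>i. (f i, g i)) = (mixv P f, mixv P g)"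
  unfolding mixv_def by (simp add: prod_eq_iff fst_sum snd_sum)

lemma mixv_nth: "mixv P f $ i = ex P (\<lambda>j. f j $ i)"
  unfolding mixv_def by (simp add: ex_def)

lemma mixv_vec: "mixv P f = (\<chi> i. ex P (\<lambda>j. f j $ i))"
  by (simp add: vec_eq_iff mixv_nth)

lemma mixv_cong: "(\<And>i. i \<in> set_pmf P \<Longrightarrow> f i = g i) \<Longrightarrow> mixv P f = mixv P g"
  unfolding mixv_def by auto

lemma mixv_map_inj:
  assumes "inj h"
  shows "mixv (map_pmf h P) f = mixv P (\<lambda>i. f (h i))"
  unfolding mixv_def using assms
  by (simp add: sum.reindex inj_on_subset[OF assms] pmf_map_inj')

lemma mixv_in_hull:
  assumes "finite (set_pmf P)" "\<And>i. i \<in> set_pmf P \<Longrightarrow> pt i \<in> convex hull A"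
  shows "mixv P pt \<in> convex hull A"
  unfolding mixv_def using assms
  by (intro convex_sum) (auto simp: sum_pmf_eq_1 convex_convex_hull)

text \<open>The points of a convex combination are numbered, so that the number can serve as the
  value of an auxiliary variable whose law is given by the weights.\<close>

lemma hull_eq_mixv:
  assumes "y \<in> convex hull A"
  shows "\<exists>P pt. finite (set_pmf P) \<and> (\<forall>i\<in>set_pmf P. pt i \<in> A) \<and> y = mixv P pt"
proof -
  obtain T u where T: "finite T" "T \<subseteq> A" and u: "\<forall>v\<in>T. 0 \<le> u v" "sum u T = 1" "(\<Sum>v\<in>T. u v *\<^sub>R v) = y"
    using assms unfolding convex_hull_explicit by blast
  obtain h where h: "bij_betw h {0..<card T} T" using ex_bij_betw_nat_finite[OF T(1)] by blast
  \<comment> \<open>Padding by zero extends the weights to all of the naturals.\<close>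
  define g where "g i = (if i < card T then u (h i) else 0)" for i
  have hT: "h i \<in> T" if "i < card T" for i using h that by (auto simp: bij_betw_def)
  have gn: "0 \<le> g i" for i using u hT by (simp add: g_def)
  have "(\<integral>\<^sup>+i. ennreal (g i) \<partial>count_space UNIV) = (\<Sum>i\<in>{0..<card T}. ennreal (g i))"
    by (rule nn_integral_count_space') (auto simp: g_def)
  also have "\<dots> = ennreal (\<Sum>i\<in>{0..<card T}. u (h i))"
    using u(1) hT by (subst sum_ennreal[symmetric]) (auto simp: g_def intro!: sum.cong)
  also have "(\<Sum>i\<in>{0..<card T}. u (h i)) = 1"
    using sum.reindex_bij_betw[OF h, of u] u by simp
  finally have pg: "pmf (embed_pmf g) i = g i" for i
    using gn by (intro pmf_embed_pmf) auto
  have sub: "set_pmf (embed_pmf g) \<subseteq> {0..<card T}"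
    by (auto simp: set_pmf_iff pg g_def split: if_splits)
  show ?thesis
  proof (intro exI conjI ballI)
    show "finite (set_pmf (embed_pmf g))" using finite_subset[OF sub] by simp
    show "h i \<in> A" if "i \<in> set_pmf (embed_pmf g)" for i
      using hT T(2) that sub by fastforce
    have "mixv (embed_pmf g) h = (\<Sum>i\<in>{0..<card T}. g i *\<^sub>R h i)"
      unfolding mixv_def using sub by (intro sum.mono_neutral_cong_left) (auto simp: set_pmf_iff pg)
    also have "\<dots> = (\<Sum>i\<in>{0..<card T}. u (h i) *\<^sub>R h i)"
      by (intro sum.cong) (auto simp: g_def)
    also have "\<dots> = y" using sum.reindex_bij_betw[OF h, of "\<lambda>v. u v *\<^sub>R v"] u by simp
    finally show "y = mixv (embed_pmf g) h" ..
  qed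
qed

text \<open>A tuple \<open>(w, \<alpha>, \<beta>, \<gamma>, \<delta>)\<close> stands for the law of \<open>(X, Y2, Y3)\<close> together with
  \<open>H(X|V1)\<close>, \<open>H(Y2|V1)\<close>, \<open>H(Y3|V2)\<close> and \<open>H(X|V2)\<close>. All constraints are linear in the tuple.
  Conditioning on a value of \<open>V2\<close> yields a point of \<open>outer_pt\<close>, conditioning also on \<open>V1\<close>
  a point of \<open>inner_pt\<close>; so the tuples form an iterated convex hull, which is compact without
  any bound on the alphabets of \<open>V1\<close> and \<open>V2\<close>.\<close>

type_synonym ('x, 'y, 'z) tuple = "(real ^ ('x \<times> 'y \<times> 'z)) \<times> real \<times> real \<times> real \<times> real"

definition inner_pt :: "real ^ 'x::finite \<Rightarrow> real ^ 'y::finite \<Rightarrow> (real ^ ('x \<times> 'y)) \<times> real \<times> real" where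
  "inner_pt a b = ((\<chi> i. a $ fst i * b $ snd i), Hv a, Hv b)"

definition inner_hull :: "((real ^ ('x::finite \<times> 'y::finite)) \<times> real \<times> real) set" where
  "inner_hull = convex hull ((\<lambda>(a, b). inner_pt a b) ` (prob_simplex \<times> prob_simplex))"

definition outer_pt :: "(real ^ ('x::finite \<times> 'y::finite)) \<times> real \<times> real \<Rightarrow> real ^ 'z::finite \<Rightarrow> ('x, 'y, 'z) tuple" where
  "outer_pt e c = ((\<chi> i. fst e $ (fst i, fst (snd i)) * c $ snd (snd i)), fst (snd e), snd (snd e), Hv c,
      Hv (\<chi> x. \<Sum>y\<in>UNIV. fst e $ (x, y)))"

definition region :: "('x::finite, 'y::finite, 'z::finite) tuple set" where
  "region = convex hull ((\<lambda>(e, c). outer_pt e c) ` (inner_hull \<times> prob_simplex))"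

lemma compact_inner_hull: "compact inner_hull"
  unfolding inner_hull_def inner_pt_def case_prod_unfold
  by (intro compact_convex_hull compact_continuous_image compact_Times compact_prob_simplex
      continuous_intros continuous_on_Hv) (auto simp: prob_simplex_def)

text \<open>Continuity of \<open>eta\<close> is established on nonnegative arguments only; this sign
  is what \<open>Hv\<close> in \<open>outer_pt\<close> relies on.\<close>

lemma inner_hull_nonneg:
  assumes "e \<in> inner_hull" shows "0 \<le> fst e $ i"
proof -
  have "convex {e :: (real ^ ('a \<times> 'b)) \<times> real \<times> real. \<forall>i. 0 \<le> fst e $ i}"
    by (auto simp: convex_def)
  moreover have "(\<lambda>(a, b). inner_pt a b) ` (prob_simplex \<times> prob_simplex) \<subseteq> {e :: (real ^ ('a \<times> 'b)) \<times> real \<times> real. \<forall>i. 0 \<le> fst e $ i}"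
    by (auto simp: inner_pt_def prob_simplex_def)
  ultimately have "inner_hull \<subseteq> {e :: (real ^ ('a \<times> 'b)) \<times> real \<times> real. \<forall>i. 0 \<le> fst e $ i}"
    unfolding inner_hull_def by (intro hull_minimal)
  then show ?thesis using assms by blast
qed

lemma compact_region: "compact region"
  unfolding region_def outer_pt_def case_prod_unfold
  by (intro compact_convex_hull compact_continuous_image compact_Times compact_prob_simplex
      continuous_intros continuous_on_Hv compact_inner_hull)
     (auto simp: prob_simplex_def intro!: sum_nonneg inner_hull_nonneg)

lemma convex_region: "convex region"
  unfolding region_def by (rule convex_convex_hull)

definition tuple_of ::
  "nat pmf \<Rightarrow> (nat \<Rightarrow> nat pmf) \<Rightarrow> (nat \<Rightarrow> 'x::finite pmf) \<Rightarrow> (nat \<Rightarrow> 'y::finite pmf)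
    \<Rightarrow> (nat \<Rightarrow> 'z::finite pmf) \<Rightarrow> ('x, 'y, 'z) tuple" where
  "tuple_of P2 P1 a b c =
     ((\<chi> i. ex P2 (\<lambda>u. ex (P1 u) (\<lambda>v. pmf (a v) (fst i) * pmf (b v) (fst (snd i))) * pmf (c u) (snd (snd i)))),
      ex P2 (\<lambda>u. ex (P1 u) (\<lambda>v. Hp (a v))),
      ex P2 (\<lambda>u. ex (P1 u) (\<lambda>v. Hp (b v))),
      ex P2 (\<lambda>u. Hp (c u)),
      ex P2 (\<lambda>u. Hp (bind_pmf (P1 u) a)))"

text \<open>Summing the first component of an inner mixture over y returns the law of X given V2 =
  u. So the last entry of \<open>outer_pt\<close> is H(X|V2 = u), a nonlinear function of the inner
  mixture, which is why the hull is taken in two stages.\<close>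

lemma tuple_of_eq:
  fixes a :: "nat \<Rightarrow> 'x::finite pmf" and b :: "nat \<Rightarrow> 'y::finite pmf" and c :: "nat \<Rightarrow> 'z::finite pmf"
  assumes "finite (set_pmf P2)" "\<And>u. finite (set_pmf (P1 u))"
  shows "tuple_of P2 P1 a b c =
    mixv P2 (\<lambda>u. outer_pt (mixv (P1 u) (\<lambda>v. inner_pt (vecp (a v)) (vecp (b v)))) (vecp (c u)))"
proof -
  have m: "(\<chi> x. \<Sum>y\<in>UNIV. ex (P1 u) (\<lambda>v. pmf (a v) x * pmf (b v) y)) = vecp (bind_pmf (P1 u) a)" for u
    using assms by (simp add: vecp_def vec_eq_iff pmf_bind_ex ex_sum[symmetric] sum_distrib_left[symmetric] sum_pmf_eq_1)
  have n: "mixv (P1 u) (\<lambda>v. inner_pt (vecp (a v)) (vecp (b v)))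
      = ((\<chi> i. ex (P1 u) (\<lambda>v. pmf (a v) (fst i) * pmf (b v) (snd i))), ex (P1 u) (\<lambda>v. Hp (a v)), ex (P1 u) (\<lambda>v. Hp (b v)))" for u
    unfolding inner_pt_def mixv_Pair mixv_real mixv_vec Hv_vecp by (simp add: vecp_def)
  have o: "outer_pt (mixv (P1 u) (\<lambda>v. inner_pt (vecp (a v)) (vecp (b v)))) (vecp (c u))
      = ((\<chi> i. ex (P1 u) (\<lambda>v. pmf (a v) (fst i) * pmf (b v) (fst (snd i))) * pmf (c u) (snd (snd i))),
         ex (P1 u) (\<lambda>v. Hp (a v)), ex (P1 u) (\<lambda>v. Hp (b v)), Hp (c u), Hp (bind_pmf (P1 u) a))" for u
    unfolding n outer_pt_def Hv_vecp by (simp add: m) (simp add: vecp_def)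
  show ?thesis
    unfolding o mixv_Pair mixv_real mixv_vec tuple_of_def by simp
qed

lemma tuple_of_in_region:
  assumes "finite (set_pmf P2)" "\<And>u. finite (set_pmf (P1 u))"
  shows "tuple_of P2 P1 a b c \<in> region"
proof -
  have vp: "vecp p \<in> prob_simplex" for p :: "'q::finite pmf" using range_vecp by auto
  have inner: "mixv (P1 u) (\<lambda>v. inner_pt (vecp (a v)) (vecp (b v))) \<in> inner_hull" for u
    unfolding inner_hull_def
  proof (rule mixv_in_hull[OF assms(2)], rule hull_inc)
    show "inner_pt (vecp (a v)) (vecp (b v)) \<in> (\<lambda>(a, b). inner_pt a b) ` (prob_simplex \<times> prob_simplex)" for v
      using vp[of "a v"] vp[of "b v"] by (rule_tac image_eqI[where x="(vecp (a v), vecp (b v))"]) simp_all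
  qed
  show ?thesis
    unfolding tuple_of_eq[OF assms] region_def
  proof (rule mixv_in_hull[OF assms(1)], rule hull_inc)
    show "outer_pt (mixv (P1 u) (\<lambda>v. inner_pt (vecp (a v)) (vecp (b v)))) (vecp (c u))
        \<in> (\<lambda>(e, c). outer_pt e c) ` (inner_hull \<times> prob_simplex)" for u
      using inner[of u] vp[of "c u"]
      by (rule_tac image_eqI[where x="(mixv (P1 u) (\<lambda>v. inner_pt (vecp (a v)) (vecp (b v))), vecp (c u))"]) simp_all
  qed
qed

text \<open>Every hull point is a finite mixture, and mixing weights become laws of auxiliary
  variables: the outer ones give V2, the inner ones V1 given V2.\<close>

lemma region_eq_tuple_of:
  fixes t :: "('x::finite, 'y::finite, 'z::finite) tuple"
  assumes "t \<in> region"
  obtains P2 P1 a b c where "kernels P2 P1 (fst \<circ> prod_decode)" "t = tuple_of P2 P1 a b c"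
proof -
  obtain P2 pt where P2: "finite (set_pmf P2)" and pt: "\<forall>u\<in>set_pmf P2. pt u \<in> (\<lambda>(e, c). outer_pt e c) ` (inner_hull \<times> prob_simplex)"
    and t: "t = mixv P2 pt"
    using hull_eq_mixv[OF assms[unfolded region_def]] by blast
  have "\<exists>r. case r of (c, P, a, b) \<Rightarrow> finite (set_pmf P) \<and> (u \<in> set_pmf P2 \<longrightarrow>
      pt u = outer_pt (mixv P (\<lambda>j. inner_pt (vecp (a j)) (vecp (b j)))) (vecp c))" for u
  proof (cases "u \<in> set_pmf P2")
    case True
    obtain e c where e: "e \<in> inner_hull" and c: "c \<in> prob_simplex" and pu: "pt u = outer_pt e c"
      using bspec[OF pt True] by auto
    obtain c' where cc: "c = vecp c'" using c unfolding range_vecp[symmetric] by auto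
    obtain P pt' where P: "finite (set_pmf P)" and pt': "\<forall>j\<in>set_pmf P. pt' j \<in> (\<lambda>(a, b). inner_pt a b) ` (prob_simplex \<times> prob_simplex)"
      and em: "e = mixv P pt'"
      using hull_eq_mixv[OF e[unfolded inner_hull_def]] by blast
    have ex: "\<exists>r. pt' j = inner_pt (vecp (fst r)) (vecp (snd r))" if j: "j \<in> set_pmf P" for j
    proof -
      obtain x y where "pt' j = inner_pt x y" and "x \<in> range vecp" "y \<in> range vecp"
        using bspec[OF pt' j] unfolding range_vecp by (elim imageE) (simp add: case_prod_unfold mem_Times_iff)
      moreover from this obtain p q where "x = vecp p" "y = vecp q" by (elim rangeE)
      ultimately show ?thesis by (intro exI[of _ "(p, q)"]) simp
    qed
    from bchoice[OF ballI[OF ex]]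
    obtain r where "\<forall>j\<in>set_pmf P. pt' j = inner_pt (vecp (fst (r j))) (vecp (snd (r j)))" by (rule exE)
    then have "\<And>j. j \<in> set_pmf P \<Longrightarrow> pt' j = inner_pt (vecp ((fst \<circ> r) j)) (vecp ((snd \<circ> r) j))" by (simp only: o_apply)
    then have mx: "mixv P pt' = mixv P (\<lambda>j. inner_pt (vecp ((fst \<circ> r) j)) (vecp ((snd \<circ> r) j)))" by (rule mixv_cong)
    have "pt u = outer_pt (mixv P (\<lambda>j. inner_pt (vecp ((fst \<circ> r) j)) (vecp ((snd \<circ> r) j)))) (vecp c')" unfolding pu em cc mx ..
    then show ?thesis using P by (intro exI[of _ "(c', P, fst \<circ> r, snd \<circ> r)"]) simp
  next
    case False
    then show ?thesis by (intro exI[of _ "(undefined, return_pmf 0, undefined, undefined)"]) simp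
  qed
  then have "\<exists>r. \<forall>u. case r u of (c, P, a, b) \<Rightarrow> finite (set_pmf P) \<and> (u \<in> set_pmf P2 \<longrightarrow>
      pt u = outer_pt (mixv P (\<lambda>j. inner_pt (vecp (a j)) (vecp (b j)))) (vecp c))"
    by (intro choice allI)
  then obtain r where r: "\<And>u. case r u of (c, P, a, b) \<Rightarrow> finite (set_pmf P) \<and> (u \<in> set_pmf P2 \<longrightarrow>
      pt u = outer_pt (mixv P (\<lambda>j. inner_pt (vecp (a j)) (vecp (b j)))) (vecp c))" by blast
  define c P a b where "c u = fst (r u)" and "P u = fst (snd (r u))" and "a u = fst (snd (snd (r u)))"
    and "b u = snd (snd (snd (r u)))" for u
  have P: "finite (set_pmf (P u))" for u
    using r[of u] by (simp add: P_def case_prod_unfold)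
  have eq: "pt u = outer_pt (mixv (P u) (\<lambda>j. inner_pt (vecp (a u j)) (vecp (b u j)))) (vecp (c u))"
    if "u \<in> set_pmf P2" for u
    using r[of u] that by (simp add: P_def a_def b_def c_def case_prod_unfold)
  \<comment> \<open>Inner indices of different u may coincide; pairing them with u makes V2 a
    function of V1.\<close>
  define P1 where "P1 u = map_pmf (\<lambda>j. prod_encode (u, j)) (P u)" for u
  define a' where "a' v = a (fst (prod_decode v)) (snd (prod_decode v))" for v
  define b' where "b' v = b (fst (prod_decode v)) (snd (prod_decode v))" for v
  have fin1: "finite (set_pmf (P1 u))" for u using P by (simp add: P1_def)
  have inj: "inj (\<lambda>j. prod_encode (u, j))" for u by (simp add: inj_def)
  have "t = tuple_of P2 P1 a' b' c"
    unfolding tuple_of_eq[OF P2 fin1] t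
    by (intro mixv_cong) (simp add: eq P1_def mixv_map_inj[OF inj] a'_def b'_def)
  moreover have "kernels P2 P1 (fst \<circ> prod_decode)"
    using P2 fin1 by unfold_locales (auto simp: P1_def)
  ultimately show ?thesis using that by blast
qed

subsection \<open>Letter laws and tuples\<close>

definition W3 :: "('x, 'y, 'z) letter pmf \<Rightarrow> ('x \<times> 'y \<times> 'z) pmf" where
  "W3 q = map_pmf (\<lambda>w. (src w, rec2 w, rec3 w)) q"

abbreviation hX1 :: "('x::finite, 'y::finite, 'z::finite) tuple \<Rightarrow> real" where "hX1 t \<equiv> fst (snd t)"
abbreviation hY1 :: "('x::finite, 'y::finite, 'z::finite) tuple \<Rightarrow> real" where "hY1 t \<equiv> fst (snd (snd t))"
abbreviation hZ2 :: "('x::finite, 'y::finite, 'z::finite) tuple \<Rightarrow> real" where "hZ2 t \<equiv> fst (snd (snd (snd t)))"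
abbreviation hX2 :: "('x::finite, 'y::finite, 'z::finite) tuple \<Rightarrow> real" where "hX2 t \<equiv> snd (snd (snd (snd t)))"

text \<open>The entries for Y2 and Y3 are tied to \<open>q\<close> through singleton
  \<open>S\<close>. For \<open>S = {Rec3}\<close> the right side is H(Y3|V1), which under the Markov
  conditions agrees with H(Y3|V2) because V2 is a function of V1.\<close>

definition represents :: "('x::finite, 'y::finite, 'z::finite) tuple \<Rightarrow> ('x, 'y, 'z) letter pmf \<Rightarrow> bool" where
  "represents t q \<longleftrightarrow> fst t = vecp (W3 q) \<and>
     hX1 t = ent q (\<lambda>w. (src w, aux1 w)) - ent q aux1 \<and>
     hX2 t = ent q (\<lambda>w. (src w, aux2 w)) - ent q aux2 \<and>
     (\<forall>S. sel_sum S (hX1 t) (hY1 t) (hZ2 t)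
        = ent q (\<lambda>w. (select S (src w) (rec2 w) (rec3 w), aux1 w)) - ent q aux1)"

lemma ex_zero: "ex p (\<lambda>_. 0) = 0"
  by (simp add: ex_def)

lemma ex_sel_sum: "ex P (\<lambda>u. sel_sum S (f u) (g u) (h u)) = sel_sum S (ex P f) (ex P g) (ex P h)"
  by (simp add: sel_sum_def ex_add ex_zero)

lemma (in kernels) represents_tuple_of: "represents (tuple_of P2 P1 a b c) q"
proof -
  have "pmf (W3 q) (x, y, z) = ex P2 (\<lambda>u. ex (P1 u) (\<lambda>v. pmf (a v) x * pmf (b v) y) * pmf (c u) z)" for x y z
    unfolding W3_def map_q ex_cmult_right[symmetric]
    by (simp add: pmf_bind_ex case_prod_unfold pmf_pair mult.assoc)
  then have 1: "fst (tuple_of P2 P1 a b c) = vecp (W3 q)"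
    by (auto simp: tuple_of_def vecp_def vec_eq_iff)
  have 2: "ent q (\<lambda>w. (src w, aux1 w)) = ent q aux1 + ex P2 (\<lambda>u. ex (P1 u) (\<lambda>v. Hp (a v)))"
    using mutual_aux1 by (simp add: mutual_info2_ent)
  have 3: "ent q (\<lambda>w. (src w, aux2 w)) = ent q aux2 + ex P2 (\<lambda>u. Hp (bind_pmf (P1 u) a))"
    using mutual_aux2 by (simp add: mutual_info2_ent)
  have 4: "ent q (\<lambda>w. (select S (src w) (rec2 w) (rec3 w), aux1 w)) = ent q aux1
     + sel_sum S (ex P2 (\<lambda>u. ex (P1 u) (\<lambda>v. Hp (a v)))) (ex P2 (\<lambda>u. ex (P1 u) (\<lambda>v. Hp (b v)))) (ex P2 (\<lambda>u. Hp (c u)))" for S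
    unfolding ent_q_aux1[of "select S"] by (simp add: Hp_select ex_sel_sum ex_const)
  show ?thesis
    unfolding represents_def using 1 2 3 4 by (simp add: tuple_of_def)
qed

text \<open>Disintegrate \<open>q\<close> along V2 and then V1; by \<open>eq_letter_law\<close> it
  is the law sampled from these kernels.\<close>

lemma law_represented:
  fixes q :: "('x::finite, 'y::finite, 'z::finite) letter pmf"
  assumes fin: "finite (set_pmf q)"
    and m1: "markov_chain q src aux1 rec2"
    and m2: "markov_chain q (\<lambda>w. (src w, aux1 w, rec2 w)) aux2 rec3"
    and f: "\<And>w. w \<in> set_pmf q \<Longrightarrow> aux2 w = f (aux1 w)"
  shows "\<exists>t\<in>region. represents t q"
proof -
  let ?P2 = "map_pmf aux2 q" and ?P1 = "cond_law q aux1 aux2"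
  interpret kernels ?P2 ?P1 "cond_law q src aux1" "cond_law q rec2 aux1" "cond_law q rec3 aux2" f
  proof
    show "f v = u" if "u \<in> set_pmf ?P2" "v \<in> set_pmf (?P1 u)" for u v
      using cond_law_subset[of u aux2 q aux1] that f by auto
  qed (use fin in auto)
  have q: "letter_law ?P2 ?P1 (cond_law q src aux1) (cond_law q rec2 aux1) (cond_law q rec3 aux2) = q"
    by (rule eq_letter_law[OF fin m1 m2 f, symmetric])
  show ?thesis
    by (rule bexI, rule represents_tuple_of[unfolded q], rule tuple_of_in_region) (use fin in auto)
qed

lemma finite_letter_support:
  fixes q :: "('x::finite, 'y::finite, 'z::finite) letter pmf"
  assumes "finite (aux1 ` set_pmf q)" "finite (aux2 ` set_pmf q)"
  shows "finite (set_pmf q)"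
proof (rule finite_subset)
  show "set_pmf q \<subseteq> (\<lambda>(x, y, z, v, u). Letter x y z v u) `
      (UNIV \<times> UNIV \<times> UNIV \<times> aux1 ` set_pmf q \<times> aux2 ` set_pmf q)"
  proof
    fix w assume w: "w \<in> set_pmf q"
    then show "w \<in> (\<lambda>(x, y, z, v, u). Letter x y z v u) ` (UNIV \<times> UNIV \<times> UNIV \<times> aux1 ` set_pmf q \<times> aux2 ` set_pmf q)"
      by (intro image_eqI[of _ _ "(src w, rec2 w, rec3 w, aux1 w, aux2 w)"]) auto
  qed
qed (use assms in auto)

section \<open>Constraints and objective as functions of tuples\<close>

definition dist1 :: "('x::finite \<Rightarrow> 'y::finite \<Rightarrow> real) \<Rightarrow> ('x, 'y, 'z::finite) tuple \<Rightarrow> real" where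
  "dist1 d t = (\<Sum>i\<in>UNIV. fst t $ i * d (fst i) (fst (snd i)))"

definition dist2 :: "('x::finite \<Rightarrow> 'z::finite \<Rightarrow> real) \<Rightarrow> ('x, 'y::finite, 'z) tuple \<Rightarrow> real" where
  "dist2 d t = (\<Sum>i\<in>UNIV. fst t $ i * d (fst i) (snd (snd i)))"

definition margX :: "('x::finite, 'y::finite, 'z::finite) tuple \<Rightarrow> 'x \<Rightarrow> real" where
  "margX t x = (\<Sum>i\<in>UNIV. fst t $ (x, i))"

text \<open>H - [I - R0]_+ is the minimum of H and R0 + (H - I), and H(S) - I(S;V1) = H(S|V1) splits
  into the entries of the tuple. A minimum of a concave and an affine function is concave.\<close>

definition tuple_value :: "real \<Rightarrow> signal set \<Rightarrow> ('x::finite, 'y::finite, 'z::finite) tuple \<Rightarrow> real" where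
  "tuple_value R0 S t = min (HS S (fst t)) (R0 + sel_sum S (hX1 t) (hY1 t) (hZ2 t))"

definition feasible :: "real \<Rightarrow> real \<Rightarrow> 'x::finite pmf \<Rightarrow> ('x \<Rightarrow> 'y::finite \<Rightarrow> real) \<Rightarrow> ('x \<Rightarrow> 'z::finite \<Rightarrow> real)
    \<Rightarrow> real \<Rightarrow> real \<Rightarrow> ('x, 'y, 'z) tuple set" where
  "feasible R1 R2 PX d1 d2 D1 D2 = {t \<in> region. (\<forall>x. margX t x = pmf PX x) \<and>
     dist1 d1 t \<le> D1 \<and> dist2 d2 t \<le> D2 \<and> Hp PX - hX1 t \<le> R1 \<and> Hp PX - hX2 t \<le> R2}"

context
  fixes q :: "('x::finite, 'y::finite, 'z::finite) letter pmf" and t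
  assumes fin: "finite (set_pmf q)" and rep: "represents t q"
begin

lemma represents_dist1: "dist1 d t = measure_pmf.expectation q (\<lambda>w. d (src w) (rec2 w))"
proof -
  have "dist1 d t = ex (W3 q) (\<lambda>i. d (fst i) (fst (snd i)))"
    using rep by (subst ex_eq_sum[of UNIV]) (auto simp: dist1_def represents_def vecp_def)
  then show ?thesis using fin by (simp add: W3_def ex_map ex_eq_expectation)
qed

lemma represents_dist2: "dist2 d t = measure_pmf.expectation q (\<lambda>w. d (src w) (rec3 w))"
proof -
  have "dist2 d t = ex (W3 q) (\<lambda>i. d (fst i) (snd (snd i)))"
    using rep by (subst ex_eq_sum[of UNIV]) (auto simp: dist2_def represents_def vecp_def)
  then show ?thesis using fin by (simp add: W3_def ex_map ex_eq_expectation)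
qed

lemma represents_margX: "margX t x = pmf (map_pmf src q) x"
proof -
  have "margX t x = (\<Sum>i\<in>UNIV. pmf (W3 q) (x, i))"
    using rep by (simp add: margX_def represents_def vecp_def)
  also have "\<dots> = (\<Sum>j\<in>Pair x ` UNIV. pmf (W3 q) j)"
    by (simp add: sum.reindex inj_on_def)
  also have "\<dots> = pmf (map_pmf fst (W3 q)) x"
    unfolding pmf_map by (subst measure_measure_pmf_finite) (auto intro!: sum.cong arg_cong2[of _ _ _ _ sum])
  finally show ?thesis by (simp add: W3_def pmf.map_comp o_def)
qed

lemma represents_HS: "HS S (fst t) = ent q (\<lambda>w. select S (src w) (rec2 w) (rec3 w))"
  using rep by (simp add: represents_def HS_vecp W3_def pmf.map_comp o_def sel3_def)

lemma represents_value: "secrecy_value R0 S q = tuple_value R0 S t"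
proof -
  have "sel_sum S (hX1 t) (hY1 t) (hZ2 t) = ent q (\<lambda>w. (select S (src w) (rec2 w) (rec3 w), aux1 w)) - ent q aux1"
    using rep unfolding represents_def by blast
  then show ?thesis
    unfolding secrecy_value_def Let_def tuple_value_def entropy2_ent[OF fin] mutual_info2_ent[OF fin] represents_HS
    by simp
qed

lemma represents_mutual1: "mutual_info2 q src aux1 = Hp (map_pmf src q) - hX1 t"
  using rep by (simp add: represents_def mutual_info2_ent[OF fin])

lemma represents_mutual2: "mutual_info2 q src aux2 = Hp (map_pmf src q) - hX2 t"
  using rep by (simp add: represents_def mutual_info2_ent[OF fin])

lemma represents_feasible:
  assumes "t \<in> region" "markov_chain q src aux1 rec2" "markov_chain q (\<lambda>w. (src w, aux1 w, rec2 w)) aux2 rec3"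
    "cond_entropy2 q aux2 aux1 = 0"
  shows "t \<in> feasible R1 R2 PX d1 d2 D1 D2 \<longleftrightarrow> q \<in> letter_laws R1 R2 PX d1 d2 D1 D2"
proof -
  have "(\<forall>x. margX t x = pmf PX x) \<longleftrightarrow> map_pmf src q = PX"
    unfolding represents_margX by (auto intro: pmf_eqI)
  then show ?thesis
    using assms fin
    by (auto simp: feasible_def letter_laws_def represents_dist1 represents_dist2 represents_mutual1 represents_mutual2)
qed

end

lemma letter_laws_represented:
  fixes q :: "('x::finite, 'y::finite, 'z::finite) letter pmf"
  assumes "q \<in> letter_laws R1 R2 PX d1 d2 D1 D2"
  shows "\<exists>t\<in>feasible R1 R2 PX d1 d2 D1 D2. tuple_value R0 S t = secrecy_value R0 S q"
proof -
  note q = assms[unfolded letter_laws_def mem_Collect_eq]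
  have fin: "finite (set_pmf q)" using q by (intro finite_letter_support) auto
  obtain f where f: "\<And>w. w \<in> set_pmf q \<Longrightarrow> aux2 w = f (aux1 w)"
    using aux2_fun_of_aux1[OF fin] q by metis
  obtain t where t: "t \<in> region" "represents t q"
    using law_represented[OF fin _ _ f] q by blast
  have "t \<in> feasible R1 R2 PX d1 d2 D1 D2"
    using represents_feasible[OF fin t(2,1)] q assms by blast
  then show ?thesis using represents_value[OF fin t(2)] by metis
qed

lemma feasible_realized:
  fixes t :: "('x::finite, 'y::finite, 'z::finite) tuple"
  assumes "t \<in> feasible R1 R2 PX d1 d2 D1 D2"
  shows "\<exists>q\<in>letter_laws R1 R2 PX d1 d2 D1 D2. secrecy_value R0 S q = tuple_value R0 S t"
proof -
  have tr: "t \<in> region" using assms by (simp add: feasible_def)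
  obtain P2 P1 a b c where k: "kernels P2 P1 (fst \<circ> prod_decode)" and t: "t = tuple_of P2 P1 a b c"
    by (rule region_eq_tuple_of[OF tr])
  interpret kernels P2 P1 a b c "fst \<circ> prod_decode" by (rule k)
  have rep: "represents t q" unfolding t by (rule represents_tuple_of)
  show ?thesis
    using represents_feasible[OF fin_q rep tr markov1 markov2 cond_entropy_q] assms represents_value[OF fin_q rep] by metis
qed

lemma letter_laws_empty_iff:
  fixes PX :: "'x::finite pmf" and d1 :: "'x \<Rightarrow> 'y::finite \<Rightarrow> real" and d2 :: "'x \<Rightarrow> 'z::finite \<Rightarrow> real"
  shows "letter_laws R1 R2 PX d1 d2 D1 D2 = {} \<longleftrightarrow> feasible R1 R2 PX d1 d2 D1 D2 = {}"
  using letter_laws_represented[of _ R1 R2 PX d1 d2 D1 D2] feasible_realized[of _ R1 R2 PX d1 d2 D1 D2] by blast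

lemma secrecy_value_image:
  fixes PX :: "'x::finite pmf" and d1 :: "'x \<Rightarrow> 'y::finite \<Rightarrow> real" and d2 :: "'x \<Rightarrow> 'z::finite \<Rightarrow> real"
  shows "secrecy_value R0 S ` letter_laws R1 R2 PX d1 d2 D1 D2 = tuple_value R0 S ` feasible R1 R2 PX d1 d2 D1 D2"
  using letter_laws_represented[of _ R1 R2 PX d1 d2 D1 D2 R0 S] feasible_realized[of _ R1 R2 PX d1 d2 D1 D2 R0 S]
  by (auto 0 3 simp: image_iff; metis)

lemma region_simplex:
  assumes "t \<in> region" shows "fst t \<in> prob_simplex" "0 \<le> hX1 t" "0 \<le> hY1 t" "0 \<le> hZ2 t"
proof -
  obtain P2 P1 a b c where k: "kernels P2 P1 (fst \<circ> prod_decode)" and t: "t = tuple_of P2 P1 a b c"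
    by (rule region_eq_tuple_of[OF assms])
  interpret kernels P2 P1 a b c "fst \<circ> prod_decode" by (rule k)
  show "fst t \<in> prob_simplex" 
    using represents_tuple_of unfolding t represents_def range_vecp[symmetric] by simp
  show "0 \<le> hX1 t" "0 \<le> hY1 t" "0 \<le> hZ2 t"
    unfolding t tuple_of_def by (auto intro!: ex_nonneg Hp_nonneg)
qed

lemma region_nth_nonneg: "t \<in> region \<Longrightarrow> 0 \<le> fst t $ i"
  using region_simplex(1)[of t] unfolding prob_simplex_def by blast

lemma region_HS_nonneg: "t \<in> region \<Longrightarrow> 0 \<le> HS S (fst t)"
  using region_simplex(1)[of t] by (intro HS_nonneg) (auto simp: prob_simplex_def)

lemma sel_sum_nonneg: "0 \<le> a \<Longrightarrow> 0 \<le> b \<Longrightarrow> 0 \<le> c \<Longrightarrow> 0 \<le> sel_sum S a b c"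
  by (simp add: sel_sum_def)

lemma tuple_value_nonneg: "0 \<le> R0 \<Longrightarrow> t \<in> region \<Longrightarrow> 0 \<le> tuple_value R0 S t"
  unfolding tuple_value_def by (auto intro!: add_nonneg_nonneg sel_sum_nonneg region_simplex region_HS_nonneg)

text \<open>Concavity with the nonnegative contribution of \<open>t'\<close> discarded: moving a
  fraction \<open>l\<close> towards any other tuple loses at most the fraction \<open>l\<close> of
  the value.\<close>

lemma tuple_value_mono_mix:
  assumes "t \<in> region" "t' \<in> region" "0 \<le> l" "l \<le> 1" "0 \<le> R0"
  shows "(1 - l) * tuple_value R0 S t \<le> tuple_value R0 S ((1 - l) *\<^sub>R t + l *\<^sub>R t')"
proof -
  let ?t = "(1 - l) *\<^sub>R t + l *\<^sub>R t'"
  \<comment> \<open>The two-point mixture is indexed by the booleans.\<close>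
  have "(\<Sum>i\<in>(UNIV::bool set). (if i then 1 - l else l) * HS S (if i then fst t else fst t'))
     \<le> HS S (\<Sum>i\<in>(UNIV::bool set). (if i then 1 - l else l) *\<^sub>R (if i then fst t else fst t'))"
    using assms by (intro HS_jensen) (auto simp: UNIV_bool region_nth_nonneg)
  then have "(1 - l) * HS S (fst t) + l * HS S (fst t') \<le> HS S (fst ?t)"
    by (simp add: UNIV_bool add.commute)
  moreover have "0 \<le> l * HS S (fst t')" using assms by (simp add: region_HS_nonneg)
  ultimately have 1: "(1 - l) * HS S (fst t) \<le> HS S (fst ?t)" by linarith
  have "sel_sum S (hX1 ?t) (hY1 ?t) (hZ2 ?t)
      = (1 - l) * sel_sum S (hX1 t) (hY1 t) (hZ2 t) + l * sel_sum S (hX1 t') (hY1 t') (hZ2 t')"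
    by (simp add: sel_sum_def algebra_simps)
  moreover have "0 \<le> l * sel_sum S (hX1 t') (hY1 t') (hZ2 t')"
    using assms by (auto intro!: mult_nonneg_nonneg sel_sum_nonneg region_simplex)
  moreover have "(1 - l) * R0 \<le> R0" using assms by (simp add: mult_left_le_one_le)
  ultimately have 2: "(1 - l) * (R0 + sel_sum S (hX1 t) (hY1 t) (hZ2 t)) \<le> R0 + sel_sum S (hX1 ?t) (hY1 ?t) (hZ2 ?t)"
    by (simp add: distrib_left)
  have "(1 - l) * tuple_value R0 S t \<le> (1 - l) * HS S (fst t)"
    "(1 - l) * tuple_value R0 S t \<le> (1 - l) * (R0 + sel_sum S (hX1 t) (hY1 t) (hZ2 t))"
    using assms by (auto simp: tuple_value_def intro!: mult_left_mono)
  then show ?thesis using 1 2 unfolding tuple_value_def[of _ _ ?t] by linarith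
qed

lemma continuous_on_tuple_value: "continuous_on region (tuple_value R0 S)"
proof -
  have "continuous_on region (\<lambda>t :: ('a, 'b, 'c) tuple. sel_sum S (hX1 t) (hY1 t) (hZ2 t))"
    unfolding sel_sum_def by (cases "Src \<in> S"; cases "Rec2 \<in> S"; cases "Rec3 \<in> S") (auto intro!: continuous_intros)
  then show ?thesis
    unfolding tuple_value_def[abs_def]
    by (intro continuous_intros continuous_on_HS) (auto simp: region_nth_nonneg)
qed

lemma continuous_dist:
  "continuous_on UNIV (dist1 d1)" "continuous_on UNIV (dist2 d2)"
  unfolding dist1_def[abs_def] dist2_def[abs_def] by (auto intro!: continuous_intros)

lemma compact_feasible:
  fixes PX :: "'x::finite pmf" and d1 :: "'x \<Rightarrow> 'y::finite \<Rightarrow> real" and d2 :: "'x \<Rightarrow> 'z::finite \<Rightarrow> real"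
  shows "compact (feasible R1 R2 PX d1 d2 D1 D2)"
proof -
  have "closed {t :: ('x, 'y, 'z) tuple. (\<forall>x. margX t x = pmf PX x) \<and>
     dist1 d1 t \<le> D1 \<and> dist2 d2 t \<le> D2 \<and> Hp PX - hX1 t \<le> R1 \<and> Hp PX - hX2 t \<le> R2}"
    unfolding margX_def dist1_def dist2_def
    by (intro closed_Collect_conj closed_Collect_all closed_Collect_le closed_Collect_eq continuous_intros)
  from compact_Int_closed[OF compact_region this] show ?thesis
    unfolding feasible_def Int_def mem_Collect_eq .
qed

lemma feasible_region: "t \<in> feasible R1 R2 PX d1 d2 D1 D2 \<Longrightarrow> t \<in> region"
  by (simp add: feasible_def)

lemma secrecy_value_attains_max:
  fixes PX :: "'x::finite pmf" and d1 :: "'x \<Rightarrow> 'y::finite \<Rightarrow> real" and d2 :: "'x \<Rightarrow> 'z::finite \<Rightarrow> real"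
  assumes "letter_laws R1 R2 PX d1 d2 D1 D2 \<noteq> {}"
  shows "\<exists>q\<in>letter_laws R1 R2 PX d1 d2 D1 D2. \<forall>q'\<in>letter_laws R1 R2 PX d1 d2 D1 D2.
           secrecy_value R0 S q' \<le> secrecy_value R0 S q"
proof -
  let ?F = "feasible R1 R2 PX d1 d2 D1 D2"
  have "?F \<noteq> {}" using assms letter_laws_empty_iff by blast
  moreover have "continuous_on ?F (tuple_value R0 S)"
    by (rule continuous_on_subset[OF continuous_on_tuple_value]) (auto simp: feasible_def)
  ultimately obtain t where t: "t \<in> ?F" "\<And>t'. t' \<in> ?F \<Longrightarrow> tuple_value R0 S t' \<le> tuple_value R0 S t"
    using continuous_attains_sup[OF compact_feasible, of R1 R2 PX d1 d2 D1 D2 "tuple_value R0 S"] by blast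
  obtain q where "q \<in> letter_laws R1 R2 PX d1 d2 D1 D2" "secrecy_value R0 S q = tuple_value R0 S t"
    using feasible_realized[OF t(1)] by blast
  then show ?thesis
    using t(2) letter_laws_represented[of _ R1 R2 PX d1 d2 D1 D2 R0 S] by metis
qed

lemma tuple_value_right_continuous:
  fixes PX :: "'x::finite pmf" and d1 :: "'x \<Rightarrow> 'y::finite \<Rightarrow> real" and d2 :: "'x \<Rightarrow> 'z::finite \<Rightarrow> real"
  assumes "\<And>t. t \<in> feasible R1 R2 PX d1 d2 D1 D2 \<Longrightarrow> tuple_value R0 S t < r"
  shows "\<exists>\<epsilon>>0. \<forall>t\<in>feasible R1 R2 PX d1 d2 (D1 + \<epsilon>) (D2 + \<epsilon>). tuple_value R0 S t < r"
proof (rule ccontr)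
  assume neg: "\<not> ?thesis"
  let ?e = "\<lambda>n. inverse (real (Suc n))"
  have "\<exists>t. t \<in> feasible R1 R2 PX d1 d2 (D1 + ?e n) (D2 + ?e n) \<and> r \<le> tuple_value R0 S t" for n
  proof -
    have "?e n > 0" by simp
    then show ?thesis using neg by (meson not_le)
  qed
  then obtain s where s: "\<And>n. s n \<in> feasible R1 R2 PX d1 d2 (D1 + ?e n) (D2 + ?e n)" and sr: "\<And>n. r \<le> tuple_value R0 S (s n)"
    by metis
  have e1: "?e n \<le> 1" for n by (simp add: field_simps)
  \<comment> \<open>All violating tuples lie in the one compact set with both levels raised by
    1.\<close>
  have "s n \<in> feasible R1 R2 PX d1 d2 (D1 + 1) (D2 + 1)" for n
    using s[of n] e1[of n] unfolding feasible_def mem_Collect_eq by (meson add_left_mono order_trans)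
  then obtain l h where l: "l \<in> feasible R1 R2 PX d1 d2 (D1 + 1) (D2 + 1)" and h: "strict_mono (h :: nat \<Rightarrow> nat)" and lim: "(s \<circ> h) \<longlonglongrightarrow> l"
    using compact_feasible[unfolded compact_def] by metis
  have e0: "(\<lambda>n. ?e (h n)) \<longlonglongrightarrow> 0"
    using LIMSEQ_subseq_LIMSEQ[OF LIMSEQ_inverse_real_of_nat h] by (simp add: o_def)
  have c: "(\<lambda>n. f (s (h n))) \<longlonglongrightarrow> f l" if "continuous_on UNIV f" for f :: "('x, 'y, 'z) tuple \<Rightarrow> real"
    using continuous_on_tendsto_compose[OF that lim] by (simp add: o_def)
  have "dist1 d1 l \<le> D1 + 0"
    by (rule LIMSEQ_le[OF c[OF continuous_dist(1)] tendsto_add[OF tendsto_const e0]])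
      (use s in \<open>auto simp: feasible_def\<close>)
  moreover have "dist2 d2 l \<le> D2 + 0"
    by (rule LIMSEQ_le[OF c[OF continuous_dist(2)] tendsto_add[OF tendsto_const e0]])
      (use s in \<open>auto simp: feasible_def\<close>)
  ultimately have "dist1 d1 l \<le> D1" "dist2 d2 l \<le> D2" by simp_all
  then have "l \<in> feasible R1 R2 PX d1 d2 D1 D2" using l by (simp add: feasible_def)
  moreover have "(\<lambda>n. tuple_value R0 S (s (h n))) \<longlonglongrightarrow> tuple_value R0 S l"
    using continuous_on_tendsto_compose[OF continuous_on_tuple_value[of R0 S] lim] feasible_region[OF s] feasible_region[OF l]
    by (simp add: o_def)
  then have "r \<le> tuple_value R0 S l" by (rule LIMSEQ_le_const) (use sr in auto)
  ultimately show False using assms by fastforce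
qed

section \<open>Converse\<close>

text \<open>The converse of \<open>markov_kernel\<close>; it makes the closure properties below a
  matter of composing kernels.\<close>

lemma markov_chain_eq_kernel:
  assumes fin: "finite (set_pmf p)" and m: "markov_chain p A B C"
  shows "map_pmf (\<lambda>w. (A w, B w, C w)) p
    = bind_pmf (map_pmf (\<lambda>w. (A w, B w)) p) (\<lambda>s. map_pmf (\<lambda>c. (fst s, snd s, c)) (cond_law p C B (snd s)))"
proof (rule pmf_eqI)
  fix t :: "'b \<times> 'c \<times> 'd"
  obtain a b c where t: "t = (a, b, c)" by (cases t)
  have fin': "finite (set_pmf (map_pmf (\<lambda>w. (A w, B w)) p))" using fin by simp
  let ?ab = "pmf (map_pmf (\<lambda>w. (A w, B w)) p) (a, b)" and ?b = "pmf (map_pmf B p) b"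
  have cl: "?b * pmf (cond_law p C B b) c = pmf (map_pmf (\<lambda>w. (B w, C w)) p) (b, c)"
    unfolding pmf_cond_law[OF fin] using fin by (auto simp: pmf_map_ex intro!: ex_cong)
  have mm: "pmf (map_pmf (\<lambda>w. (A w, B w, C w)) p) (a, b, c) * ?b
      = ?ab * pmf (map_pmf (\<lambda>w. (B w, C w)) p) (b, c)"
    using m unfolding markov_chain_pmf by blast
  have rhs: "pmf (bind_pmf (map_pmf (\<lambda>w. (A w, B w)) p) (\<lambda>s. map_pmf (\<lambda>c. (fst s, snd s, c)) (cond_law p C B (snd s)))) t
     = ?ab * pmf (cond_law p C B b) c"
    unfolding t pmf_kernel[OF fin', of fst snd "cond_law p C B"] by simp
  show "pmf (map_pmf (\<lambda>w. (A w, B w, C w)) p) t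
     = pmf (bind_pmf (map_pmf (\<lambda>w. (A w, B w)) p) (\<lambda>s. map_pmf (\<lambda>c. (fst s, snd s, c)) (cond_law p C B (snd s)))) t"
  proof (cases "b \<in> B ` set_pmf p")
    case True
    then have "?b \<noteq> 0" by (simp add: set_pmf_iff[symmetric])
    moreover have "pmf (map_pmf (\<lambda>w. (A w, B w, C w)) p) (a, b, c) * ?b = (?ab * pmf (cond_law p C B b) c) * ?b"
      unfolding mm cl[symmetric] by simp
    ultimately show ?thesis unfolding rhs unfolding t by simp
  next
    case False
    then have "pmf (map_pmf (\<lambda>w. (A w, B w, C w)) p) (a, b, c) = 0" "?ab = 0"
      by (auto intro!: pmf_map_outside)
    then show ?thesis unfolding rhs unfolding t by simp
  qed
qed

text \<open>The middle variable may be relabelled, and each outer variable may be replaced by a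
  function of itself and the middle one. Injectivity is asked only on the range, since the numbering
  of message pairs is injective only there.\<close>

lemma markov_chain_fun_on:
  assumes fin: "finite (set_pmf p)" and m: "markov_chain p A B C" and e: "inj_on e (B ` set_pmf p)"
  shows "markov_chain p (\<lambda>w. g (A w) (B w)) (\<lambda>w. e (B w)) (\<lambda>w. h (C w) (B w))"
proof (rule markov_kernel)
  let ?r = "map_pmf (\<lambda>w. (A w, B w)) p"
  let ?inv = "inv_into (B ` set_pmf p) e"
  let ?k = "\<lambda>b'. map_pmf (\<lambda>c. h c (?inv b')) (cond_law p C B (?inv b'))"
  show "finite (set_pmf ?r)" using fin by simp
  have "map_pmf (\<lambda>w. (g (A w) (B w), e (B w), h (C w) (B w))) p
     = map_pmf (\<lambda>(a, b, c). (g a b, e b, h c b)) (map_pmf (\<lambda>w. (A w, B w, C w)) p)"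
    by (simp add: pmf.map_comp o_def)
  also have "\<dots> = bind_pmf ?r (\<lambda>s. map_pmf (\<lambda>c. (g (fst s) (snd s), e (snd s), c)) (?k (e (snd s))))"
    unfolding markov_chain_eq_kernel[OF fin m] map_bind_pmf
  proof (rule bind_pmf_cong[OF refl])
    fix s assume "s \<in> set_pmf ?r"
    then have "?inv (e (snd s)) = snd s" using e by (auto intro: inv_into_f_f)
    then show "map_pmf (\<lambda>(a, b, c). (g a b, e b, h c b)) (map_pmf (\<lambda>c. (fst s, snd s, c)) (cond_law p C B (snd s)))
      = map_pmf (\<lambda>c. (g (fst s) (snd s), e (snd s), c)) (?k (e (snd s)))"
      by (simp add: pmf.map_comp o_def)
  qed
  finally show "map_pmf (\<lambda>w. (g (A w) (B w), e (B w), h (C w) (B w))) p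
     = bind_pmf ?r (\<lambda>s. map_pmf (\<lambda>c. (g (fst s) (snd s), e (snd s), c)) (?k (e (snd s))))" .
qed

lemma markov_chain_fun:
  assumes "finite (set_pmf p)" "markov_chain p A B C" "inj e"
  shows "markov_chain p (\<lambda>w. g (A w) (B w)) (\<lambda>w. e (B w)) (\<lambda>w. h (C w) (B w))"
  using markov_chain_fun_on[OF assms(1,2) inj_on_subset[OF assms(3) subset_UNIV]] .

text \<open>Weak union: part of the right-hand variable may be moved into the condition.\<close>

lemma markov_chain_weak_union:
  fixes p :: "'w pmf" and A :: "'w \<Rightarrow> 'a" and B :: "'w \<Rightarrow> 'b" and C :: "'w \<Rightarrow> 'c" and D :: "'w \<Rightarrow> 'd"
  assumes fin: "finite (set_pmf p)" and m: "markov_chain p A B (\<lambda>w. (C w, D w))"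
  shows "markov_chain p A (\<lambda>w. (B w, C w)) D"
proof -
  have mc: "markov_chain p A B C"
    using markov_chain_fun[OF fin m inj_on_id, of "\<lambda>a _. a" "\<lambda>c _. fst c"] by simp
  have shuffle: "pmf (map_pmf (\<lambda>w. (A w, (B w, C w), D w)) p) (a, (b, c), d) = pmf (map_pmf (\<lambda>w. (A w, B w, C w, D w)) p) (a, b, c, d)"
    "pmf (map_pmf (\<lambda>w. ((B w, C w), D w)) p) ((b, c), d) = pmf (map_pmf (\<lambda>w. (B w, C w, D w)) p) (b, c, d)" for a b c d
    using fin by (auto simp: pmf_map_ex intro!: ex_cong)
  show ?thesis
    unfolding markov_chain_pmf
  proof (intro allI)
    fix a :: 'a and bc :: "'b \<times> 'c" and d :: 'd
    obtain b c where bc: "bc = (b, c)" by (cases bc)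
    let ?b = "pmf (map_pmf B p) b"
    have 1: "pmf (map_pmf (\<lambda>w. (A w, B w, C w, D w)) p) (a, b, c, d) * ?b
       = pmf (map_pmf (\<lambda>w. (A w, B w)) p) (a, b) * pmf (map_pmf (\<lambda>w. (B w, C w, D w)) p) (b, c, d)"
      using m unfolding markov_chain_pmf by blast
    have 2: "pmf (map_pmf (\<lambda>w. (A w, B w, C w)) p) (a, b, c) * ?b
       = pmf (map_pmf (\<lambda>w. (A w, B w)) p) (a, b) * pmf (map_pmf (\<lambda>w. (B w, C w)) p) (b, c)"
      using mc unfolding markov_chain_pmf by blast
    show "pmf (map_pmf (\<lambda>w. (A w, (B w, C w), D w)) p) (a, bc, d) * pmf (map_pmf (\<lambda>w. (B w, C w)) p) bc
        = pmf (map_pmf (\<lambda>w. (A w, (B w, C w))) p) (a, bc) * pmf (map_pmf (\<lambda>w. ((B w, C w), D w)) p) (bc, d)"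
      unfolding bc shuffle
    proof (cases "b \<in> B ` set_pmf p")
      case True
      then have "?b \<noteq> 0" by (simp add: set_pmf_iff[symmetric])
      \<comment> \<open>The two factorisations share the factor P(A, B); cross-multiplying them
        gives the claim times \<open>?b\<close>, which can be cancelled.\<close>
      moreover have "(pmf (map_pmf (\<lambda>w. (A w, B w, C w, D w)) p) (a, b, c, d) * pmf (map_pmf (\<lambda>w. (B w, C w)) p) (b, c)) * ?b
         = (pmf (map_pmf (\<lambda>w. (A w, B w, C w)) p) (a, b, c) * pmf (map_pmf (\<lambda>w. (B w, C w, D w)) p) (b, c, d)) * ?b"
        using 1 2 by algebra
      ultimately show "pmf (map_pmf (\<lambda>w. (A w, B w, C w, D w)) p) (a, b, c, d) * pmf (map_pmf (\<lambda>w. (B w, C w)) p) (b, c)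
        = pmf (map_pmf (\<lambda>w. (A w, B w, C w)) p) (a, b, c) * pmf (map_pmf (\<lambda>w. (B w, C w, D w)) p) (b, c, d)" by simp
    next
      case False
      then have "pmf (map_pmf (\<lambda>w. (B w, C w)) p) (b, c) = 0" "pmf (map_pmf (\<lambda>w. (B w, C w, D w)) p) (b, c, d) = 0"
        by (auto intro!: pmf_map_outside)
      then show "pmf (map_pmf (\<lambda>w. (A w, B w, C w, D w)) p) (a, b, c, d) * pmf (map_pmf (\<lambda>w. (B w, C w)) p) (b, c)
        = pmf (map_pmf (\<lambda>w. (A w, B w, C w)) p) (a, b, c) * pmf (map_pmf (\<lambda>w. (B w, C w, D w)) p) (b, c, d)" by simp
    qed
  qed
qed

text \<open>Conditional subadditivity, one letter at a time by \<open>ent_submod\<close>.\<close>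

lemma ent_map_upt_le:
  assumes fin: "finite (set_pmf p)"
  shows "ent p (\<lambda>w. (map (\<lambda>s. A s w) [0..<n], B w)) - ent p B \<le> (\<Sum>s<n. ent p (\<lambda>w. (A s w, B w)) - ent p B)"
proof (induction n)
  case 0
  have "ent p (\<lambda>w. (map (\<lambda>s. A s w) [0..<0], B w)) \<le> ent p B"
    by (rule ent_mono[OF fin, where g="\<lambda>b. ([], b)"]) simp
  then show ?case by simp
next
  case (Suc n)
  let ?L = "\<lambda>w. map (\<lambda>s. A s w) [0..<n]"
  have "ent p (\<lambda>w. (map (\<lambda>s. A s w) [0..<Suc n], B w)) \<le> ent p (\<lambda>w. (?L w, A n w, B w))"
    by (rule ent_mono[OF fin, where g="\<lambda>(l, a, b). (l @ [a], b)"]) simp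
  moreover have "ent p (\<lambda>w. (?L w, A n w, B w)) + ent p B \<le> ent p (\<lambda>w. (?L w, B w)) + ent p (\<lambda>w. (A n w, B w))"
    by (rule ent_submod[OF fin])
  ultimately show ?case using Suc by simp
qed

lemma ent_map_upt_le':
  assumes fin: "finite (set_pmf p)"
  shows "ent p (\<lambda>w. map (\<lambda>s. A s w) [0..<n]) \<le> (\<Sum>s<n. ent p (A s))"
proof -
  have "ent p (\<lambda>w. map (\<lambda>s. A s w) [0..<n]) \<le> ent p (\<lambda>w. (map (\<lambda>s. A s w) [0..<n], ()))"
    by (rule ent_mono[OF fin, where g=fst]) simp
  also have "\<dots> \<le> (\<Sum>s<n. ent p (\<lambda>w. (A s w, ())))"
    using ent_map_upt_le[OF fin, of A n "\<lambda>_. ()"] by simp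
  also have "\<dots> \<le> (\<Sum>s<n. ent p (A s))"
    by (intro sum_mono ent_mono[OF fin, where g="\<lambda>a. (a, ())"]) simp
  finally show ?thesis .
qed

text \<open>A selected block consists of optional lists, a letterwise selection is a list of
  optional letters. The conversion shows that the former is a function of the latter, so its entropy
  is no larger.\<close>

lemma select_eq_map_upt:
  assumes "length xs = n" "length ys = n" "length zs = n"
  shows "select S xs ys zs =
    (\<lambda>l. select S (map (the \<circ> fst) l) (map (the \<circ> fst \<circ> snd) l) (map (the \<circ> snd \<circ> snd) l))
      (map (\<lambda>s. select S (xs ! s) (ys ! s) (zs ! s)) [0..<n])"
  using assms by (auto simp: select_def o_def intro!: nth_equalityI)

lemma replicate_pmf_Suc_map: "replicate_pmf (Suc n) p = map_pmf (\<lambda>(x, xs). x # xs) (pair_pmf p (replicate_pmf n p))"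
  by (simp add: pair_pmf_def map_bind_pmf)

lemma finite_replicate_pmf [simp]: "finite (set_pmf p) \<Longrightarrow> finite (set_pmf (replicate_pmf n p))"
  by (induction n) auto

lemma Hp_replicate_pmf:
  assumes "finite (set_pmf p)"
  shows "Hp (replicate_pmf n p) = n * Hp p"
proof (induction n)
  case (Suc n)
  have "Hp (replicate_pmf (Suc n) p) = Hp (pair_pmf p (replicate_pmf n p))"
    unfolding replicate_pmf_Suc_map using assms by (intro Hp_map_inj) (auto simp: inj_on_def)
  then show ?case using assms Suc by (simp add: Hp_pair algebra_simps)
qed simp

lemma map_nth_replicate_pmf:
  "s < n \<Longrightarrow> map_pmf (\<lambda>xs. xs ! s) (replicate_pmf n p) = p"
proof (induction n arbitrary: s)
  case (Suc n)
  show ?case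
  proof (cases s)
    case 0
    then show ?thesis by (simp add: map_bind_pmf bind_return_pmf')
  next
    case (Suc s')
    then have "map_pmf (\<lambda>xs. xs ! s') (replicate_pmf n p) = p" using Suc.IH Suc.prems by simp
    then show ?thesis using Suc by (simp add: map_bind_pmf pmf.map_comp o_def flip: map_pmf_def)
  qed
qed simp

lemma index_set_finite [simp]: "finite (index_set a)"
  by (simp add: index_set_def)

lemma index_set_nonempty: "1 \<le> a \<Longrightarrow> index_set a \<noteq> {}"
  by (simp add: index_set_def) linarith

lemma card_index_set: "card (index_set a) = nat \<lfloor>a\<rfloor>"
  by (simp add: index_set_def)

lemma log_card_index_set:
  assumes "0 \<le> r" shows "log 2 (card (index_set (2 powr r))) \<le> r"
proof -
  have 1: "1 \<le> (2::real) powr r" using assms by (simp add: ge_one_powr_ge_zero)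
  then have "1 \<le> \<lfloor>(2::real) powr r\<rfloor>" by simp
  then have "real (nat \<lfloor>(2::real) powr r\<rfloor>) \<le> 2 powr r" "0 < real (nat \<lfloor>(2::real) powr r\<rfloor>)" by simp_all
  then have "log 2 (card (index_set (2 powr r))) \<le> log 2 (2 powr r)"
    unfolding card_index_set by (subst log_le_cancel_iff) auto
  then show ?thesis by simp
qed

lemma convex_combination_region:
  assumes "\<And>s. s < n \<Longrightarrow> t s \<in> region" "1 \<le> n"
  shows "(\<Sum>s<n. (1 / real n) *\<^sub>R t s) \<in> region"
  using assms by (intro convex_sum convex_region) auto

lemma dist1_sum: "dist1 d (\<Sum>s\<in>I. c *\<^sub>R t s) = c * (\<Sum>s\<in>I. dist1 d (t s))"
  unfolding dist1_def fst_sum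
  by (simp add: sum_distrib_left sum_distrib_right mult.assoc) (rule sum.swap)

lemma dist2_sum: "dist2 d (\<Sum>s\<in>I. c *\<^sub>R t s) = c * (\<Sum>s\<in>I. dist2 d (t s))"
  unfolding dist2_def fst_sum
  by (simp add: sum_distrib_left sum_distrib_right mult.assoc) (rule sum.swap)

lemma margX_sum: "margX (\<Sum>s\<in>I. c *\<^sub>R t s) x = c * (\<Sum>s\<in>I. margX (t s) x)"
  unfolding margX_def fst_sum
  by (simp add: sum_distrib_left) (rule sum.swap)

lemma sel_sum_sum:
  "sel_sum S (c * (\<Sum>s\<in>I. f s)) (c * (\<Sum>s\<in>I. g s)) (c * (\<Sum>s\<in>I. h s)) = c * (\<Sum>s\<in>I. sel_sum S (f s) (g s) (h s))"
  by (simp add: sel_sum_def sum.distrib distrib_left)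

section \<open>Single-letter bounds for a valid block system\<close>

locale valid_block =
  fixes R0 R1 R2 :: real and PX :: "'x::finite pmf" and n :: nat and p :: "('x, 'y::finite, 'z::finite) block pmf"
  assumes R: "0 \<le> R0" "0 \<le> R1" "0 \<le> R2" and n: "1 \<le> n" and valid: "valid_system R0 R1 R2 PX n p"
begin

text \<open>With M2 included in V1, the variable V2 = (M2, K) is a function of V1;
  \<open>to_nat\<close> turns the tuples into admissible auxiliary values.\<close>

definition "V1 w = to_nat (msg1 w, msg2 w, key w)" for w :: "('x, 'y, 'z) block"
definition "V2 w = to_nat (msg2 w, key w)" for w :: "('x, 'y, 'z) block"
definition "letter s w = Letter (srcs w ! s) (recs2 w ! s) (recs3 w ! s) (V1 w) (V2 w)" for w :: "('x, 'y, 'z) block"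

lemma xk: "map_pmf (\<lambda>w. (srcs w, key w)) p = pair_pmf (replicate_pmf n PX) (pmf_of_set (index_set (2 powr (real n * R0))))"
  using valid by (simp add: valid_system_def)

lemma key_set_ne: "index_set (2 powr (real n * R0)) \<noteq> {}"
  using R by (intro index_set_nonempty ge_one_powr_ge_zero) auto

lemma key_set: "set_pmf (pmf_of_set (index_set (2 powr (real n * R0)))) = index_set (2 powr (real n * R0))"
  using key_set_ne by (intro set_pmf_of_set) auto

lemma srcs_law: "map_pmf srcs p = replicate_pmf n PX"
proof -
  have "map_pmf srcs p = map_pmf fst (map_pmf (\<lambda>w. (srcs w, key w)) p)" by (simp add: pmf.map_comp o_def)
  then show ?thesis unfolding xk by (simp add: map_fst_pair_pmf)
qed

lemma key_law: "map_pmf key p = pmf_of_set (index_set (2 powr (real n * R0)))"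
proof -
  have "map_pmf key p = map_pmf snd (map_pmf (\<lambda>w. (srcs w, key w)) p)" by (simp add: pmf.map_comp o_def)
  then show ?thesis unfolding xk by (simp add: map_snd_pair_pmf)
qed

lemma support:
  assumes w: "w \<in> set_pmf p"
  shows "length (srcs w) = n" "length (recs2 w) = n" "length (recs3 w) = n"
    "key w \<in> index_set (2 powr (real n * R0))" "msg1 w \<in> index_set (2 powr (real n * R1))"
    "msg2 w \<in> index_set (2 powr (real n * R2))"
proof -
  have "srcs w \<in> set_pmf (map_pmf srcs p)" using w by simp
  then show "length (srcs w) = n" unfolding srcs_law by (simp add: set_replicate_pmf)
  have "key w \<in> set_pmf (map_pmf key p)" using w by simp
  then show "key w \<in> index_set (2 powr (real n * R0))" unfolding key_law key_set .
qed (use valid w in \<open>auto simp: valid_system_def\<close>)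

lemma fin: "finite (set_pmf p)"
proof (rule finite_subset)
  let ?L = "\<lambda>A. {xs. set xs \<subseteq> A \<and> length xs = n}"
  let ?I = "\<lambda>R. index_set (2 powr (real n * R))"
  let ?T = "?L (UNIV :: 'x set) \<times> ?I R0 \<times> ?I R1 \<times> ?I R2 \<times> ?L (UNIV :: 'y set) \<times> ?L (UNIV :: 'z set)"
  show "finite ((\<lambda>(a, b, c, d, e, f). Block a b c d e f) ` ?T)"
    by (intro finite_imageI finite_cartesian_product finite_lists_length_eq) auto
  show "set_pmf p \<subseteq> (\<lambda>(a, b, c, d, e, f). Block a b c d e f) ` ?T"
  proof
    fix w assume w: "w \<in> set_pmf p"
    show "w \<in> (\<lambda>(a, b, c, d, e, f). Block a b c d e f) ` ?T"
      by (rule image_eqI[of _ _ "(srcs w, key w, msg1 w, msg2 w, recs2 w, recs3 w)"])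
        (use support[OF w] in auto)
  qed
qed

lemma markov_a: "markov_chain p srcs (\<lambda>w. (msg1 w, key w)) (\<lambda>w. (msg2 w, recs2 w))"
  and markov_b: "markov_chain p (\<lambda>w. (srcs w, msg1 w, recs2 w)) (\<lambda>w. (msg2 w, key w)) recs3"
  using valid by (auto simp: valid_system_def)

text \<open>The system gives X^n - (M1, K) - (M2, Y2^n); weak union moves M2 into the
  condition.\<close>

lemma letter_markov1: "markov_chain (map_pmf (letter s) p) src aux1 rec2"
proof -
  have inj: "inj (\<lambda>((m1, k), m2). to_nat (m1 :: nat, m2 :: nat, k :: nat))" by (auto simp: inj_def)
  from markov_chain_fun[OF fin markov_chain_weak_union[OF fin markov_a] inj, of "\<lambda>x _. x ! s" "\<lambda>y _. y ! s"]
  show ?thesis by (simp add: markov_chain_map letter_def V1_def)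
qed

lemma letter_markov2: "markov_chain (map_pmf (letter s) p) (\<lambda>w. (src w, aux1 w, rec2 w)) aux2 rec3"
proof -
  have inj: "inj (\<lambda>mk :: nat \<times> nat. to_nat mk)" by (auto simp: inj_def)
  from markov_chain_fun[OF fin markov_b inj, of "\<lambda>(x, m1, y) (m2, k). (x ! s, to_nat (m1, m2, k), y ! s)" "\<lambda>z _. z ! s"]
  show ?thesis by (simp add: markov_chain_map letter_def V1_def V2_def)
qed

lemma letter_tuple: "\<exists>t\<in>region. represents t (map_pmf (letter s) p)"
proof (rule law_represented)
  show "finite (set_pmf (map_pmf (letter s) p))" using fin by simp
  show "aux2 w = (\<lambda>v. to_nat (snd (from_nat v :: nat \<times> nat \<times> nat))) (aux1 w)" if "w \<in> set_pmf (map_pmf (letter s) p)" for w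
    using that by (auto simp: letter_def V1_def V2_def)
qed (rule letter_markov1 letter_markov2)+

lemma ent_srcs_key: "ent p (\<lambda>w. (srcs w, key w)) = n * Hp PX + ent p key"
  unfolding xk key_law using key_set_ne by (subst Hp_pair) (auto simp: Hp_replicate_pmf)

text \<open>Since X^n is independent of K, I(X^n; M, K) = I(X^n; M | K), which is at most
  H(M).\<close>

lemma cond_ent_srcs_ge:
  fixes r :: real
  assumes "\<And>w. w \<in> set_pmf p \<Longrightarrow> m w \<in> index_set (2 powr (real n * r))" "0 \<le> r"
  shows "n * Hp PX - n * r \<le> ent p (\<lambda>w. (srcs w, m w, key w)) - ent p (\<lambda>w. (m w, key w))"
proof -
  have "ent p (\<lambda>w. (srcs w, key w)) \<le> ent p (\<lambda>w. (srcs w, m w, key w))"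
    by (rule ent_mono[OF fin, where g="\<lambda>(x, m, k). (x, k)"]) simp
  moreover have "ent p (\<lambda>w. (m w, key w)) \<le> ent p m + ent p key" by (rule ent_subadd[OF fin])
  moreover have "ent p m \<le> log 2 (card (index_set (2 powr (real n * r))))"
    using assms by (intro Hp_le_log_card) auto
  moreover have "\<dots> \<le> real n * r" using assms by (intro log_card_index_set) auto
  ultimately show ?thesis using ent_srcs_key by linarith
qed

text \<open>Given (M1, K), the message M2 says nothing more about X^n, so V1 obeys the rate bound of
  M1 alone.\<close>

lemma cond_ent_V1: "n * Hp PX - n * R1 \<le> ent p (\<lambda>w. (srcs w, V1 w)) - ent p V1"
proof -
  have "markov_chain p srcs (\<lambda>w. (msg1 w, key w)) msg2"
    using markov_chain_fun[OF fin markov_a inj_on_id, of "\<lambda>a _. a" "\<lambda>c _. fst c"] by simp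
  from ent_markov[OF fin this]
  have "ent p (\<lambda>w. (srcs w, (msg1 w, key w), msg2 w)) + ent p (\<lambda>w. (msg1 w, key w))
     = ent p (\<lambda>w. (srcs w, (msg1 w, key w))) + ent p (\<lambda>w. ((msg1 w, key w), msg2 w))" .
  moreover have "ent p (\<lambda>w. (srcs w, V1 w)) = ent p (\<lambda>w. (srcs w, (msg1 w, key w), msg2 w))"
    by (rule ent_cong_fun[OF fin, where g="\<lambda>(x, (m1, k), m2). (x, to_nat (m1, m2, k))"
        and h="\<lambda>(x, v). case from_nat v of (m1, m2, k) \<Rightarrow> (x, (m1, k), m2)"]) (auto simp: V1_def)
  moreover have "ent p V1 = ent p (\<lambda>w. ((msg1 w, key w), msg2 w))"
    by (rule ent_cong_fun[OF fin, where g="\<lambda>((m1, k), m2). to_nat (m1, m2, k)"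
        and h="\<lambda>v. case from_nat v of (m1, m2, k) \<Rightarrow> ((m1, k), m2)"]) (auto simp: V1_def)
  ultimately show ?thesis using cond_ent_srcs_ge[where m=msg1 and r=R1] support R by fastforce
qed

lemma cond_ent_V2: "n * Hp PX - n * R2 \<le> ent p (\<lambda>w. (srcs w, V2 w)) - ent p V2"
proof -
  have "ent p (\<lambda>w. (srcs w, V2 w)) = ent p (\<lambda>w. (srcs w, msg2 w, key w))"
    by (rule ent_cong_fun[OF fin, where g="\<lambda>(x, m). (x, to_nat m)"
        and h="\<lambda>(x, v). (x, from_nat v)"]) (auto simp: V2_def)
  moreover have "ent p V2 = ent p (\<lambda>w. (msg2 w, key w))"
    by (rule ent_cong_fun[OF fin, where g=to_nat and h=from_nat]) (auto simp: V2_def)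
  ultimately show ?thesis using cond_ent_srcs_ge[where m=msg2 and r=R2] support R by fastforce
qed

lemma cond_ent_srcs_le:
  "ent p (\<lambda>w. (srcs w, V w)) - ent p V \<le> (\<Sum>s<n. ent p (\<lambda>w. (srcs w ! s, V w)) - ent p V)"
proof -
  have "ent p (\<lambda>w. (srcs w, V w)) = ent p (\<lambda>w. (map (\<lambda>s. srcs w ! s) [0..<n], V w))"
  proof (intro arg_cong[of _ _ Hp] map_pmf_cong refl)
    fix w assume "w \<in> set_pmf p"
    then show "(srcs w, V w) = (map (\<lambda>s. srcs w ! s) [0..<n], V w)"
      using map_nth[of "srcs w"] support(1) by simp
  qed
  then show ?thesis using ent_map_upt_le[OF fin, of "\<lambda>s w. srcs w ! s" n V] by simp
qed

abbreviation "sel S w \<equiv> select S (srcs w) (recs2 w) (recs3 w)"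
abbreviation "sel1 S s w \<equiv> select S (srcs w ! s) (recs2 w ! s) (recs3 w ! s)"

lemma ent_sel_le: "ent p (sel S) \<le> (\<Sum>s<n. ent p (sel1 S s))"
proof -
  have "ent p (sel S) \<le> ent p (\<lambda>w. map (\<lambda>s. sel1 S s w) [0..<n])"
  proof (rule ent_mono[OF fin])
    fix w assume w: "w \<in> set_pmf p"
    show "sel S w = (\<lambda>l. select S (map (the \<circ> fst) l) (map (the \<circ> fst \<circ> snd) l) (map (the \<circ> snd \<circ> snd) l))
        (map (\<lambda>s. sel1 S s w) [0..<n])"
      using support[OF w] by (intro select_eq_map_upt) auto
  qed
  then show ?thesis using ent_map_upt_le'[OF fin, of "\<lambda>s. sel1 S s" n] by simp
qed

lemma cond_ent_sel_le: "ent p (\<lambda>w. (sel S w, V w)) - ent p V \<le> (\<Sum>s<n. ent p (\<lambda>w. (sel1 S s w, V w)) - ent p V)"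
proof -
  let ?h = "\<lambda>l. select S (map (the \<circ> fst) l) (map (the \<circ> fst \<circ> snd) l) (map (the \<circ> snd \<circ> snd) l)"
  have "ent p (\<lambda>w. (sel S w, V w)) \<le> ent p (\<lambda>w. (map (\<lambda>s. sel1 S s w) [0..<n], V w))"
  proof (rule ent_mono[OF fin, where g="\<lambda>(l, v). (?h l, v)"])
    fix w assume "w \<in> set_pmf p"
    then show "(sel S w, V w) = (\<lambda>(l, v). (?h l, v)) (map (\<lambda>s. sel1 S s w) [0..<n], V w)"
      using select_eq_map_upt[of "srcs w" n "recs2 w" "recs3 w" S] support[of w] by simp
  qed
  then show ?thesis using ent_map_upt_le[OF fin, of "\<lambda>s w. sel1 S s w" n V] by simp
qed

text \<open>First bound: drop the conditioning. Second bound: hand the key to the adversary, which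
  costs at most H(K) \<le> n R0 and turns the condition into V1.\<close>

lemma equivocation_le:
  "equivocation S n p \<le> (1 / n) * (\<Sum>s<n. ent p (sel1 S s))"
  "equivocation S n p \<le> R0 + (1 / n) * (\<Sum>s<n. ent p (\<lambda>w. (sel1 S s w, V1 w)) - ent p V1)"
proof -
  let ?M = "\<lambda>w. (msg1 w, msg2 w)"
  have eq: "equivocation S n p = (1 / n) * (ent p (\<lambda>w. (sel S w, ?M w)) - ent p ?M)"
    unfolding equivocation_def cond_entropy2_ent[OF fin] ..
  have "ent p (\<lambda>w. (sel S w, ?M w)) - ent p ?M \<le> (\<Sum>s<n. ent p (sel1 S s))"
    using ent_subadd[OF fin, of "sel S" ?M] ent_sel_le[of S] by linarith
  then show "equivocation S n p \<le> (1 / n) * (\<Sum>s<n. ent p (sel1 S s))"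
    unfolding eq by (intro mult_left_mono) auto
  have "ent p (\<lambda>w. (sel S w, ?M w)) \<le> ent p (\<lambda>w. (sel S w, V1 w))"
    by (rule ent_mono[OF fin, where g="\<lambda>(s, v). case from_nat v of (m1, m2, k :: nat) \<Rightarrow> (s, m1, m2)"]) (simp add: V1_def)
  moreover have "ent p V1 \<le> ent p (\<lambda>w. (?M w, key w))"
    by (rule ent_mono[OF fin, where g="\<lambda>((m1, m2), k). to_nat (m1, m2, k)"]) (simp add: V1_def)
  moreover have "\<dots> \<le> ent p ?M + ent p key" by (rule ent_subadd[OF fin])
  moreover have "ent p key \<le> log 2 (card (index_set (2 powr (real n * R0))))"
    using support by (intro Hp_le_log_card) auto
  moreover have "\<dots> \<le> real n * R0" using R by (intro log_card_index_set) auto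
  ultimately have "ent p (\<lambda>w. (sel S w, ?M w)) - ent p ?M \<le> n * R0 + (\<Sum>s<n. ent p (\<lambda>w. (sel1 S s w, V1 w)) - ent p V1)"
    using cond_ent_sel_le[of S V1] by linarith
  then have "equivocation S n p \<le> (1 / n) * (n * R0 + (\<Sum>s<n. ent p (\<lambda>w. (sel1 S s w, V1 w)) - ent p V1))"
    unfolding eq by (intro mult_left_mono) auto
  then show "equivocation S n p \<le> R0 + (1 / n) * (\<Sum>s<n. ent p (\<lambda>w. (sel1 S s w, V1 w)) - ent p V1)"
    using n by (simp add: distrib_left)
qed

text \<open>The tuples of the n letters are averaged with weight 1 / n. Their entries are affine
  under averaging and H(S) is concave, so no time-sharing variable has to be adjoined to V1 and
  V2.\<close>

lemma converse_tuple:
  "\<exists>t\<in>feasible R1 R2 PX d1 d2 (distortion2 d1 n p) (distortion3 d2 n p). \<forall>S. equivocation S n p \<le> tuple_value R0 S t"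
proof -
  have "\<exists>t. \<forall>s. t s \<in> region \<and> represents (t s) (map_pmf (letter s) p)"
    by (intro choice allI) (use letter_tuple in blast)
  then obtain t where tr: "\<And>s. t s \<in> region" and rep: "\<And>s. represents (t s) (map_pmf (letter s) p)" by blast
  have fl: "finite (set_pmf (map_pmf (letter s) p))" for s using fin by simp
  define T where "T = (\<Sum>s<n. (1 / real n) *\<^sub>R t s)"
  have T: "T \<in> region" unfolding T_def by (rule convex_combination_region) (use tr n in auto)
  have comp: "hX1 T = 1 / n * (\<Sum>s<n. hX1 (t s))" "hY1 T = 1 / n * (\<Sum>s<n. hY1 (t s))"
    "hZ2 T = 1 / n * (\<Sum>s<n. hZ2 (t s))" "hX2 T = 1 / n * (\<Sum>s<n. hX2 (t s))"
    by (simp_all add: T_def fst_sum snd_sum sum_divide_distrib)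
  have n0: "0 < real n" using n by simp
  have marg: "margX T x = pmf PX x" for x
  proof -
    have "margX (t s) x = pmf PX x" if s: "s < n" for s
    proof -
      have "map_pmf src (map_pmf (letter s) p) = map_pmf (\<lambda>xs. xs ! s) (map_pmf srcs p)"
        by (simp add: pmf.map_comp o_def letter_def)
      also have "\<dots> = PX" unfolding srcs_law by (rule map_nth_replicate_pmf[OF s])
      finally show ?thesis unfolding represents_margX[OF fl rep] by simp
    qed
    then show ?thesis using n0 by (simp add: T_def margX_sum)
  qed
  have d1: "dist1 d1 T = distortion2 d1 n p"
    unfolding T_def dist1_sum distortion2_def represents_dist1[OF fl rep]
    using fin by (simp add: letter_def flip: ex_eq_expectation) (simp add: ex_divide ex_sum)
  have d2: "dist2 d2 T = distortion3 d2 n p"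
    unfolding T_def dist2_sum distortion3_def represents_dist2[OF fl rep]
    using fin by (simp add: letter_def flip: ex_eq_expectation) (simp add: ex_divide ex_sum)
  have h1: "hX1 (t s) = ent p (\<lambda>w. (srcs w ! s, V1 w)) - ent p V1"
    and h2: "hX2 (t s) = ent p (\<lambda>w. (srcs w ! s, V2 w)) - ent p V2"
    and hS: "sel_sum S (hX1 (t s)) (hY1 (t s)) (hZ2 (t s)) = ent p (\<lambda>w. (sel1 S s w, V1 w)) - ent p V1" for s S
    using rep[of s, unfolded represents_def pmf.map_comp o_def letter_def letter.sel] by blast+
  have "n * Hp PX - n * R1 \<le> n * hX1 T"
    using cond_ent_V1 cond_ent_srcs_le[of V1] n0 by (simp add: comp h1)
  then have r1: "Hp PX - hX1 T \<le> R1" using n0 mult_le_cancel_left_pos[of "real n" "Hp PX - R1" "hX1 T"]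
    by (simp add: right_diff_distrib)
  have "n * Hp PX - n * R2 \<le> n * hX2 T"
    using cond_ent_V2 cond_ent_srcs_le[of V2] n0 by (simp add: comp h2)
  then have r2: "Hp PX - hX2 T \<le> R2" using n0 mult_le_cancel_left_pos[of "real n" "Hp PX - R2" "hX2 T"]
    by (simp add: right_diff_distrib)
  have "equivocation S n p \<le> tuple_value R0 S T" for S
  proof -
    have "1 / n * (\<Sum>s<n. ent p (sel1 S s)) = (\<Sum>s<n. 1 / n * HS S (fst (t s)))"
      unfolding represents_HS[OF fl rep] by (simp add: pmf.map_comp o_def letter_def sum_divide_distrib)
    also have "\<dots> \<le> HS S (\<Sum>s<n. (1 / n) *\<^sub>R fst (t s))"
      by (intro HS_jensen) (use n0 region_nth_nonneg[OF tr] in auto)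
    also have "(\<Sum>s<n. (1 / n) *\<^sub>R fst (t s)) = fst T" by (simp add: T_def fst_sum)
    finally have "equivocation S n p \<le> HS S (fst T)" using equivocation_le(1)[of S] by linarith
    moreover have "sel_sum S (hX1 T) (hY1 T) (hZ2 T) = 1 / n * (\<Sum>s<n. ent p (\<lambda>w. (sel1 S s w, V1 w)) - ent p V1)"
      unfolding comp sel_sum_sum hS ..
    then have "equivocation S n p \<le> R0 + sel_sum S (hX1 T) (hY1 T) (hZ2 T)"
      using equivocation_le(2)[of S] by simp
    ultimately show ?thesis by (simp add: tuple_value_def)
  qed
  then show ?thesis using T marg d1 d2 r1 r2 by (intro bexI[of _ T]) (auto simp: feasible_def)
qed

end

section \<open>One-shot achievability\<close>

definition l1_dist :: "'a pmf \<Rightarrow> 'a pmf \<Rightarrow> real" where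
  "l1_dist p q = (\<Sum>a\<in>set_pmf p \<union> set_pmf q. \<bar>pmf p a - pmf q a\<bar>)"

lemma l1_dist_eq_sum:
  "finite A \<Longrightarrow> set_pmf p \<union> set_pmf q \<subseteq> A \<Longrightarrow> l1_dist p q = (\<Sum>a\<in>A. \<bar>pmf p a - pmf q a\<bar>)"
  unfolding l1_dist_def by (rule sum.mono_neutral_left) (auto simp: set_pmf_iff)

lemma l1_dist_nonneg: "0 \<le> l1_dist p q"
  unfolding l1_dist_def by (intro sum_nonneg) auto

lemma ex_l1_dist:
  assumes fin: "finite (set_pmf p)" "finite (set_pmf q)"
    and f: "\<And>a. a \<in> set_pmf p \<union> set_pmf q \<Longrightarrow> \<bar>f a\<bar> \<le> M"
  shows "ex p f \<le> ex q f + M * l1_dist p q"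
proof -
  let ?A = "set_pmf p \<union> set_pmf q"
  have "ex p f - ex q f = (\<Sum>a\<in>?A. (pmf p a - pmf q a) * f a)"
    using fin ex_eq_sum[of ?A p f] ex_eq_sum[of ?A q f] by (simp add: left_diff_distrib sum_subtractf)
  also have "\<dots> \<le> (\<Sum>a\<in>?A. M * \<bar>pmf p a - pmf q a\<bar>)"
  proof (rule sum_mono)
    fix a assume "a \<in> ?A"
    then have "\<bar>f a\<bar> \<le> M" by (rule f)
    have "(pmf p a - pmf q a) * f a \<le> \<bar>pmf p a - pmf q a\<bar> * \<bar>f a\<bar>" unfolding abs_mult[symmetric] by (rule abs_ge_self)
    also have "\<dots> \<le> \<bar>pmf p a - pmf q a\<bar> * M" using \<open>\<bar>f a\<bar> \<le> M\<close> by (intro mult_left_mono) auto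
    finally show "(pmf p a - pmf q a) * f a \<le> M * \<bar>pmf p a - pmf q a\<bar>" by (simp add: mult.commute)
  qed
  also have "\<dots> = M * l1_dist p q" by (simp add: l1_dist_def sum_distrib_left)
  finally show ?thesis by simp
qed

text \<open>Data processing: passing both laws through one kernel does not increase their
  distance.\<close>

lemma l1_dist_bind:
  assumes fin: "finite (set_pmf p)" "finite (set_pmf q)" "\<And>x. finite (set_pmf (k x))"
  shows "l1_dist (bind_pmf p k) (bind_pmf q k) \<le> l1_dist p q"
proof -
  let ?A = "set_pmf p \<union> set_pmf q"
  let ?B = "\<Union>x\<in>?A. set_pmf (k x)"
  have "l1_dist (bind_pmf p k) (bind_pmf q k) = (\<Sum>b\<in>?B. \<bar>pmf (bind_pmf p k) b - pmf (bind_pmf q k) b\<bar>)"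
    using fin by (intro l1_dist_eq_sum) auto
  also have "\<dots> = (\<Sum>b\<in>?B. \<bar>\<Sum>a\<in>?A. (pmf p a - pmf q a) * pmf (k a) b\<bar>)"
    using fin by (simp add: pmf_bind_ex ex_eq_sum[of ?A] left_diff_distrib sum_subtractf)
  also have "\<dots> \<le> (\<Sum>b\<in>?B. \<Sum>a\<in>?A. \<bar>pmf p a - pmf q a\<bar> * pmf (k a) b)"
    by (intro sum_mono order_trans[OF sum_abs]) (simp add: abs_mult)
  also have "\<dots> = (\<Sum>a\<in>?A. \<bar>pmf p a - pmf q a\<bar> * (\<Sum>b\<in>?B. pmf (k a) b))"
    unfolding sum_distrib_left by (rule sum.swap)
  also have "\<dots> = (\<Sum>a\<in>?A. \<bar>pmf p a - pmf q a\<bar> * 1)"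
    using fin by (intro sum.cong refl arg_cong2[of _ _ _ _ "(*)"] sum_pmf_eq_1) auto
  finally show ?thesis by (simp add: l1_dist_def)
qed

lemma l1_dist_map:
  assumes "finite (set_pmf p)" "finite (set_pmf q)"
  shows "l1_dist (map_pmf g p) (map_pmf g q) \<le> l1_dist p q"
  using l1_dist_bind[OF assms, of "\<lambda>x. return_pmf (g x)"] by (simp add: map_pmf_def)

definition rel_ent :: "'a pmf \<Rightarrow> 'a pmf \<Rightarrow> real" where
  "rel_ent p q = ex p (\<lambda>a. log 2 (pmf p a) - log 2 (pmf q a))"

text \<open>Comparison with the Hellinger distance gives a weak form of Pinsker's inequality.\<close>

lemma l1_dist_le_rel_ent:
  assumes fin: "finite (set_pmf q)" and sub: "set_pmf p \<subseteq> set_pmf q"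
  shows "0 \<le> rel_ent p q" "l1_dist p q \<le> 2 * sqrt (rel_ent p q)"
proof -
  let ?A = "set_pmf q"
  have finp: "finite (set_pmf p)" using finite_subset[OF sub fin] .
  define h where "h = (\<Sum>a\<in>?A. (sqrt (pmf p a) - sqrt (pmf q a))\<^sup>2)"
  have s1: "(\<Sum>a\<in>?A. pmf p a) = 1" "(\<Sum>a\<in>?A. pmf q a) = 1"
    using fin sub by (auto intro!: sum_pmf_eq_1)
  have h0: "0 \<le> h" unfolding h_def by (intro sum_nonneg) auto
  have h: "h = 2 - 2 * (\<Sum>a\<in>?A. sqrt (pmf p a) * sqrt (pmf q a))"
    unfolding h_def by (simp add: power2_diff sum.distrib sum_subtractf s1 sum_distrib_left mult.assoc)
  have "h / ln 2 = ex p (\<lambda>a. 2 * (1 - sqrt (pmf q a) / sqrt (pmf p a)) / ln 2)"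
  proof -
    have "ex p (\<lambda>a. 2 * (1 - sqrt (pmf q a) / sqrt (pmf p a)) / ln 2)
       = (\<Sum>a\<in>?A. (2 * pmf p a - 2 * (sqrt (pmf p a) * sqrt (pmf q a))) / ln 2)"
      unfolding ex_eq_sum[OF fin sub]
    proof (intro sum.cong refl)
      fix a
      have "pmf p a = sqrt (pmf p a) * sqrt (pmf p a)" by simp
      then have e: "pmf p a * (sqrt (pmf q a) / sqrt (pmf p a)) = sqrt (pmf p a) * sqrt (pmf q a)"
        by (cases "pmf p a = 0") (auto simp: field_simps)
      have gen: "x * (2 * (1 - R) / c) = (2 * x - 2 * (x * R)) / c" for x R c :: real
        by (simp add: right_diff_distrib)
      show "pmf p a * (2 * (1 - sqrt (pmf q a) / sqrt (pmf p a)) / ln 2) = (2 * pmf p a - 2 * (sqrt (pmf p a) * sqrt (pmf q a))) / ln 2"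
        unfolding gen e ..
    qed
    also have "\<dots> = h / ln 2"
      unfolding h sum_divide_distrib[symmetric] sum_subtractf sum_distrib_left[symmetric] s1 by simp
    finally show ?thesis ..
  qed
  also have "\<dots> \<le> rel_ent p q"
    unfolding rel_ent_def
  proof (rule ex_mono)
    fix a assume a: "a \<in> set_pmf p"
    then have pos: "0 < pmf p a" "0 < pmf q a" using sub by (auto simp: pmf_positive)
    have "log 2 (sqrt (pmf q a)) \<le> log 2 (sqrt (pmf p a)) + (sqrt (pmf q a) / sqrt (pmf p a) - 1) / ln 2"
      using pos by (intro log2_le_tangent) auto
    then have "log 2 (pmf q a) / 2 \<le> log 2 (pmf p a) / 2 + (sqrt (pmf q a) / sqrt (pmf p a) - 1) / ln 2"
      using pos by (simp add: log_def ln_sqrt)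
    moreover have "2 * (1 - R) / c \<le> y - x" if "x / 2 \<le> y / 2 + (R - 1) / c" for x y R c :: real
      using that by (simp add: diff_divide_distrib)
    ultimately show "2 * (1 - sqrt (pmf q a) / sqrt (pmf p a)) / ln 2 \<le> log 2 (pmf p a) - log 2 (pmf q a)"
      by blast
  qed
  finally have hD: "h / ln 2 \<le> rel_ent p q" .
  have "h \<le> h / ln 2" using h0 ln_2_less_1 by (simp add: field_simps mult_left_le)
  then have hD': "h \<le> rel_ent p q" using hD by linarith
  then show "0 \<le> rel_ent p q" using h0 by linarith
  have "l1_dist p q = (\<Sum>a\<in>?A. \<bar>sqrt (pmf p a) - sqrt (pmf q a)\<bar> * \<bar>sqrt (pmf p a) + sqrt (pmf q a)\<bar>)"
    unfolding l1_dist_eq_sum[OF fin, of p q, OF Un_least[OF sub order_refl]] abs_mult[symmetric]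
    by (intro sum.cong) (auto simp: algebra_simps)
  \<comment> \<open>Cauchy-Schwarz after factoring |p - q| into difference and sum of square roots;
    the squared sums add up to at most 4.\<close>
  also have "\<dots> \<le> sqrt (\<Sum>a\<in>?A. (sqrt (pmf p a) - sqrt (pmf q a))\<^sup>2) * sqrt (\<Sum>a\<in>?A. (sqrt (pmf p a) + sqrt (pmf q a))\<^sup>2)"
    using L2_set_mult_ineq[of "\<lambda>a. sqrt (pmf p a) - sqrt (pmf q a)" "\<lambda>a. sqrt (pmf p a) + sqrt (pmf q a)" ?A]
    by (simp add: L2_set_def)
  also have "(\<Sum>a\<in>?A. (sqrt (pmf p a) + sqrt (pmf q a))\<^sup>2) \<le> (\<Sum>a\<in>?A. 2 * pmf p a + 2 * pmf q a)"
  proof (rule sum_mono)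
    fix a
    have "0 \<le> (sqrt (pmf p a) - sqrt (pmf q a))\<^sup>2" by simp
    then show "(sqrt (pmf p a) + sqrt (pmf q a))\<^sup>2 \<le> 2 * pmf p a + 2 * pmf q a"
      by (simp add: power2_sum power2_diff)
  qed
  also have "\<dots> = 4" by (simp add: sum.distrib s1 flip: sum_distrib_left)
  finally have "l1_dist p q \<le> sqrt h * sqrt 4"
    unfolding h_def by (simp add: mult_left_mono h_def[symmetric] h0)
  also have "\<dots> \<le> 2 * sqrt (rel_ent p q)" using hD' by simp
  finally show "l1_dist p q \<le> 2 * sqrt (rel_ent p q)" .
qed

subsection \<open>Continuity of conditional entropy\<close>

text \<open>Conditional entropy of an unnormalised measure on \<open>T \<times> M\<close>; without
  the normalisation it is superadditive, so the common part of two laws can be split off.\<close>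

definition hmass :: "'s set \<Rightarrow> 'm set \<Rightarrow> ('s \<Rightarrow> 'm \<Rightarrow> real) \<Rightarrow> real" where
  "hmass T M f = (\<Sum>m\<in>M. \<Sum>s\<in>T. f s m * (log 2 (\<Sum>s\<in>T. f s m) - log 2 (f s m)))"

text \<open>The log-sum inequality for two pairs.\<close>

lemma log_sum_2:
  assumes "0 \<le> f" "f \<le> F" "0 \<le> g" "g \<le> G"
  shows "f * (log 2 F - log 2 f) + g * (log 2 G - log 2 g) \<le> (f + g) * (log 2 (F + G) - log 2 (f + g))"
proof (cases "f + g = 0")
  case True
  then have "f = 0" "g = 0" using assms by linarith+
  then show ?thesis by simp
next
  case False
  then have fg: "0 < f + g" using assms by simp
  have FG: "0 < F + G" using assms fg by linarith
  have gen: "h * (L + (R - 1) / c) = h * L + (h * R - h) / c" for h L R c :: real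
    by (simp add: distrib_left right_diff_distrib)
  \<comment> \<open>Tangent at the common ratio (F + G) / (f + g); the error terms of the two pairs
    cancel.\<close>
  have *: "h * (log 2 H - log 2 h) \<le> h * (log 2 (F + G) - log 2 (f + g)) + (H * (f + g) / (F + G) - h) / ln 2"
    if "0 \<le> h" "h \<le> H" for h H
  proof (cases "h = 0")
    case True
    then show ?thesis using that fg FG by simp
  next
    case False
    then have h: "0 < h" "0 < H" using that by auto
    have "log 2 (H / h) \<le> log 2 ((F + G) / (f + g)) + ((H / h) / ((F + G) / (f + g)) - 1) / ln 2"
      using h fg FG by (intro log2_le_tangent) auto
    then have "h * (log 2 H - log 2 h) \<le> h * ((log 2 (F + G) - log 2 (f + g)) + ((H / h) / ((F + G) / (f + g)) - 1) / ln 2)"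
      using h fg FG by (intro mult_left_mono) (auto simp: log_divide)
    also have "\<dots> = h * (log 2 (F + G) - log 2 (f + g)) + (H * (f + g) / (F + G) - h) / ln 2"
      unfolding gen using h by simp
    finally show ?thesis .
  qed
  have "(F * (f + g) / (F + G) - f) / ln 2 + (G * (f + g) / (F + G) - g) / ln 2 = 0"
  proof -
    have "F * (f + g) / (F + G) + G * (f + g) / (F + G) = f + g"
      using FG by (simp add: add_divide_distrib[symmetric] distrib_right[symmetric])
    moreover have "(x - f) / c + (y - g) / c = 0" if "x + y = f + g" for x y c :: real
      unfolding add_divide_distrib[symmetric] using that by simp
    ultimately show ?thesis by blast
  qed
  then show ?thesis using *[of f F] *[of g G] assms by (simp add: distrib_right)
qed

text \<open>\<open>hmass\<close> is homogeneous of degree one, so this is concavity of conditional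
  entropy; entrywise it is the log-sum inequality.\<close>

lemma hmass_superadd:
  assumes "finite T" "\<And>s m. 0 \<le> f s m" "\<And>s m. 0 \<le> g s m"
  shows "hmass T M f + hmass T M g \<le> hmass T M (\<lambda>s m. f s m + g s m)"
  unfolding hmass_def sum.distrib[symmetric]
proof (intro sum_mono)
  fix m s assume s: "s \<in> T"
  have "f s m \<le> (\<Sum>s\<in>T. f s m)" "g s m \<le> (\<Sum>s\<in>T. g s m)" using assms s by (auto intro!: member_le_sum)
  from log_sum_2[OF assms(2) this(1) assms(3) this(2)]
  show "f s m * (log 2 (\<Sum>s\<in>T. f s m) - log 2 (f s m)) + g s m * (log 2 (\<Sum>s\<in>T. g s m) - log 2 (g s m))
     \<le> (f s m + g s m) * (log 2 (\<Sum>s\<in>T. f s m + g s m) - log 2 (f s m + g s m))"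
    by (simp only: sum.distrib)
qed

lemma hmass_nonneg:
  assumes "finite T" "\<And>s m. 0 \<le> f s m"
  shows "0 \<le> hmass T M f"
  unfolding hmass_def
proof (intro sum_nonneg)
  fix m s assume s: "s \<in> T"
  have "f s m \<le> (\<Sum>s\<in>T. f s m)" using assms s by (intro member_le_sum) auto
  then show "0 \<le> f s m * (log 2 (\<Sum>s\<in>T. f s m) - log 2 (f s m))"
    using assms(2)[of s m] by (cases "f s m = 0") (auto intro!: mult_nonneg_nonneg)
qed

text \<open>Splitting a measure in two can save at most the entropy of the label that names the
  part, which is linear in the total mass.\<close>

lemma hmass_subadd:
  assumes fin: "finite T" and f: "\<And>s m. 0 \<le> f s m" and g: "\<And>s m. 0 \<le> g s m"
  shows "hmass T M (\<lambda>s m. f s m + g s m)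
    \<le> hmass T M f + hmass T M g + 2 * (\<Sum>m\<in>M. \<Sum>s\<in>T. f s m + g s m)"
proof -
  have point: "(x + y) * (log 2 (F + G) - log 2 (x + y))
     \<le> x * (log 2 F - log 2 x) + y * (log 2 G - log 2 y) + x * (log 2 (F + G) - log 2 F) + y * (log 2 (F + G) - log 2 G)"
    if "0 \<le> x" "0 \<le> y" for x y F G :: real
  proof -
    have "x * log 2 x \<le> x * log 2 (x + y)" using that by (cases "x = 0") auto
    moreover have "y * log 2 y \<le> y * log 2 (x + y)" using that by (cases "y = 0") auto
    ultimately show ?thesis by (simp add: algebra_simps)
  qed
  have tot: "F * (log 2 (F + G) - log 2 F) \<le> 2 * G" if "0 \<le> F" "0 \<le> G" for F G :: real
  proof (cases "F = 0")
    case False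
    then have F: "0 < F" using that by simp
    have "log 2 (F + G) \<le> log 2 F + ((F + G) / F - 1) / ln 2" using F that by (intro log2_le_tangent) auto
    then have "F * (log 2 (F + G) - log 2 F) \<le> F * (((F + G) / F - 1) / ln 2)" using F by (intro mult_left_mono) auto
    also have "\<dots> = G / ln 2" using F by (simp add: field_simps)
    also have "\<dots> \<le> 2 * G"
    proof -
      have "G * 1 \<le> G * (2 * ln 2)" using that ln2_ge_two_thirds by (intro mult_left_mono) auto
      then show ?thesis by (simp add: field_simps)
    qed
    finally show ?thesis .
  qed (use that in simp)
  let ?F = "\<lambda>m. \<Sum>s\<in>T. f s m" and ?G = "\<lambda>m. \<Sum>s\<in>T. g s m"
  have d: "(\<Sum>s\<in>T. f s m + g s m) = ?F m + ?G m" for m by (rule sum.distrib)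
  have "hmass T M (\<lambda>s m. f s m + g s m) \<le> (\<Sum>m\<in>M. \<Sum>s\<in>T.
      f s m * (log 2 (?F m) - log 2 (f s m)) + g s m * (log 2 (?G m) - log 2 (g s m))
      + f s m * (log 2 (?F m + ?G m) - log 2 (?F m)) + g s m * (log 2 (?F m + ?G m) - log 2 (?G m)))"
    unfolding hmass_def d by (intro sum_mono point f g)
  also have "\<dots> = hmass T M f + hmass T M g + (\<Sum>m\<in>M. ?F m * (log 2 (?F m + ?G m) - log 2 (?F m)) + ?G m * (log 2 (?F m + ?G m) - log 2 (?G m)))"
    unfolding hmass_def sum.distrib sum_distrib_right[symmetric] by simp
  also have "\<dots> \<le> hmass T M f + hmass T M g + (\<Sum>m\<in>M. 2 * ?G m + 2 * ?F m)"
  proof (intro add_left_mono sum_mono add_mono)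
    fix m
    have n: "0 \<le> ?F m" "0 \<le> ?G m" using f g by (auto intro!: sum_nonneg)
    show "?F m * (log 2 (?F m + ?G m) - log 2 (?F m)) \<le> 2 * ?G m" by (rule tot[OF n])
    show "?G m * (log 2 (?F m + ?G m) - log 2 (?G m)) \<le> 2 * ?F m"
      using tot[OF n(2,1)] by (simp add: add.commute)
  qed
  finally show ?thesis by (simp add: sum.distrib sum_distrib_left distrib_left add.commute)
qed

lemma hmass_le:
  assumes fin: "finite T" "T \<noteq> {}" and g: "\<And>s m. 0 \<le> g s m"
  shows "hmass T M g \<le> (\<Sum>m\<in>M. \<Sum>s\<in>T. g s m) * log 2 (card T)"
proof -
  have c: "0 < real (card T)" using fin by (simp add: card_gt_0_iff)
  have "(\<Sum>s\<in>T. g s m * (log 2 (\<Sum>s\<in>T. g s m) - log 2 (g s m))) \<le> (\<Sum>s\<in>T. g s m) * log 2 (card T)" for m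
  proof -
    let ?G = "\<Sum>s\<in>T. g s m"
    have "g s m * (log 2 ?G - log 2 (g s m)) \<le> g s m * log 2 (card T) + (?G / card T - g s m) / ln 2" if s: "s \<in> T" for s
    proof (cases "g s m = 0")
      case True
      then show ?thesis using g by (simp add: sum_nonneg)
    next
      case False
      then have gp: "0 < g s m" using g[of s m] by simp
      have "g s m \<le> ?G" using g fin s by (intro member_le_sum) auto
      then have G: "0 < ?G" using gp by simp
      have "log 2 (?G / g s m) \<le> log 2 (card T) + ((?G / g s m) / card T - 1) / ln 2"
        using gp G c by (intro log2_le_tangent) auto
      then have "g s m * (log 2 ?G - log 2 (g s m)) \<le> g s m * (log 2 (card T) + ((?G / g s m) / card T - 1) / ln 2)"
        using gp G by (intro mult_left_mono) (auto simp: log_divide)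
      also have "\<dots> = g s m * log 2 (card T) + (?G / card T - g s m) / ln 2"
        using gp c by (simp add: distrib_left) (simp add: field_simps)
      finally show ?thesis .
    qed
    then have "(\<Sum>s\<in>T. g s m * (log 2 ?G - log 2 (g s m))) \<le> (\<Sum>s\<in>T. g s m * log 2 (card T) + (?G / card T - g s m) / ln 2)"
      by (intro sum_mono) auto
    also have "\<dots> = ?G * log 2 (card T)"
      using c by (simp add: sum.distrib sum_distrib_right sum_subtractf flip: sum_divide_distrib)
    finally show ?thesis .
  qed
  then show ?thesis unfolding hmass_def sum_distrib_right[of _ M] by (intro sum_mono) auto
qed

lemma cond_ent_eq_hmass:
  assumes fin: "finite T" "finite M" and sub: "set_pmf p \<subseteq> T \<times> M"
  shows "Hp p - Hp (map_pmf snd p) = hmass T M (\<lambda>s m. pmf p (s, m))"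
proof -
  have finp: "finite (set_pmf p)" using finite_subset[OF sub] fin by simp
  have marg: "pmf (map_pmf snd p) m = (\<Sum>s\<in>T. pmf p (s, m))" if "m \<in> M" for m
  proof -
    have "pmf (map_pmf snd p) m = (\<Sum>a\<in>T \<times> M. pmf p a * (if snd a = m then 1 else 0))"
      unfolding pmf_map_ex[OF finp] by (rule ex_eq_sum) (use fin sub in auto)
    also have "\<dots> = (\<Sum>s\<in>T. \<Sum>m'\<in>M. if m' = m then pmf p (s, m') else 0)"
      unfolding sum.cartesian_product by (intro sum.cong) auto
    finally show ?thesis using fin that by simp
  qed
  have "Hp p - Hp (map_pmf snd p) = ex p (\<lambda>a. log 2 (pmf (map_pmf snd p) (snd a)) - log 2 (pmf p a))"
    unfolding ent_ex[OF finp] unfolding Hp_def by (simp add: ex_diff ex_minus)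
  also have "\<dots> = (\<Sum>m\<in>M. \<Sum>s\<in>T. pmf p (s, m) * (log 2 (pmf (map_pmf snd p) m) - log 2 (pmf p (s, m))))"
    using fin sub by (subst ex_eq_sum[of "T \<times> M"]) (auto simp: sum.cartesian_product' intro: sum.swap)
  also have "\<dots> = hmass T M (\<lambda>s m. pmf p (s, m))"
    unfolding hmass_def by (intro sum.cong refl) (simp add: marg)
  finally show ?thesis .
qed

text \<open>Split both laws at their pointwise minimum. The remainder of \<open>q\<close> has mass
  at most \<open>l1_dist p q\<close>, and the constant 2 is the cost of the split. The loss does not
  involve \<open>card M\<close>, which matters because M will be the set of messages.\<close>

lemma cond_ent_continuous:
  assumes fin: "finite T" "T \<noteq> {}" "finite M" and sub: "set_pmf p \<subseteq> T \<times> M" "set_pmf q \<subseteq> T \<times> M"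
  shows "Hp q - Hp (map_pmf snd q) - 2 - l1_dist p q * log 2 (card T) \<le> Hp p - Hp (map_pmf snd p)"
proof -
  let ?p = "\<lambda>s m. pmf p (s, m)" and ?q = "\<lambda>s m. pmf q (s, m)"
  let ?r = "\<lambda>s m. min (?p s m) (?q s m)"
  let ?p' = "\<lambda>s m. ?p s m - ?r s m" and ?q' = "\<lambda>s m. ?q s m - ?r s m"
  have "hmass T M ?r + hmass T M ?p' \<le> hmass T M ?p"
    using hmass_superadd[OF fin(1), of ?r ?p' M] by simp
  moreover have "0 \<le> hmass T M ?p'" using fin by (intro hmass_nonneg) auto
  moreover have "hmass T M ?q \<le> hmass T M ?r + hmass T M ?q' + 2 * (\<Sum>m\<in>M. \<Sum>s\<in>T. ?q s m)"
    using hmass_subadd[OF fin(1), of ?r ?q' M] by simp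
  moreover have "(\<Sum>m\<in>M. \<Sum>s\<in>T. ?q s m) = 1"
  proof -
    have "(\<Sum>m\<in>M. \<Sum>s\<in>T. ?q s m) = (\<Sum>a\<in>T \<times> M. pmf q a)"
      by (subst sum.swap) (simp add: sum.cartesian_product')
    then show ?thesis using fin sub by (simp add: sum_pmf_eq_1)
  qed
  moreover have "hmass T M ?q' \<le> (\<Sum>m\<in>M. \<Sum>s\<in>T. ?q' s m) * log 2 (card T)"
    using fin by (intro hmass_le) auto
  moreover have "(\<Sum>m\<in>M. \<Sum>s\<in>T. ?q' s m) * log 2 (card T) \<le> l1_dist p q * log 2 (card T)"
  proof (rule mult_right_mono)
    have "(\<Sum>m\<in>M. \<Sum>s\<in>T. ?q' s m) \<le> (\<Sum>m\<in>M. \<Sum>s\<in>T. \<bar>?p s m - ?q s m\<bar>)"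
      by (intro sum_mono) auto
    also have "\<dots> = (\<Sum>a\<in>T \<times> M. \<bar>pmf p a - pmf q a\<bar>)"
      by (subst sum.swap) (simp add: sum.cartesian_product')
    also have "\<dots> = l1_dist p q" using fin sub by (intro l1_dist_eq_sum[symmetric]) auto
    finally show "(\<Sum>m\<in>M. \<Sum>s\<in>T. ?q' s m) \<le> l1_dist p q" .
    have "1 \<le> card T" using fin by (simp add: Suc_le_eq card_gt_0_iff)
    then show "0 \<le> log 2 (card T)" by simp
  qed
  ultimately show ?thesis
    unfolding cond_ent_eq_hmass[OF fin(1,3) sub(1)] cond_ent_eq_hmass[OF fin(1,3) sub(2)] by linarith
qed

subsection \<open>Random superposition codebooks\<close>

lemma Pi_pmf_pair:
  assumes "finite A" "x \<in> A" "y \<in> A" "x \<noteq> y"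
  shows "map_pmf (\<lambda>f. (f x, f y)) (Pi_pmf A d p) = pair_pmf (p x) (p y)"
proof -
  have A: "A = insert x (A - {x})" using assms by auto
  have "map_pmf (\<lambda>f. (f x, f y)) (Pi_pmf A d p)
     = map_pmf (\<lambda>f. (f x, f y)) (map_pmf (\<lambda>(y, f). f(x := y)) (pair_pmf (p x) (Pi_pmf (A - {x}) d p)))"
    by (subst A, subst Pi_pmf_insert) (use assms in auto)
  also have "\<dots> = map_pmf (\<lambda>(a, f). (a, f y)) (pair_pmf (p x) (Pi_pmf (A - {x}) d p))"
    using assms by (simp add: pmf.map_comp o_def case_prod_unfold)
  also have "\<dots> = pair_pmf (p x) (map_pmf (\<lambda>f. f y) (Pi_pmf (A - {x}) d p))"
    by (simp add: pair_map_pmf2 case_prod_unfold apsnd_def map_prod_def)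
  also have "map_pmf (\<lambda>f. f y) (Pi_pmf (A - {x}) d p) = p y"
    using assms by (simp add: Pi_pmf_component)
  finally show ?thesis .
qed

lemma finite_Pi_pmf:
  assumes "finite A" "\<And>x. finite (set_pmf (p x))"
  shows "finite (set_pmf (Pi_pmf A d p))"
  using assms by (intro finite_subset[OF set_Pi_pmf_subset'[OF assms(1)]] finite_PiE_dflt) auto

text \<open>Every key in \<open>K\<close> has its own codebook of N2 clouds with N1 satellites each;
  \<open>f\<close> sends a satellite to its cloud centre.\<close>

locale superposition =
  fixes P2 :: "'u pmf" and P1 :: "'u \<Rightarrow> 'v pmf" and f :: "'v \<Rightarrow> 'u"
    and K :: "nat set" and N2 N1 :: nat
  assumes fin2 [simp]: "finite (set_pmf P2)" and fin1 [simp]: "\<And>u. finite (set_pmf (P1 u))"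
    and sep: "\<And>u v. u \<in> set_pmf P2 \<Longrightarrow> v \<in> set_pmf (P1 u) \<Longrightarrow> f v = u"
    and K: "finite K" "K \<noteq> {}" and N2: "0 < N2" and N1: "0 < N1"
begin

definition "P = bind_pmf P2 P1"
definition "\<Omega> = {..<N2} \<times> {..<N1}"

text \<open>Only the satellites are kept; on the support the centre of cloud (k, i) is recovered as
  \<open>f (c (k, i, j))\<close> for any j.\<close>

definition codebook :: "(nat \<times> nat \<times> nat \<Rightarrow> 'v) pmf" where
  "codebook = bind_pmf (Pi_pmf (K \<times> {..<N2}) undefined (\<lambda>_. P2))
     (\<lambda>g. Pi_pmf (K \<times> \<Omega>) undefined (\<lambda>(k, i, j). P1 (g (k, i))))"

lemma finP [simp]: "finite (set_pmf P)" by (simp add: P_def)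

lemma fin\<Omega> [simp]: "finite \<Omega>" "finite (K \<times> \<Omega>)" "finite (K \<times> {..<N2})" using K by (auto simp: \<Omega>_def)

lemma \<Omega>_ne [simp]: "\<Omega> \<noteq> {}" using N1 N2 by (auto simp: \<Omega>_def)

lemma finite_codebook [simp]: "finite (set_pmf codebook)"
  unfolding codebook_def by (auto intro!: finite_Pi_pmf)

lemma codeword_law:
  assumes "k \<in> K" "\<omega> \<in> \<Omega>" shows "map_pmf (\<lambda>c. c (k, \<omega>)) codebook = P"
proof -
  obtain i j where o: "\<omega> = (i, j)" "i < N2" "j < N1" using assms by (auto simp: \<Omega>_def)
  have "map_pmf (\<lambda>c. c (k, \<omega>)) codebook
     = bind_pmf (Pi_pmf (K \<times> {..<N2}) undefined (\<lambda>_. P2)) (\<lambda>g. P1 (g (k, i)))"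
    unfolding codebook_def map_bind_pmf using assms o
    by (intro bind_pmf_cong refl) (auto simp: Pi_pmf_component)
  also have "\<dots> = bind_pmf (map_pmf (\<lambda>g. g (k, i)) (Pi_pmf (K \<times> {..<N2}) undefined (\<lambda>_. P2))) P1"
    by (simp add: bind_map_pmf)
  also have "\<dots> = P" using assms o by (simp add: Pi_pmf_component P_def)
  finally show ?thesis .
qed

text \<open>Laws of pairs suffice later, because the expected likelihood of a mixture is a sum over
  pairs of codewords. Within a cloud the codewords are independent given the centre.\<close>

lemma codeword_pair_law_same:
  assumes "k \<in> K" "i < N2" "j < N1" "j' < N1" "j \<noteq> j'"
  shows "map_pmf (\<lambda>c. (c (k, i, j), c (k, i, j'))) codebook = bind_pmf P2 (\<lambda>u. pair_pmf (P1 u) (P1 u))"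
proof -
  have "map_pmf (\<lambda>c. (c (k, i, j), c (k, i, j'))) codebook
     = bind_pmf (Pi_pmf (K \<times> {..<N2}) undefined (\<lambda>_. P2)) (\<lambda>g. pair_pmf (P1 (g (k, i))) (P1 (g (k, i))))"
    unfolding codebook_def map_bind_pmf using assms
    by (intro bind_pmf_cong refl) (subst Pi_pmf_pair, auto simp: \<Omega>_def K)
  also have "\<dots> = bind_pmf (map_pmf (\<lambda>g. g (k, i)) (Pi_pmf (K \<times> {..<N2}) undefined (\<lambda>_. P2))) (\<lambda>u. pair_pmf (P1 u) (P1 u))"
    by (simp add: bind_map_pmf)
  finally show ?thesis using assms by (simp add: Pi_pmf_component)
qed

lemma codeword_pair_law_diff:
  assumes "k \<in> K" "i < N2" "j < N1" "k' \<in> K" "i' < N2" "j' < N1" "(k, i) \<noteq> (k', i')"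
  shows "map_pmf (\<lambda>c. (c (k, i, j), c (k', i', j'))) codebook = pair_pmf P P"
proof -
  have "map_pmf (\<lambda>c. (c (k, i, j), c (k', i', j'))) codebook
     = bind_pmf (Pi_pmf (K \<times> {..<N2}) undefined (\<lambda>_. P2)) (\<lambda>g. pair_pmf (P1 (g (k, i))) (P1 (g (k', i'))))"
    unfolding codebook_def map_bind_pmf using assms
    by (intro bind_pmf_cong refl) (subst Pi_pmf_pair, auto simp: \<Omega>_def K)
  also have "\<dots> = bind_pmf (map_pmf (\<lambda>g. (g (k, i), g (k', i'))) (Pi_pmf (K \<times> {..<N2}) undefined (\<lambda>_. P2))) (\<lambda>(u, u'). pair_pmf (P1 u) (P1 u'))"
    by (simp add: bind_map_pmf)
  also have "map_pmf (\<lambda>g. (g (k, i), g (k', i'))) (Pi_pmf (K \<times> {..<N2}) undefined (\<lambda>_. P2)) = pair_pmf P2 P2"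
    by (rule Pi_pmf_pair) (use assms in auto)
  also have "bind_pmf (pair_pmf P2 P2) (\<lambda>(u, u'). pair_pmf (P1 u) (P1 u')) = pair_pmf P P"
    unfolding P_def pair_pmf_def
    by (simp add: bind_assoc_pmf bind_return_pmf) (subst bind_commute_pmf[of "P1 _"], simp)
  finally show ?thesis .
qed

text \<open>This is what lets node 3 produce its output from the cloud index and the key
  alone.\<close>

lemma codeword_sep:
  assumes "c \<in> set_pmf codebook" "k \<in> K" "i < N2" "j < N1" "j' < N1"
  shows "f (c (k, i, j)) = f (c (k, i, j'))"
proof -
  obtain g where g: "g \<in> set_pmf (Pi_pmf (K \<times> {..<N2}) undefined (\<lambda>_. P2))"
    and c: "c \<in> set_pmf (Pi_pmf (K \<times> \<Omega>) undefined (\<lambda>(k, i, j). P1 (g (k, i))))"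
    using assms(1) unfolding codebook_def by auto
  have gu: "g (k, i) \<in> set_pmf P2"
    using g set_Pi_pmf_subset'[of "K \<times> {..<N2}" undefined "\<lambda>_. P2"] assms by (fastforce simp: PiE_dflt_def)
  have cp: "c \<in> PiE_dflt (K \<times> \<Omega>) undefined (set_pmf \<circ> (\<lambda>(k, i, j). P1 (g (k, i))))"
    by (rule subsetD[OF set_Pi_pmf_subset' c]) simp
  have "c (k, i, j) \<in> set_pmf (P1 (g (k, i)))" if "j < N1" for j
    using cp assms that unfolding PiE_dflt_def by (auto simp: \<Omega>_def)
  then show ?thesis using sep[OF gu] assms by metis
qed

lemma codeword_supp:
  assumes "c \<in> set_pmf codebook" "k \<in> K" "\<omega> \<in> \<Omega>" shows "c (k, \<omega>) \<in> set_pmf P"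
  using codeword_law[OF assms(2,3)] assms(1) by (metis imageI set_map_pmf)

end

text \<open>The output of a random codebook is as random as if all other codewords were replaced by their
  conditional mean \<open>\<mu>\<close> given the transmitted one.\<close>

lemma mixture_log_bound:
  fixes W :: "'v \<Rightarrow> 'x pmf" and c :: "'c \<Rightarrow> 'w \<Rightarrow> 'v"
  assumes fin: "finite (set_pmf C)" "\<And>v. finite (set_pmf (W v))" "finite \<Omega>" "\<Omega> \<noteq> {}"
    and law: "\<And>\<omega>. \<omega> \<in> \<Omega> \<Longrightarrow> map_pmf (\<lambda>b. c b \<omega>) C = P"
    and pos: "\<And>v x. v \<in> set_pmf P \<Longrightarrow> x \<in> set_pmf (W v) \<Longrightarrow> 0 < \<mu> x v"
    and mean: "\<And>\<omega>. \<omega> \<in> \<Omega> \<Longrightarrow> (\<Sum>\<omega>'\<in>\<Omega>. ex C (\<lambda>b. ex (W (c b \<omega>)) (\<lambda>x. pmf (W (c b \<omega>')) x / \<mu> x (c b \<omega>)))) \<le> card \<Omega>"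
  defines "mix \<equiv> \<lambda>b. bind_pmf (pmf_of_set \<Omega>) (\<lambda>\<omega>. W (c b \<omega>))"
  shows "ex C (\<lambda>b. ex (mix b) (\<lambda>x. log 2 (pmf (mix b) x))) \<le> ex P (\<lambda>v. ex (W v) (\<lambda>x. log 2 (\<mu> x v)))"
proof -
  let ?U = "pmf_of_set \<Omega>"
  have card: "0 < real (card \<Omega>)" using fin by (simp add: card_gt_0_iff)
  have pm: "pmf (mix b) x = (\<Sum>\<omega>'\<in>\<Omega>. pmf (W (c b \<omega>')) x) / card \<Omega>" for b x
    unfolding mix_def using fin by (simp add: pmf_bind_ex ex_pmf_of_set)
  have exm: "ex (mix b) F = ex ?U (\<lambda>\<omega>. ex (W (c b \<omega>)) F)" for b F
    unfolding mix_def using fin by (intro ex_bind) auto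
  have cs: "c b \<omega> \<in> set_pmf P" if "b \<in> set_pmf C" "\<omega> \<in> \<Omega>" for b \<omega>
    using law[OF that(2)] that(1) by (metis imageI set_map_pmf)
  \<comment> \<open>The tangent is taken at \<mu> instead of at the realised mixture; the hypothesis
    \<open>mean\<close> says that its error term has nonpositive expectation.\<close>
  have "ex C (\<lambda>b. ex (mix b) (\<lambda>x. log 2 (pmf (mix b) x)))
     \<le> ex C (\<lambda>b. ex ?U (\<lambda>\<omega>. ex (W (c b \<omega>)) (\<lambda>x. log 2 (\<mu> x (c b \<omega>)) + (pmf (mix b) x / \<mu> x (c b \<omega>) - 1) / ln 2)))"
    unfolding exm
  proof (intro ex_mono)
    fix b \<omega> x assume b: "b \<in> set_pmf C" and "\<omega> \<in> set_pmf ?U" and x: "x \<in> set_pmf (W (c b \<omega>))"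
    then have o: "\<omega> \<in> \<Omega>" using fin by simp
    have "x \<in> set_pmf (mix b)" using o x fin by (auto simp: mix_def)
    then show "log 2 (pmf (mix b) x) \<le> log 2 (\<mu> x (c b \<omega>)) + (pmf (mix b) x / \<mu> x (c b \<omega>) - 1) / ln 2"
      using pos[OF cs[OF b o] x] by (intro log2_le_tangent) (auto simp: pmf_positive)
  qed
  also have "\<dots> = ex ?U (\<lambda>\<omega>. ex C (\<lambda>b. ex (W (c b \<omega>)) (\<lambda>x. log 2 (\<mu> x (c b \<omega>)))))
     + (ex ?U (\<lambda>\<omega>. ex C (\<lambda>b. ex (W (c b \<omega>)) (\<lambda>x. pmf (mix b) x / \<mu> x (c b \<omega>)))) - 1) / ln 2"
    using fin by (simp add: ex_add ex_divide ex_diff ex_const ex_swap[of C])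
  also have "ex ?U (\<lambda>\<omega>. ex C (\<lambda>b. ex (W (c b \<omega>)) (\<lambda>x. log 2 (\<mu> x (c b \<omega>)))))
     = ex ?U (\<lambda>\<omega>. ex P (\<lambda>v. ex (W v) (\<lambda>x. log 2 (\<mu> x v))))"
    using fin by (intro ex_cong refl) (simp add: law[symmetric] ex_map)
  also have "\<dots> = ex P (\<lambda>v. ex (W v) (\<lambda>x. log 2 (\<mu> x v)))" using fin by (simp add: ex_const)
  also have "ex ?U (\<lambda>\<omega>. ex C (\<lambda>b. ex (W (c b \<omega>)) (\<lambda>x. pmf (mix b) x / \<mu> x (c b \<omega>)))) \<le> ex ?U (\<lambda>\<omega>. 1)"
  proof (rule ex_mono)
    fix \<omega> assume "\<omega> \<in> set_pmf ?U"
    then have o: "\<omega> \<in> \<Omega>" using fin by simp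
    have "ex C (\<lambda>b. ex (W (c b \<omega>)) (\<lambda>x. pmf (mix b) x / \<mu> x (c b \<omega>)))
       = (\<Sum>\<omega>'\<in>\<Omega>. ex C (\<lambda>b. ex (W (c b \<omega>)) (\<lambda>x. pmf (W (c b \<omega>')) x / \<mu> x (c b \<omega>)))) / card \<Omega>"
      unfolding pm by (simp add: ex_sum[symmetric] ex_divide[symmetric] sum_divide_distrib mult.commute)
    also have "\<dots> \<le> 1" using mean[OF o] card by (simp add: divide_le_eq)
    finally show "ex C (\<lambda>b. ex (W (c b \<omega>)) (\<lambda>x. pmf (mix b) x / \<mu> x (c b \<omega>))) \<le> 1" .
  qed
  finally show ?thesis using fin by (simp add: ex_const divide_right_mono)
qed

context superposition
begin

text \<open>The mean output given that \<open>v\<close> is sent: among the \<open>N2 * N1\<close> codewords one is \<open>v\<close>, \<open>N1 - 1\<close> are drawn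
  from the same cloud centre \<open>f v\<close>, and the others are independent of \<open>v\<close>.\<close>

definition mean_X :: "('v \<Rightarrow> 'x pmf) \<Rightarrow> 'x \<Rightarrow> 'v \<Rightarrow> real" where
  "mean_X W x v = (pmf (W v) x + (real N1 - 1) * pmf (bind_pmf (P1 (f v)) W) x
      + (real N2 - 1) * real N1 * pmf (bind_pmf P W) x) / (real N2 * real N1)"

text \<open>The adversary knows the index but not the key, so the relevant mixture runs over the
  codewords with one index and all keys; codewords of different keys are independent.\<close>

definition mean_S :: "('v \<Rightarrow> 's pmf) \<Rightarrow> 's \<Rightarrow> 'v \<Rightarrow> real" where
  "mean_S W x v = (pmf (W v) x + (real (card K) - 1) * pmf (bind_pmf P W) x) / real (card K)"

lemma card\<Omega>: "real (card \<Omega>) = real N2 * real N1"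
  by (simp add: \<Omega>_def)

lemma card_K: "1 \<le> card K"
  using K by (simp add: Suc_le_eq card_gt_0_iff)

lemma ex_P: "ex P g = ex P2 (\<lambda>u. ex (P1 u) g)"
  unfolding P_def by (rule ex_bind) auto

lemma mean_X_pos:
  assumes "x \<in> set_pmf (W v)" shows "0 < mean_X W x v"
proof -
  have "0 < pmf (W v) x" using assms by (rule pmf_positive)
  moreover have "0 \<le> (real N1 - 1) * pmf (bind_pmf (P1 (f v)) W) x" using N1 by simp
  moreover have "0 \<le> (real N2 - 1) * real N1 * pmf (bind_pmf P W) x" using N2 by simp
  ultimately have "0 < pmf (W v) x + (real N1 - 1) * pmf (bind_pmf (P1 (f v)) W) x
      + (real N2 - 1) * real N1 * pmf (bind_pmf P W) x" by linarith
  then show ?thesis using N1 N2 unfolding mean_X_def by (intro divide_pos_pos) simp_all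
qed

lemma mean_S_pos:
  assumes "x \<in> set_pmf (W v)" shows "0 < mean_S W x v"
proof -
  have "0 < pmf (W v) x" using assms by (rule pmf_positive)
  moreover have "0 \<le> (real (card K) - 1) * pmf (bind_pmf P W) x" using card_K by simp
  ultimately have "0 < pmf (W v) x + (real (card K) - 1) * pmf (bind_pmf P W) x" by linarith
  then show ?thesis using card_K unfolding mean_S_def by (intro divide_pos_pos) simp_all
qed

lemma ex_codeword:
  assumes "k \<in> K" "\<omega> \<in> \<Omega>"
  shows "ex codebook (\<lambda>b. g (b (k, \<omega>))) = ex P g"
  using codeword_law[OF assms] by (simp flip: ex_map[OF finite_codebook, of "\<lambda>b. b (k, \<omega>)" g])

lemma ex_pair_codebook: "ex codebook (\<lambda>b. g (b x) (b y)) = ex (map_pmf (\<lambda>b. (b x, b y)) codebook) (\<lambda>(v, v'). g v v')"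
  by (simp add: ex_map)

text \<open>The numbers of pairs of each kind are exactly the coefficients in \<open>mean_X\<close>,
  so the ratios average to 1 and the bound is in fact attained.\<close>

lemma mean_X_condition:
  fixes W :: "'v \<Rightarrow> 'x pmf"
  assumes W: "\<And>v. finite (set_pmf (W v))" and k: "k \<in> K" and o: "\<omega> \<in> \<Omega>"
  shows "(\<Sum>\<omega>'\<in>\<Omega>. ex codebook (\<lambda>b. ex (W (b (k, \<omega>))) (\<lambda>x. pmf (W (b (k, \<omega>'))) x / mean_X W x (b (k, \<omega>))))) \<le> card \<Omega>"
proof -
  obtain i j where ij: "\<omega> = (i, j)" "i < N2" "j < N1" using o by (auto simp: \<Omega>_def)
  let ?\<phi> = "\<lambda>v v'. ex (W v) (\<lambda>x. pmf (W v') x / mean_X W x v)"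
  define t0 where "t0 = ex P (\<lambda>v. ex (W v) (\<lambda>x. pmf (W v) x / mean_X W x v))"
  define t1 where "t1 = ex P (\<lambda>v. ex (W v) (\<lambda>x. pmf (bind_pmf (P1 (f v)) W) x / mean_X W x v))"
  define t2 where "t2 = ex P (\<lambda>v. ex (W v) (\<lambda>x. pmf (bind_pmf P W) x / mean_X W x v))"
  \<comment> \<open>\<open>t2\<close> belongs to different clouds, \<open>t1\<close> to different
    codewords of one cloud, \<open>t0\<close> to a repeated codeword. Written as nested corrections,
    both sums collapse.\<close>
  have T: "ex codebook (\<lambda>b. ?\<phi> (b (k, \<omega>)) (b (k, i', j'))) = t2 + (if i' = i then (t1 - t2) + (if j' = j then t0 - t1 else 0) else 0)"
    if i': "i' < N2" and j': "j' < N1" for i' j'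
  proof -
    consider "i' = i" "j' = j" | "i' = i" "j' \<noteq> j" | "i' \<noteq> i" by auto
    then show ?thesis
    proof cases
      case 1
      then show ?thesis using ex_codeword[OF k o, of "\<lambda>v. ?\<phi> v v"] by (simp add: ij t0_def)
    next
      case 2
      have "ex codebook (\<lambda>b. ?\<phi> (b (k, \<omega>)) (b (k, i', j'))) = ex P2 (\<lambda>u. ex (P1 u) (\<lambda>v. ex (P1 u) (\<lambda>v'. ?\<phi> v v')))"
        unfolding ex_pair_codebook[where g="?\<phi>"] using 2 ij codeword_pair_law_same[OF k, of i j j'] i' j'
        by (simp add: ex_bind ex_pair set_pair_pmf)
      also have "\<dots> = ex P2 (\<lambda>u. ex (P1 u) (\<lambda>v. ex (W v) (\<lambda>x. pmf (bind_pmf (P1 (f v)) W) x / mean_X W x v)))"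
        by (intro ex_cong refl) (simp add: sep ex_swap[of "P1 _"] ex_divide pmf_bind_ex)
      finally show ?thesis using 2 by (simp add: t1_def ex_P)
    next
      case 3
      have "ex codebook (\<lambda>b. ?\<phi> (b (k, \<omega>)) (b (k, i', j'))) = ex P (\<lambda>v. ex P (\<lambda>v'. ?\<phi> v v'))"
        unfolding ex_pair_codebook[where g="?\<phi>"] using 3 ij codeword_pair_law_diff[OF k, of i j k i' j'] i' j' k
        by (simp add: ex_pair)
      also have "\<dots> = t2"
        unfolding t2_def by (intro ex_cong refl) (simp add: ex_swap[of P] ex_divide pmf_bind_ex)
      finally show ?thesis using 3 by simp
    qed
  qed
  have "(\<Sum>\<omega>'\<in>\<Omega>. ex codebook (\<lambda>b. ?\<phi> (b (k, \<omega>)) (b (k, \<omega>'))))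
    = (\<Sum>i'<N2. \<Sum>j'<N1. t2 + (if i' = i then (t1 - t2) + (if j' = j then t0 - t1 else 0) else 0))"
    unfolding \<Omega>_def sum.cartesian_product' by (intro sum.cong refl) (use T in \<open>auto simp: ij\<close>)
  also have "\<dots> = (\<Sum>i'<N2. N1 * t2 + (if i' = i then N1 * (t1 - t2) + (t0 - t1) else 0))"
    using ij by (intro sum.cong refl) (simp add: sum.distrib)
  also have "\<dots> = t0 + (real N1 - 1) * t1 + (real N2 - 1) * N1 * t2"
    using ij by (simp add: sum.distrib algebra_simps)
  also have "\<dots> = ex P (\<lambda>v. ex (W v) (\<lambda>x. (pmf (W v) x + (real N1 - 1) * pmf (bind_pmf (P1 (f v)) W) x
      + (real N2 - 1) * real N1 * pmf (bind_pmf P W) x) / mean_X W x v))"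
    unfolding t0_def t1_def t2_def add_divide_distrib times_divide_eq_right[symmetric] ex_add ex_cmult ..
  also have "\<dots> = ex P (\<lambda>v. ex (W v) (\<lambda>x. real N2 * real N1))"
  proof (intro ex_cong refl)
    fix v x assume "x \<in> set_pmf (W v)"
    then have "mean_X W x v \<noteq> 0" using mean_X_pos by fastforce
    then show "(pmf (W v) x + (real N1 - 1) * pmf (bind_pmf (P1 (f v)) W) x
      + (real N2 - 1) * real N1 * pmf (bind_pmf P W) x) / mean_X W x v = real N2 * real N1"
      using N1 N2 unfolding mean_X_def by (auto simp: field_simps)
  qed
  also have "\<dots> = card \<Omega>" using W by (simp add: ex_const card\<Omega>)
  finally show ?thesis by simp
qed

text \<open>The same count over keys, with only two kinds of pairs.\<close>

lemma mean_S_condition: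
  fixes W :: "'v \<Rightarrow> 's pmf"
  assumes W: "\<And>v. finite (set_pmf (W v))" and k: "k \<in> K" and o: "\<omega> \<in> \<Omega>"
  shows "(\<Sum>k'\<in>K. ex codebook (\<lambda>b. ex (W (b (k, \<omega>))) (\<lambda>x. pmf (W (b (k', \<omega>))) x / mean_S W x (b (k, \<omega>))))) \<le> card K"
proof -
  obtain i j where ij: "\<omega> = (i, j)" "i < N2" "j < N1" using o by (auto simp: \<Omega>_def)
  let ?\<phi> = "\<lambda>v v'. ex (W v) (\<lambda>x. pmf (W v') x / mean_S W x v)"
  define t0 where "t0 = ex P (\<lambda>v. ex (W v) (\<lambda>x. pmf (W v) x / mean_S W x v))"
  define t2 where "t2 = ex P (\<lambda>v. ex (W v) (\<lambda>x. pmf (bind_pmf P W) x / mean_S W x v))"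
  have T: "ex codebook (\<lambda>b. ?\<phi> (b (k, \<omega>)) (b (k', \<omega>))) = t2 + (if k' = k then t0 - t2 else 0)" if k': "k' \<in> K" for k'
  proof (cases "k' = k")
    case True
    then show ?thesis using ex_codeword[OF k o, of "\<lambda>v. ?\<phi> v v"] by (simp add: t0_def)
  next
    case False
    have "ex codebook (\<lambda>b. ?\<phi> (b (k, \<omega>)) (b (k', \<omega>))) = ex P (\<lambda>v. ex P (\<lambda>v'. ?\<phi> v v'))"
      unfolding ex_pair_codebook[where g="?\<phi>"] using False ij codeword_pair_law_diff[OF k, of i j k' i j] k'
      by (simp add: ex_pair)
    also have "\<dots> = t2"
      unfolding t2_def by (intro ex_cong refl) (simp add: ex_swap[of P] ex_divide pmf_bind_ex)
    finally show ?thesis using False by simp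
  qed
  have "(\<Sum>k'\<in>K. ex codebook (\<lambda>b. ?\<phi> (b (k, \<omega>)) (b (k', \<omega>)))) = (\<Sum>k'\<in>K. t2 + (if k' = k then t0 - t2 else 0))"
    by (intro sum.cong refl) (use T in auto)
  also have "\<dots> = t0 + (real (card K) - 1) * t2"
    using K k by (simp add: sum.distrib algebra_simps)
  also have "\<dots> = ex P (\<lambda>v. ex (W v) (\<lambda>x. (pmf (W v) x + (real (card K) - 1) * pmf (bind_pmf P W) x) / mean_S W x v))"
    unfolding t0_def t2_def add_divide_distrib times_divide_eq_right[symmetric] ex_add ex_cmult ..
  also have "\<dots> = ex P (\<lambda>v. ex (W v) (\<lambda>x. real (card K)))"
  proof (intro ex_cong refl)
    fix v x assume "x \<in> set_pmf (W v)"
    then have "mean_S W x v \<noteq> 0" using mean_S_pos by fastforce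
    then show "(pmf (W v) x + (real (card K) - 1) * pmf (bind_pmf P W) x) / mean_S W x v = real (card K)"
      using card_K unfolding mean_S_def by (auto simp: field_simps)
  qed
  also have "\<dots> = card K" using W by (simp add: ex_const)
  finally show ?thesis by simp
qed

definition out_X :: "('v \<Rightarrow> 'x pmf) \<Rightarrow> (nat \<times> nat \<times> nat \<Rightarrow> 'v) \<Rightarrow> nat \<Rightarrow> 'x pmf" where
  "out_X W b k = bind_pmf (pmf_of_set \<Omega>) (\<lambda>\<omega>. W (b (k, \<omega>)))"

definition out_S :: "('v \<Rightarrow> 's pmf) \<Rightarrow> (nat \<times> nat \<times> nat \<Rightarrow> 'v) \<Rightarrow> nat \<times> nat \<Rightarrow> 's pmf" where
  "out_S W b \<omega> = bind_pmf (pmf_of_set K) (\<lambda>k. W (b (k, \<omega>)))"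

lemma ex_out_X:
  assumes W: "\<And>v. finite (set_pmf (W v))" and k: "k \<in> K"
  shows "ex codebook (\<lambda>b. ex (out_X W b k) g) = ex (bind_pmf P W) g"
proof -
  have "ex codebook (\<lambda>b. ex (out_X W b k) g) = ex (pmf_of_set \<Omega>) (\<lambda>\<omega>. ex codebook (\<lambda>b. ex (W (b (k, \<omega>))) g))"
    unfolding out_X_def using W by (simp add: ex_bind ex_swap[of codebook])
  also have "\<dots> = ex (pmf_of_set \<Omega>) (\<lambda>\<omega>. ex P (\<lambda>v. ex (W v) g))"
    by (intro ex_cong refl ex_codeword k) simp
  finally show ?thesis using W by (simp add: ex_const ex_bind)
qed

text \<open>Averaged over codebooks the output law is the true one, so the reference term of the
  divergence is exact and only the log-likelihood of the output needs
  \<open>mixture_log_bound\<close>.\<close>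

lemma resolvability:
  assumes W: "\<And>v. finite (set_pmf (W v))" and k: "k \<in> K"
  shows "ex codebook (\<lambda>b. rel_ent (out_X W b k) (bind_pmf P W))
     \<le> ex P (\<lambda>v. ex (W v) (\<lambda>x. log 2 (mean_X W x v) - log 2 (pmf (bind_pmf P W) x)))"
proof -
  have "ex codebook (\<lambda>b. ex (out_X W b k) (\<lambda>x. log 2 (pmf (out_X W b k) x))) \<le> ex P (\<lambda>v. ex (W v) (\<lambda>x. log 2 (mean_X W x v)))"
    unfolding out_X_def
    by (rule mixture_log_bound[where c="\<lambda>b \<omega>. b (k, \<omega>)"])
      (use W k mean_X_condition[where W=W, OF W k] in \<open>auto simp: codeword_law mean_X_pos\<close>)
  then show ?thesis
    unfolding rel_ent_def ex_diff using W by (simp add: ex_out_X[OF W k] ex_bind)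
qed

lemma secrecy:
  assumes W: "\<And>v. finite (set_pmf (W v))" and o: "\<omega> \<in> \<Omega>"
  shows "- ex P (\<lambda>v. ex (W v) (\<lambda>x. log 2 (mean_S W x v))) \<le> ex codebook (\<lambda>b. Hp (out_S W b \<omega>))"
proof -
  have "ex codebook (\<lambda>b. ex (out_S W b \<omega>) (\<lambda>x. log 2 (pmf (out_S W b \<omega>) x))) \<le> ex P (\<lambda>v. ex (W v) (\<lambda>x. log 2 (mean_S W x v)))"
    unfolding out_S_def
    by (rule mixture_log_bound[where c="\<lambda>b k. b (k, \<omega>)"])
      (use W K o mean_S_condition[where W=W, OF W _ o] in \<open>auto simp: codeword_law mean_S_pos\<close>)
  then show ?thesis unfolding Hp_def by (simp add: ex_minus)
qed

end

text \<open>The probabilistic method: some codebook does at least as well as the average.\<close>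

lemma exists_ge_ex:
  assumes "finite (set_pmf p)" shows "\<exists>a\<in>set_pmf p. ex p F \<le> F a"
proof (rule ccontr)
  assume "\<not> ?thesis"
  then have lt: "\<And>a. a \<in> set_pmf p \<Longrightarrow> F a < ex p F" by (auto simp: not_le)
  define e where "e = ex p F"
  have "(\<Sum>a\<in>set_pmf p. pmf p a * F a) < (\<Sum>a\<in>set_pmf p. pmf p a * e)"
    using assms lt by (intro sum_strict_mono) (auto simp: set_pmf_not_empty pmf_positive e_def)
  then have "ex p F < ex p (\<lambda>_. e)" unfolding ex_def .
  then show False using assms by (simp add: ex_const e_def)
qed

lemma ex_square_le:
  assumes "finite (set_pmf p)" shows "(ex p h - m)\<^sup>2 \<le> ex p (\<lambda>a. (h a - m)\<^sup>2)"
proof -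
  let ?e = "ex p h"
  have "0 \<le> ex p (\<lambda>a. (h a - ?e)\<^sup>2)" by (intro ex_nonneg) simp
  also have "ex p (\<lambda>a. (h a - ?e)\<^sup>2) = ex p (\<lambda>a. (h a - m)\<^sup>2 - 2 * (?e - m) * (h a - m) + (?e - m)\<^sup>2)"
    by (intro ex_cong refl) (simp add: power2_eq_square algebra_simps)
  also have "\<dots> = ex p (\<lambda>a. (h a - m)\<^sup>2) - (?e - m)\<^sup>2"
    unfolding ex_add ex_diff ex_cmult ex_const[OF assms] by (simp add: power2_eq_square)
  finally show ?thesis by simp
qed

subsection \<open>The likelihood encoder\<close>

locale oneshot = superposition P2 P1 f K N2 N1
  for P2 :: "'u pmf" and P1 :: "'u \<Rightarrow> 'v pmf" and f :: "'v \<Rightarrow> 'u" and K :: "nat set" and N2 N1 :: nat +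
  fixes A :: "'v \<Rightarrow> 'x pmf" and B :: "'v \<Rightarrow> 'y pmf" and G :: "'u \<Rightarrow> 'z pmf"
  assumes finA [simp]: "\<And>v. finite (set_pmf (A v))" and finB [simp]: "\<And>v. finite (set_pmf (B v))"
    and finG [simp]: "\<And>u. finite (set_pmf (G u))"
begin

definition "PX = bind_pmf P A"
definition "pxk = pair_pmf PX (pmf_of_set K)"

text \<open>Under \<open>ideal\<close> the codeword index is uniform and the source block is the channel output. The encoder \<open>enc\<close>
  draws the index from its conditional law given the source block and the key, with an arbitrary index
  where \<open>ideal\<close> has probability zero.\<close>

definition ideal :: "(nat \<times> nat \<times> nat \<Rightarrow> 'v) \<Rightarrow> (('x \<times> nat) \<times> (nat \<times> nat)) pmf" where
  "ideal b = bind_pmf (pmf_of_set K) (\<lambda>k. bind_pmf (pmf_of_set \<Omega>) (\<lambda>\<omega>. map_pmf (\<lambda>x. ((x, k), \<omega>)) (A (b (k, \<omega>)))))"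

definition "qxk b = map_pmf fst (ideal b)"

definition enc :: "(nat \<times> nat \<times> nat \<Rightarrow> 'v) \<Rightarrow> 'x \<times> nat \<Rightarrow> (nat \<times> nat) pmf" where
  "enc b xk = (if xk \<in> fst ` set_pmf (ideal b) then cond_law (ideal b) snd fst xk else return_pmf (0, 0))"

definition recv :: "(nat \<times> nat \<times> nat \<Rightarrow> 'v) \<Rightarrow> ('x \<times> nat) \<times> (nat \<times> nat) \<Rightarrow> ('x \<times> nat \<times> (nat \<times> nat) \<times> 'y \<times> 'z) pmf" where
  "recv b = (\<lambda>((x, k), \<omega>). map_pmf (\<lambda>(y, z). (x, k, \<omega>, y, z)) (pair_pmf (B (b (k, \<omega>))) (G (f (b (k, \<omega>))))))"

definition step :: "(nat \<times> nat \<times> nat \<Rightarrow> 'v) \<Rightarrow> 'x \<times> nat \<Rightarrow> ('x \<times> nat \<times> (nat \<times> nat) \<times> 'y \<times> 'z) pmf" where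
  "step b xk = bind_pmf (map_pmf (Pair xk) (enc b xk)) (recv b)"

definition "sys b = bind_pmf pxk (step b)"

lemma finPX [simp]: "finite (set_pmf PX)" by (simp add: PX_def)
lemma setK [simp]: "set_pmf (pmf_of_set K) = K" using K by simp
lemma set\<Omega> [simp]: "set_pmf (pmf_of_set \<Omega>) = \<Omega>" by simp
lemma finK [simp]: "finite K" using K by simp
lemma fin_pxk [simp]: "finite (set_pmf pxk)" by (simp add: pxk_def)
lemma fin_ideal [simp]: "finite (set_pmf (ideal b))" by (simp add: ideal_def)
lemma fin_qxk [simp]: "finite (set_pmf (qxk b))" by (simp add: qxk_def)
lemma fin_enc [simp]: "finite (set_pmf (enc b xk))" by (simp add: enc_def)
lemma fin_recv [simp]: "finite (set_pmf (recv b w))" by (simp add: recv_def case_prod_unfold)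
lemma fin_step [simp]: "finite (set_pmf (step b xk))" by (simp add: step_def)
lemma fin_sys [simp]: "finite (set_pmf (sys b))" by (simp add: sys_def)

lemma enc_supp: "set_pmf (enc b xk) \<subseteq> \<Omega>"
proof (cases "xk \<in> fst ` set_pmf (ideal b)")
  case True
  then have "set_pmf (enc b xk) \<subseteq> snd ` set_pmf (ideal b)"
    using cond_law_subset[OF True, of snd] by (auto simp: enc_def)
  also have "\<dots> \<subseteq> \<Omega>" by (auto simp: ideal_def)
  finally show ?thesis .
next
  case False
  \<comment> \<open>The default index (0, 0) belongs to \<Omega> because N1 and N2 are
    positive.\<close>
  then show ?thesis using N1 N2 by (simp add: enc_def \<Omega>_def)
qed

text \<open>By Bayes' rule the encoder rebuilds \<open>ideal\<close> from its marginal on source and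
  key. Hence the real system and the ideal one differ in that marginal alone.\<close>

lemma ideal_eq: "ideal b = bind_pmf (qxk b) (\<lambda>xk. map_pmf (Pair xk) (enc b xk))"
proof (rule pmf_eqI)
  fix t :: "('x \<times> nat) \<times> (nat \<times> nat)"
  obtain xk \<omega> where t: "t = (xk, \<omega>)" by (cases t)
  have "pmf (bind_pmf (qxk b) (\<lambda>xk. map_pmf (Pair xk) (enc b xk))) t = pmf (qxk b) xk * pmf (enc b xk) \<omega>"
    by (simp add: t pmf_bind_Pair)
  also have "\<dots> = pmf (ideal b) t"
  proof (cases "xk \<in> fst ` set_pmf (ideal b)")
    case True
    have "pmf (qxk b) xk * pmf (enc b xk) \<omega> = pmf (map_pmf (\<lambda>w. (snd w, fst w)) (ideal b)) (\<omega>, xk)"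
      using True pmf_cond_law[OF fin_ideal, of fst b xk snd \<omega>] by (simp add: qxk_def enc_def)
    also have "\<dots> = pmf (ideal b) t"
      using pmf_map_inj'[of "\<lambda>w. (snd w, fst w)" "ideal b" t] by (simp add: t inj_def prod_eq_iff)
    finally show ?thesis .
  next
    case False
    then have "pmf (qxk b) xk = 0" "pmf (ideal b) t = 0"
      by (auto simp: qxk_def pmf_eq_0_set_pmf t image_iff)
    then show ?thesis by simp
  qed
  finally show "pmf (ideal b) t = pmf (bind_pmf (qxk b) (\<lambda>xk. map_pmf (Pair xk) (enc b xk))) t" ..
qed

lemma ideal_sys: "bind_pmf (ideal b) (recv b) = bind_pmf (qxk b) (step b)"
  by (subst ideal_eq) (simp add: step_def[abs_def] bind_assoc_pmf)

lemma pmf_qxk: "pmf (qxk b) (x, k) = pmf (pmf_of_set K) k * pmf (out_X A b k) x"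
proof -
  have "qxk b = map_pmf (\<lambda>(k, x). (x, k)) (bind_pmf (pmf_of_set K) (\<lambda>k. map_pmf (Pair k) (out_X A b k)))"
    unfolding qxk_def ideal_def out_X_def by (simp add: map_bind_pmf pmf.map_comp o_def)
  then show ?thesis
    using pmf_map_inj'[of "\<lambda>(k, x). (x, k)" "bind_pmf (pmf_of_set K) (\<lambda>k. map_pmf (Pair k) (out_X A b k))" "(k, x)"]
    by (simp add: inj_def pmf_bind_Pair)
qed

lemma out_X_supp:
  assumes "b \<in> set_pmf codebook" "k \<in> K" shows "set_pmf (out_X A b k) \<subseteq> set_pmf PX"
  using codeword_supp[OF assms] by (force simp: out_X_def PX_def)

lemma fin_out_X [simp]: "finite (set_pmf (out_X A b k))" by (simp add: out_X_def)

lemma qxk_supp: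
  assumes "b \<in> set_pmf codebook" shows "set_pmf (qxk b) \<subseteq> set_pmf pxk"
  using out_X_supp[OF assms] by (force simp: qxk_def ideal_def pxk_def out_X_def)

text \<open>The key is uniform under both laws and cancels, leaving the average divergence over the
  keys.\<close>

lemma rel_ent_qxk:
  assumes b: "b \<in> set_pmf codebook"
  shows "rel_ent (qxk b) pxk = ex (pmf_of_set K) (\<lambda>k. rel_ent (out_X A b k) PX)"
proof -
  have e: "ex (qxk b) g = ex (pmf_of_set K) (\<lambda>k. ex (out_X A b k) (\<lambda>x. g (x, k)))" for g
    unfolding qxk_def ideal_def out_X_def by (simp add: map_bind_pmf ex_bind ex_map)
  show ?thesis
    unfolding rel_ent_def[of "qxk b"] e unfolding rel_ent_def
  proof (intro ex_cong refl)
    fix k x assume k: "k \<in> set_pmf (pmf_of_set K)" and x: "x \<in> set_pmf (out_X A b k)"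
    have "x \<in> set_pmf PX" using out_X_supp[OF b] k x by auto
    then have "0 < pmf PX x" "0 < pmf (out_X A b k) x" "0 < pmf (pmf_of_set K) k"
      using x k by (auto intro: pmf_positive)
    then show "log 2 (pmf (qxk b) (x, k)) - log 2 (pmf pxk (x, k)) = log 2 (pmf (out_X A b k) x) - log 2 (pmf PX x)"
      unfolding pmf_qxk pxk_def pmf_pair by (simp add: log_mult)
  qed
qed

lemma sys_xk: "map_pmf (\<lambda>(x, k, \<omega>, y, z). (x, k)) (sys b) = pxk"
proof -
  have "map_pmf (\<lambda>(x, k, \<omega>, y, z). (x, k)) (step b xk) = return_pmf xk" for xk
    unfolding step_def recv_def
    by (simp add: map_bind_pmf bind_map_pmf pmf.map_comp o_def case_prod_unfold map_pmf_const)
  then show ?thesis unfolding sys_def map_bind_pmf by (simp add: bind_return_pmf')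
qed

lemma sys_supp:
  assumes b: "b \<in> set_pmf codebook" and w: "(x, k, \<omega>, y, z) \<in> set_pmf (sys b)"
  shows "\<omega> \<in> \<Omega>" "\<exists>v\<in>set_pmf P. y \<in> set_pmf (B v) \<and> z \<in> set_pmf (G (f v))" "x \<in> set_pmf PX"
proof -
  have k: "k \<in> K" and o: "\<omega> \<in> \<Omega>" and yz: "y \<in> set_pmf (B (b (k, \<omega>)))" "z \<in> set_pmf (G (f (b (k, \<omega>))))"
    and x: "x \<in> set_pmf PX"
    using w enc_supp[of b] by (auto simp: sys_def step_def recv_def pxk_def)
  show "\<omega> \<in> \<Omega>" "x \<in> set_pmf PX" by (fact o, fact x)
  show "\<exists>v\<in>set_pmf P. y \<in> set_pmf (B v) \<and> z \<in> set_pmf (G (f v))"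
    using codeword_supp[OF b k o] yz by blast
qed

definition "pm b = bind_pmf pxk (\<lambda>xk. map_pmf (Pair xk) (enc b xk))"

lemma fin_pm [simp]: "finite (set_pmf (pm b))" by (simp add: pm_def)

lemma sys_eq_pm: "sys b = bind_pmf (pm b) (recv b)"
  unfolding sys_def step_def pm_def by (simp add: bind_assoc_pmf)

lemma sys_markov1:
  "markov_chain (sys b) (\<lambda>(x, k, \<omega>, y, z). x) (\<lambda>(x, k, \<omega>, y, z). (\<omega>, k)) (\<lambda>(x, k, \<omega>, y, z). (fst \<omega>, y))"
proof (rule markov_kernel)
  show "finite (set_pmf (pm b))" by simp
  have "map_pmf (\<lambda>w. ((\<lambda>(x, k, \<omega>, y, z). x) w, (\<lambda>(x, k, \<omega>, y, z). (\<omega>, k)) w, (\<lambda>(x, k, \<omega>, y, z). (fst \<omega>, y)) w)) (recv b s)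
     = map_pmf (\<lambda>c. (fst (fst s), (snd s, snd (fst s)), c)) (map_pmf (Pair (fst (snd s))) (B (b (snd (fst s), snd s))))" for s
  proof -
    obtain x k \<omega> where s: "s = ((x, k), \<omega>)" by (metis surj_pair)
    have "map_pmf (\<lambda>(y, z). (x, (\<omega>, k), fst \<omega>, y)) (pair_pmf (B (b (k, \<omega>))) (G (f (b (k, \<omega>)))))
      = map_pmf (\<lambda>y. (x, (\<omega>, k), fst \<omega>, y)) (map_pmf fst (pair_pmf (B (b (k, \<omega>))) (G (f (b (k, \<omega>))))))"
      by (simp only: pmf.map_comp o_def case_prod_unfold)
    then show ?thesis unfolding s recv_def map_fst_pair_pmf by (simp add: pmf.map_comp o_def case_prod_unfold)
  qed
  then show "map_pmf (\<lambda>w. ((\<lambda>(x, k, \<omega>, y, z). x) w, (\<lambda>(x, k, \<omega>, y, z). (\<omega>, k)) w, (\<lambda>(x, k, \<omega>, y, z). (fst \<omega>, y)) w)) (sys b)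
    = bind_pmf (pm b) (\<lambda>s. map_pmf (\<lambda>c. (fst (fst s), (snd s, snd (fst s)), c))
         ((\<lambda>(\<omega>, k). map_pmf (Pair (fst \<omega>)) (B (b (k, \<omega>)))) (snd s, snd (fst s))))"
    unfolding sys_eq_pm map_bind_pmf by simp
qed

lemma sys_markov2:
  assumes b: "b \<in> set_pmf codebook"
  shows "markov_chain (sys b) (\<lambda>(x, k, \<omega>, y, z). (x, \<omega>, y)) (\<lambda>(x, k, \<omega>, y, z). (fst \<omega>, k)) (\<lambda>(x, k, \<omega>, y, z). z)"
proof (rule markov_kernel)
  let ?r = "bind_pmf (pm b) (\<lambda>((x, k), \<omega>). map_pmf (\<lambda>y. ((x, \<omega>, y), (fst \<omega>, k))) (B (b (k, \<omega>))))"
  \<comment> \<open>Node 3 does not learn j; satellite 0 has the same cloud centre.\<close>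
  let ?k = "\<lambda>(i, k). G (f (b (k, i, 0)))"
  show "finite (set_pmf ?r)" by (simp add: case_prod_unfold)
  show "map_pmf (\<lambda>w. ((\<lambda>(x, k, \<omega>, y, z). (x, \<omega>, y)) w, (\<lambda>(x, k, \<omega>, y, z). (fst \<omega>, k)) w, (\<lambda>(x, k, \<omega>, y, z). z) w)) (sys b)
    = bind_pmf ?r (\<lambda>s. map_pmf (\<lambda>c. (fst s, snd s, c)) (?k (snd s)))"
    unfolding sys_eq_pm map_bind_pmf bind_assoc_pmf
  proof (intro bind_pmf_cong refl)
    fix s assume s: "s \<in> set_pmf (pm b)"
    obtain x k i j where se: "s = ((x, k), (i, j))" by (metis surj_pair)
    have k: "k \<in> K" and o: "(i, j) \<in> \<Omega>" using s enc_supp[of b] by (auto simp: se pm_def pxk_def)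
    have e: "f (b (k, i, j)) = f (b (k, i, 0))"
      using codeword_sep[OF b k, of i j 0] o N1 by (auto simp: \<Omega>_def)
    show "map_pmf (\<lambda>w. ((\<lambda>(x, k, \<omega>, y, z). (x, \<omega>, y)) w, (\<lambda>(x, k, \<omega>, y, z). (fst \<omega>, k)) w, (\<lambda>(x, k, \<omega>, y, z). z) w)) (recv b s)
      = bind_pmf ((\<lambda>((x, k), \<omega>). map_pmf (\<lambda>y. ((x, \<omega>, y), (fst \<omega>, k))) (B (b (k, \<omega>)))) s) (\<lambda>s. map_pmf (\<lambda>c. (fst s, snd s, c)) (?k (snd s)))"
      unfolding se recv_def by (simp add: e pmf.map_comp o_def case_prod_unfold bind_map_pmf pair_pmf_def map_bind_pmf)
        (simp add: map_pmf_def)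
  qed
qed

definition mean_dist :: "('x \<Rightarrow> 'y \<Rightarrow> 'z \<Rightarrow> real) \<Rightarrow> 'v \<Rightarrow> real" where
  "mean_dist d v = ex (A v) (\<lambda>x. ex (B v) (\<lambda>y. ex (G (f v)) (\<lambda>z. d x y z)))"

definition "U = pair_pmf (pmf_of_set K) (pmf_of_set \<Omega>)"

lemma finU [simp]: "finite (set_pmf U)" by (simp add: U_def)

text \<open>A spread per codeword is enough: in the block application \<open>g\<close> is itself an
  average of n independent letters, with variance of order 1 / n.\<close>

definition dev :: "('v \<Rightarrow> real) \<Rightarrow> (nat \<times> nat \<times> nat \<Rightarrow> 'v) \<Rightarrow> real" where
  "dev g b = ex U (\<lambda>w. (g (b w) - ex P g)\<^sup>2)"

lemma dev_nonneg: "0 \<le> dev g b" unfolding dev_def by (intro ex_nonneg) simp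

lemma ex_dev: "ex codebook (dev g) = ex P (\<lambda>v. (g v - ex P g)\<^sup>2)"
proof -
  have "ex codebook (dev g) = ex U (\<lambda>w. ex codebook (\<lambda>b. (g (b w) - ex P g)\<^sup>2))"
    unfolding dev_def[abs_def] by (rule ex_swap)
  also have "\<dots> = ex U (\<lambda>w. ex P (\<lambda>v. (g v - ex P g)\<^sup>2))"
  proof (intro ex_cong refl)
    fix w assume "w \<in> set_pmf U"
    then obtain k \<omega> where "w = (k, \<omega>)" "k \<in> K" "\<omega> \<in> \<Omega>" by (auto simp: U_def)
    then show "ex codebook (\<lambda>b. (g (b w) - ex P g)\<^sup>2) = ex P (\<lambda>v. (g v - ex P g)\<^sup>2)"
      using ex_codeword[of k \<omega> "\<lambda>v. (g v - ex P g)\<^sup>2"] by simp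
  qed
  finally show ?thesis by (simp add: ex_const)
qed

lemma sys_l1:
  assumes b: "b \<in> set_pmf codebook"
  shows "0 \<le> rel_ent (qxk b) pxk" "l1_dist pxk (qxk b) \<le> 2 * sqrt (rel_ent (qxk b) pxk)"
proof -
  have "l1_dist pxk (qxk b) = l1_dist (qxk b) pxk"
    unfolding l1_dist_def by (simp add: Un_commute abs_minus_commute)
  then show "l1_dist pxk (qxk b) \<le> 2 * sqrt (rel_ent (qxk b) pxk)" "0 \<le> rel_ent (qxk b) pxk"
    using l1_dist_le_rel_ent[OF fin_pxk qxk_supp[OF b]] by simp_all
qed

text \<open>Under \<open>ideal\<close> the distortion is the codebook average of
  \<open>mean_dist\<close>, within \<open>sqrt (dev (mean_dist d) b)\<close> of its expectation.
  Passing to the real source costs M times the L1 distance.\<close>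

lemma sys_dist:
  assumes b: "b \<in> set_pmf codebook" and d: "\<And>x y z. \<bar>d x y z\<bar> \<le> M"
  shows "ex (sys b) (\<lambda>(x, k, \<omega>, y, z). d x y z)
    \<le> ex P (mean_dist d) + sqrt (dev (mean_dist d) b) + M * (2 * sqrt (rel_ent (qxk b) pxk))"
proof -
  let ?d = "\<lambda>(x, k :: nat, \<omega> :: nat \<times> nat, y, z). d x y z"
  have M: "0 \<le> M" using d[of undefined undefined undefined] by linarith
  have bd: "\<bar>ex (step b xk) ?d\<bar> \<le> M" for xk
  proof -
    have "ex (step b xk) ?d \<le> ex (step b xk) (\<lambda>_. M)" "ex (step b xk) (\<lambda>_. - M) \<le> ex (step b xk) ?d"
      using d by (auto intro!: ex_mono simp: abs_le_iff minus_le_iff)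
    then show ?thesis by (simp add: ex_const)
  qed
  have "ex (sys b) ?d = ex pxk (\<lambda>xk. ex (step b xk) ?d)"
    unfolding sys_def by (rule ex_bind) auto
  also have "\<dots> \<le> ex (qxk b) (\<lambda>xk. ex (step b xk) ?d) + M * l1_dist pxk (qxk b)"
    by (rule ex_l1_dist) (auto simp: bd)
  also have "ex (qxk b) (\<lambda>xk. ex (step b xk) ?d) = ex (bind_pmf (ideal b) (recv b)) ?d"
    unfolding ideal_sys by (rule ex_bind[symmetric]) auto
  also have "\<dots> = ex U (\<lambda>w. mean_dist d (b w))"
    unfolding ideal_def U_def mean_dist_def recv_def
    by (simp add: ex_bind ex_map ex_pair bind_assoc_pmf bind_map_pmf case_prod_unfold)
  also have "\<dots> \<le> ex P (mean_dist d) + sqrt (dev (mean_dist d) b)"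
  proof -
    have "(ex U (\<lambda>w. mean_dist d (b w)) - ex P (mean_dist d))\<^sup>2 \<le> dev (mean_dist d) b"
      unfolding dev_def by (rule ex_square_le) simp
    then have "\<bar>ex U (\<lambda>w. mean_dist d (b w)) - ex P (mean_dist d)\<bar> \<le> sqrt (dev (mean_dist d) b)"
      using real_le_rsqrt real_sqrt_abs real_sqrt_le_iff by metis
    then show ?thesis by linarith
  qed
  also have "M * l1_dist pxk (qxk b) \<le> M * (2 * sqrt (rel_ent (qxk b) pxk))"
    using sys_l1[OF b] M by (intro mult_left_mono) auto
  finally show ?thesis by simp
qed

definition sel_kernel :: "('x \<Rightarrow> 'y \<Rightarrow> 'z \<Rightarrow> 's) \<Rightarrow> 'v \<Rightarrow> 's pmf" where
  "sel_kernel \<sigma> v = map_pmf (\<lambda>(x, y, z). \<sigma> x y z) (pair_pmf (A v) (pair_pmf (B v) (G (f v))))"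

lemma fin_sel_kernel [simp]: "finite (set_pmf (sel_kernel \<sigma> v))" by (simp add: sel_kernel_def)

text \<open>Under the ideal law the index is uniform and leaves the key uniform, so given the index
  the selected signals have law \<open>out_S\<close>.\<close>

lemma ideal_cond_ent:
  "Hp (map_pmf (\<lambda>(x, k, \<omega>, y, z). (\<sigma> x y z, \<omega>)) (bind_pmf (ideal b) (recv b)))
     - Hp (map_pmf snd (map_pmf (\<lambda>(x, k, \<omega>, y, z). (\<sigma> x y z, \<omega>)) (bind_pmf (ideal b) (recv b))))
   = ex (pmf_of_set \<Omega>) (\<lambda>\<omega>. Hp (out_S (sel_kernel \<sigma>) b \<omega>))"
proof -
  let ?q = "bind_pmf (ideal b) (recv b)"
  let ?j = "map_pmf (\<lambda>(x, k, \<omega>, y, z). (\<sigma> x y z, \<omega>)) ?q"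
  have sw: "map_pmf (\<lambda>(s, \<omega>). (\<omega>, s)) ?j = bind_pmf (pmf_of_set \<Omega>) (\<lambda>\<omega>. map_pmf (Pair \<omega>) (out_S (sel_kernel \<sigma>) b \<omega>))"
  proof -
    have "map_pmf (\<lambda>(s, \<omega>). (\<omega>, s)) ?j
       = bind_pmf (pmf_of_set K) (\<lambda>k. bind_pmf (pmf_of_set \<Omega>) (\<lambda>\<omega>. map_pmf (Pair \<omega>) (sel_kernel \<sigma> (b (k, \<omega>)))))"
      unfolding ideal_def recv_def sel_kernel_def
      by (simp add: map_bind_pmf bind_assoc_pmf bind_map_pmf pmf.map_comp o_def case_prod_unfold pair_pmf_def[of "A _"] map_pmf_def bind_return_pmf)
    also have "\<dots> = bind_pmf (pmf_of_set \<Omega>) (\<lambda>\<omega>. bind_pmf (pmf_of_set K) (\<lambda>k. map_pmf (Pair \<omega>) (sel_kernel \<sigma> (b (k, \<omega>)))))"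
      by (rule bind_commute_pmf)
    finally show ?thesis by (simp add: out_S_def map_bind_pmf)
  qed
  have fj: "finite (set_pmf ?j)" by auto
  have "Hp ?j = Hp (map_pmf (\<lambda>(s, \<omega>). (\<omega>, s)) ?j)"
    by (rule Hp_map_inj[symmetric]) (use fj in \<open>auto simp: inj_on_def\<close>)
  also have "\<dots> = Hp (pmf_of_set \<Omega>) + ex (pmf_of_set \<Omega>) (\<lambda>\<omega>. Hp (out_S (sel_kernel \<sigma>) b \<omega>))"
    unfolding sw by (rule Hp_bind_Pair) (auto simp: out_S_def)
  finally have 1: "Hp ?j = Hp (pmf_of_set \<Omega>) + ex (pmf_of_set \<Omega>) (\<lambda>\<omega>. Hp (out_S (sel_kernel \<sigma>) b \<omega>))" .
  have "map_pmf snd ?j = map_pmf fst (map_pmf (\<lambda>(s, \<omega>). (\<omega>, s)) ?j)"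
    by (simp add: pmf.map_comp o_def case_prod_unfold)
  also have "\<dots> = pmf_of_set \<Omega>"
    unfolding sw by (simp add: map_bind_pmf pmf.map_comp o_def map_pmf_const bind_return_pmf')
  finally show ?thesis using 1 by simp
qed

text \<open>Transfers the ideal conditional entropy to the real source by
  \<open>cond_ent_continuous\<close> and data processing.\<close>

lemma sys_cond_ent:
  assumes b: "b \<in> set_pmf codebook" and T: "finite T" "T \<noteq> {}" "\<And>x y z. x \<in> set_pmf PX \<Longrightarrow> (\<exists>v\<in>set_pmf P. y \<in> set_pmf (B v) \<and> z \<in> set_pmf (G (f v))) \<Longrightarrow> \<sigma> x y z \<in> T"
  shows "ex (pmf_of_set \<Omega>) (\<lambda>\<omega>. Hp (out_S (sel_kernel \<sigma>) b \<omega>)) - 2 - 2 * sqrt (rel_ent (qxk b) pxk) * log 2 (card T)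
     \<le> ent (sys b) (\<lambda>(x, k, \<omega>, y, z). (\<sigma> x y z, \<omega>)) - ent (sys b) (\<lambda>(x, k, \<omega>, y, z). \<omega>)"
proof -
  let ?g = "\<lambda>(x, k, \<omega>, y, z). (\<sigma> x y z, \<omega>)"
  let ?q = "bind_pmf (qxk b) (step b)"
  have px: "fst xk \<in> set_pmf PX" "snd xk \<in> K" if "xk \<in> set_pmf (qxk b)" for xk
    using subsetD[OF qxk_supp[OF b] that] by (auto simp: pxk_def)
  have "set_pmf (map_pmf ?g (sys b)) \<subseteq> T \<times> \<Omega>"
    using sys_supp[OF b] T(3) by (auto; blast)
  moreover have "set_pmf ?q \<subseteq> set_pmf (sys b)"
    using qxk_supp[OF b] by (auto simp: sys_def)
  ultimately have sub: "set_pmf (map_pmf ?g (sys b)) \<subseteq> T \<times> \<Omega>" "set_pmf (map_pmf ?g ?q) \<subseteq> T \<times> \<Omega>"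
    unfolding set_map_pmf by blast+
  have l1: "l1_dist (map_pmf ?g (sys b)) (map_pmf ?g ?q) \<le> 2 * sqrt (rel_ent (qxk b) pxk)"
  proof -
    have "l1_dist (map_pmf ?g (sys b)) (map_pmf ?g ?q) \<le> l1_dist (sys b) ?q"
      by (rule l1_dist_map) auto
    also have "\<dots> \<le> l1_dist pxk (qxk b)" unfolding sys_def by (rule l1_dist_bind) auto
    finally show ?thesis using sys_l1[OF b] by linarith
  qed
  have "1 \<le> card T" using T by (simp add: Suc_le_eq card_gt_0_iff)
  then have "l1_dist (map_pmf ?g (sys b)) (map_pmf ?g ?q) * log 2 (card T) \<le> 2 * sqrt (rel_ent (qxk b) pxk) * log 2 (card T)"
    using l1 by (intro mult_right_mono) auto
  moreover have "Hp (map_pmf ?g ?q) - Hp (map_pmf snd (map_pmf ?g ?q)) - 2 - l1_dist (map_pmf ?g (sys b)) (map_pmf ?g ?q) * log 2 (card T)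
     \<le> Hp (map_pmf ?g (sys b)) - Hp (map_pmf snd (map_pmf ?g (sys b)))"
    by (rule cond_ent_continuous[OF T(1,2) fin\<Omega>(1) sub])
  moreover have marg: "map_pmf snd (map_pmf ?g (sys b)) = map_pmf (\<lambda>(x, k, \<omega>, y, z). \<omega>) (sys b)"
    by (simp add: pmf.map_comp o_def case_prod_unfold)
  ultimately show ?thesis
    using ideal_cond_ent[of \<sigma> b] unfolding ideal_sys marg by linarith
qed

text \<open>One scalar objective covers secrecy, source error and both distortions, so one codebook
  serves them all; a large weight \<open>a\<close> forces the penalties to be small since the
  secrecy term is bounded.\<close>

lemma good_codebook:
  assumes "0 \<le> a"
  shows "\<exists>b\<in>set_pmf codebook.
     - ex P (\<lambda>v. ex (sel_kernel \<sigma> v) (\<lambda>s. log 2 (mean_S (sel_kernel \<sigma>) s v)))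
     - a * (ex P (\<lambda>v. ex (A v) (\<lambda>x. log 2 (mean_X A x v) - log 2 (pmf PX x)))
          + ex P (\<lambda>v. (g1 v - ex P g1)\<^sup>2) + ex P (\<lambda>v. (g2 v - ex P g2)\<^sup>2))
     \<le> ex (pmf_of_set \<Omega>) (\<lambda>\<omega>. Hp (out_S (sel_kernel \<sigma>) b \<omega>))
       - a * (rel_ent (qxk b) pxk + dev g1 b + dev g2 b)"
proof -
  let ?F = "\<lambda>b. ex (pmf_of_set \<Omega>) (\<lambda>\<omega>. Hp (out_S (sel_kernel \<sigma>) b \<omega>)) - a * (rel_ent (qxk b) pxk + dev g1 b + dev g2 b)"
  obtain b where b: "b \<in> set_pmf codebook" "ex codebook ?F \<le> ?F b"
    using exists_ge_ex[OF finite_codebook, of ?F] by blast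
  have "- ex P (\<lambda>v. ex (sel_kernel \<sigma> v) (\<lambda>s. log 2 (mean_S (sel_kernel \<sigma>) s v)))
     \<le> ex codebook (\<lambda>b. ex (pmf_of_set \<Omega>) (\<lambda>\<omega>. Hp (out_S (sel_kernel \<sigma>) b \<omega>)))"
  proof -
    have "ex (pmf_of_set \<Omega>) (\<lambda>_. - ex P (\<lambda>v. ex (sel_kernel \<sigma> v) (\<lambda>s. log 2 (mean_S (sel_kernel \<sigma>) s v))))
      \<le> ex (pmf_of_set \<Omega>) (\<lambda>\<omega>. ex codebook (\<lambda>b. Hp (out_S (sel_kernel \<sigma>) b \<omega>)))"
      by (intro ex_mono secrecy) auto
    then show ?thesis by (simp add: ex_const ex_swap[of codebook])
  qed
  moreover have "ex codebook (\<lambda>b. rel_ent (qxk b) pxk) \<le> ex P (\<lambda>v. ex (A v) (\<lambda>x. log 2 (mean_X A x v) - log 2 (pmf PX x)))"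
  proof -
    have "ex codebook (\<lambda>b. rel_ent (qxk b) pxk) = ex codebook (\<lambda>b. ex (pmf_of_set K) (\<lambda>k. rel_ent (out_X A b k) PX))"
      by (intro ex_cong refl rel_ent_qxk)
    also have "\<dots> = ex (pmf_of_set K) (\<lambda>k. ex codebook (\<lambda>b. rel_ent (out_X A b k) PX))" by (rule ex_swap)
    also have "\<dots> \<le> ex (pmf_of_set K) (\<lambda>k. ex P (\<lambda>v. ex (A v) (\<lambda>x. log 2 (mean_X A x v) - log 2 (pmf PX x))))"
      unfolding PX_def by (intro ex_mono resolvability) auto
    finally show ?thesis by (simp add: ex_const)
  qed
  ultimately have "- ex P (\<lambda>v. ex (sel_kernel \<sigma> v) (\<lambda>s. log 2 (mean_S (sel_kernel \<sigma>) s v)))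
     - a * (ex P (\<lambda>v. ex (A v) (\<lambda>x. log 2 (mean_X A x v) - log 2 (pmf PX x)))
          + ex P (\<lambda>v. (g1 v - ex P g1)\<^sup>2) + ex P (\<lambda>v. (g2 v - ex P g2)\<^sup>2)) \<le> ex codebook ?F"
    unfolding ex_diff ex_cmult ex_add ex_dev using assms by (intro diff_mono mult_left_mono add_mono) auto
  then show ?thesis using b by (intro bexI[of _ b]) auto
qed

end

subsection \<open>Memoryless channels\<close>

primrec dmc :: "('v \<Rightarrow> 'x pmf) \<Rightarrow> 'v list \<Rightarrow> 'x list pmf" where
  "dmc W [] = return_pmf []"
| "dmc W (v # vs) = bind_pmf (W v) (\<lambda>x. map_pmf ((#) x) (dmc W vs))"

lemma dmc_Cons_pair: "dmc W (v # vs) = map_pmf (\<lambda>(x, xs). x # xs) (pair_pmf (W v) (dmc W vs))"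
  by (simp add: pair_pmf_def map_bind_pmf map_pmf_def bind_assoc_pmf bind_return_pmf)

lemma finite_dmc: "(\<And>v. finite (set_pmf (W v))) \<Longrightarrow> finite (set_pmf (dmc W vs))"
  by (induction vs) auto

lemma set_dmc: "xs \<in> set_pmf (dmc W vs) \<longleftrightarrow> list_all2 (\<lambda>x v. x \<in> set_pmf (W v)) xs vs"
  by (induction vs arbitrary: xs) (auto simp: list_all2_Cons2)

lemma length_dmc: "xs \<in> set_pmf (dmc W vs) \<Longrightarrow> length xs = length vs"
  by (auto simp: set_dmc dest: list_all2_lengthD)

lemma pmf_dmc_Cons: "pmf (dmc W (v # vs)) (x # xs) = pmf (W v) x * pmf (dmc W vs) xs"
  using pmf_map_inj'[of "\<lambda>(x, xs). x # xs" "pair_pmf (W v) (dmc W vs)" "(x, xs)"]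
  unfolding dmc_Cons_pair by (simp add: inj_def pmf_pair)

lemma pmf_replicate_Cons: "pmf (replicate_pmf (Suc n) p) (x # xs) = pmf p x * pmf (replicate_pmf n p) xs"
  using pmf_map_inj'[of "\<lambda>(x, xs). x # xs" "pair_pmf p (replicate_pmf n p)" "(x, xs)"]
  unfolding replicate_pmf_Suc_map by (simp add: inj_def pmf_pair)

lemma replicate_Suc_bind: "replicate_pmf (Suc n) p = bind_pmf p (\<lambda>x. map_pmf ((#) x) (replicate_pmf n p))"
  by (simp add: map_pmf_def)

lemma bind_replicate_dmc: "bind_pmf (replicate_pmf n p) (dmc W) = replicate_pmf n (bind_pmf p W)"
proof (induction n)
  case (Suc n)
  have "bind_pmf (replicate_pmf (Suc n) p) (dmc W)
     = bind_pmf p (\<lambda>v. bind_pmf (replicate_pmf n p) (\<lambda>vs. bind_pmf (W v) (\<lambda>x. map_pmf ((#) x) (dmc W vs))))"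
    unfolding replicate_Suc_bind by (simp add: bind_assoc_pmf bind_map_pmf)
  also have "\<dots> = bind_pmf p (\<lambda>v. bind_pmf (W v) (\<lambda>x. bind_pmf (replicate_pmf n p) (\<lambda>vs. map_pmf ((#) x) (dmc W vs))))"
    by (intro bind_pmf_cong refl bind_commute_pmf)
  also have "\<dots> = bind_pmf p (\<lambda>v. bind_pmf (W v) (\<lambda>x. map_pmf ((#) x) (bind_pmf (replicate_pmf n p) (dmc W))))"
    by (simp add: map_bind_pmf)
  finally show ?case unfolding Suc replicate_Suc_bind by (simp add: bind_assoc_pmf)
qed (simp add: bind_return_pmf)

lemma bind_dmc_dmc: "bind_pmf (dmc V us) (dmc W) = dmc (\<lambda>u. bind_pmf (V u) W) us"
proof (induction us)
  case (Cons u us)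
  have "bind_pmf (dmc V (u # us)) (dmc W)
     = bind_pmf (V u) (\<lambda>v. bind_pmf (dmc V us) (\<lambda>vs. bind_pmf (W v) (\<lambda>x. map_pmf ((#) x) (dmc W vs))))"
    by (simp add: bind_assoc_pmf bind_map_pmf)
  also have "\<dots> = bind_pmf (V u) (\<lambda>v. bind_pmf (W v) (\<lambda>x. bind_pmf (dmc V us) (\<lambda>vs. map_pmf ((#) x) (dmc W vs))))"
    by (intro bind_pmf_cong refl bind_commute_pmf)
  also have "\<dots> = bind_pmf (V u) (\<lambda>v. bind_pmf (W v) (\<lambda>x. map_pmf ((#) x) (bind_pmf (dmc V us) (dmc W))))"
    by (simp add: map_bind_pmf)
  finally show ?case unfolding Cons by (simp add: bind_assoc_pmf)
qed (simp add: bind_return_pmf)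

lemma map_nth_dmc: "t < length vs \<Longrightarrow> map_pmf (\<lambda>xs. xs ! t) (dmc W vs) = W (vs ! t)"
proof (induction vs arbitrary: t)
  case (Cons v vs)
  show ?case
  proof (cases t)
    case 0
    then show ?thesis by (simp add: map_bind_pmf pmf.map_comp o_def map_pmf_const bind_return_pmf')
  next
    case (Suc t')
    then have "map_pmf (\<lambda>xs. xs ! t') (dmc W vs) = W (vs ! t')" using Cons by simp
    then show ?thesis using Suc by (simp add: map_bind_pmf pmf.map_comp o_def)
  qed
qed simp

lemma ex_replicate_Suc:
  assumes "finite (set_pmf p)"
  shows "ex (replicate_pmf (Suc n) p) g = ex p (\<lambda>v. ex (replicate_pmf n p) (\<lambda>vs. g (v # vs)))"
  unfolding replicate_Suc_bind using assms by (subst ex_bind) (auto simp: ex_map)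

lemma ex_dmc_Cons:
  assumes "\<And>v. finite (set_pmf (W v))"
  shows "ex (dmc W (v # vs)) g = ex (W v) (\<lambda>x. ex (dmc W vs) (\<lambda>xs. g (x # xs)))"
  using assms finite_dmc[of W vs] by (simp add: ex_bind ex_map)

lemma ex_prod_split: "ex p (\<lambda>x. ex q (\<lambda>y. g x * h y)) = ex p g * ex q h"
  by (simp add: ex_cmult ex_cmult_right)

lemma ex_multiplicative:
  assumes fin: "finite (set_pmf p)" "\<And>v. finite (set_pmf (W v))"
    and F: "F [] [] = 1" "\<And>v vs x xs. F (v # vs) (x # xs) = g v x * F vs xs"
  shows "ex (replicate_pmf n p) (\<lambda>vs. ex (dmc W vs) (F vs)) = (ex p (\<lambda>v. ex (W v) (g v))) ^ n"
proof (induction n)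
  case (Suc n)
  have "ex (replicate_pmf (Suc n) p) (\<lambda>vs. ex (dmc W vs) (F vs))
    = ex p (\<lambda>v. ex (replicate_pmf n p) (\<lambda>vs. ex (W v) (g v) * ex (dmc W vs) (F vs)))"
    unfolding ex_replicate_Suc[OF fin(1)] ex_dmc_Cons[OF fin(2)] F by (simp only: ex_prod_split)
  also have "\<dots> = ex p (\<lambda>v. ex (W v) (g v)) * ex (replicate_pmf n p) (\<lambda>vs. ex (dmc W vs) (F vs))"
    by (rule ex_prod_split)
  finally show ?case by (simp add: Suc)
qed (simp add: F)

lemma ex_replicate_sum:
  assumes "finite (set_pmf p)"
  shows "ex (replicate_pmf n p) (\<lambda>vs. \<Sum>t<n. g (vs ! t)) = n * ex p g"
proof -
  have "ex (replicate_pmf n p) (\<lambda>vs. g (vs ! t)) = ex p g" if "t < n" for t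
    using map_nth_replicate_pmf[OF that, of p] ex_map[of "replicate_pmf n p" "\<lambda>vs. vs ! t" g] assms by simp
  then show ?thesis by (simp add: ex_sum)
qed

text \<open>Independent centred summands: the cross terms vanish.\<close>

lemma ex_replicate_sum_square:
  assumes fin: "finite (set_pmf p)" and 0: "ex p h = 0"
  shows "ex (replicate_pmf n p) (\<lambda>vs. (\<Sum>t<n. h (vs ! t))\<^sup>2) = n * ex p (\<lambda>v. (h v)\<^sup>2)"
proof (induction n)
  case (Suc n)
  let ?s = "\<lambda>vs. \<Sum>t<n. h (vs ! t)"
  have "ex (replicate_pmf (Suc n) p) (\<lambda>vs. (\<Sum>t<Suc n. h (vs ! t))\<^sup>2)
    = ex p (\<lambda>v. ex (replicate_pmf n p) (\<lambda>vs. (h v)\<^sup>2 + 2 * (h v * ?s vs) + (?s vs)\<^sup>2))"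
    unfolding ex_replicate_Suc[OF fin] sum.lessThan_Suc_shift by (simp add: power2_sum algebra_simps)
  also have "\<dots> = ex p (\<lambda>v. (h v)\<^sup>2) + 2 * (ex p h * ex (replicate_pmf n p) ?s) + ex (replicate_pmf n p) (\<lambda>vs. (?s vs)\<^sup>2)"
    using fin by (simp only: ex_add ex_cmult ex_cmult_right ex_const finite_replicate_pmf)
  finally show ?case using 0 Suc by (simp add: algebra_simps)
qed (simp)

lemma ex_dmc_log:
  assumes fin: "finite (set_pmf p)" "\<And>v. finite (set_pmf (W v))"
  shows "ex (replicate_pmf n p) (\<lambda>vs. ex (dmc W vs) (\<lambda>xs. - log 2 (pmf (replicate_pmf n (bind_pmf p W)) xs)))
    = n * Hp (bind_pmf p W)"
proof -
  have "ex (replicate_pmf n p) (\<lambda>vs. ex (dmc W vs) (\<lambda>xs. - log 2 (pmf (replicate_pmf n (bind_pmf p W)) xs)))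
     = ex (bind_pmf (replicate_pmf n p) (dmc W)) (\<lambda>xs. - log 2 (pmf (replicate_pmf n (bind_pmf p W)) xs))"
    using fin by (subst ex_bind) (auto simp: finite_dmc)
  also have "\<dots> = Hp (replicate_pmf n (bind_pmf p W))" by (simp add: bind_replicate_dmc Hp_def)
  finally show ?thesis using fin by (simp add: Hp_replicate_pmf)
qed

subsection \<open>Exponential moments\<close>

text \<open>Both sides equal 1 at s = 0, and there the logarithmic slope of the right exceeds that
  of the left by \<eta> ln 2; so the right side wins for small positive s.\<close>

lemma moment_bound:
  assumes fin: "finite (set_pmf r)" and pos: "\<And>w. w \<in> set_pmf r \<Longrightarrow> 0 < h w" and \<eta>: "0 < \<eta>"
  shows "\<exists>\<delta>>0. \<forall>s. 0 < s \<longrightarrow> s < \<delta> \<longrightarrow> ex r (\<lambda>w. h w powr s) \<le> 2 powr (s * (ex r (\<lambda>w. log 2 (h w)) + \<eta>))"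
proof -
  let ?I = "ex r (\<lambda>w. log 2 (h w)) + \<eta>"
  define g where "g s = exp (s * (?I * ln 2)) - (\<Sum>w\<in>set_pmf r. pmf r w * exp (s * ln (h w)))" for s
  have e: "((\<lambda>s. exp (s * c)) has_real_derivative c) (at 0)" for c :: real
    by (auto intro!: derivative_eq_intros)
  have "(g has_real_derivative ?I * ln 2 - (\<Sum>w\<in>set_pmf r. pmf r w * ln (h w))) (at 0)"
    unfolding g_def by (intro DERIV_diff DERIV_sum DERIV_cmult e)
  moreover have "(\<Sum>w\<in>set_pmf r. pmf r w * ln (h w)) = ex r (\<lambda>w. log 2 (h w)) * ln 2"
    unfolding ex_def by (simp add: sum_distrib_right log_def)
  ultimately have "(g has_real_derivative (\<eta> * ln 2)) (at 0)" by (simp add: distrib_right)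
  moreover have "0 < \<eta> * ln 2" using \<eta> by simp
  ultimately obtain \<delta> where \<delta>: "0 < \<delta>" "\<And>s. 0 < s \<Longrightarrow> s < \<delta> \<Longrightarrow> g 0 < g (0 + s)"
    using DERIV_pos_inc_right by blast
  have g0: "g 0 = 0" using fin by (simp add: g_def sum_pmf_eq_1)
  have "ex r (\<lambda>w. h w powr s) \<le> 2 powr (s * ?I)" if s: "0 < s" "s < \<delta>" for s
  proof -
    have "0 \<le> g s" using \<delta>(2)[OF s] g0 by simp
    moreover have "ex r (\<lambda>w. h w powr s) = (\<Sum>w\<in>set_pmf r. pmf r w * exp (s * ln (h w)))"
      unfolding ex_def by (intro sum.cong) (auto simp: powr_def dest: pos)
    ultimately show ?thesis by (simp add: g_def powr_def mult.assoc)
  qed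
  then show ?thesis using \<delta>(1) by blast
qed

lemma powr_add_le:
  assumes "0 \<le> x" "0 \<le> y" "0 < s" "s \<le> (1::real)"
  shows "(x + y) powr s \<le> x powr s + y powr s"
proof (cases "x + y = 0")
  case True
  then have "x = 0" "y = 0" using assms by auto
  then show ?thesis by simp
next
  case False
  then have t: "0 < x + y" using assms by simp
  have le: "z \<le> z powr s" if "0 \<le> z" "z \<le> 1" for z :: real
  proof (cases "z = 0")
    case False
    then have "z powr 1 \<le> z powr s" using that assms by (intro powr_mono') auto
    then show ?thesis using that False by simp
  qed simp
  have "1 = x / (x + y) + y / (x + y)" using t by (simp add: add_divide_distrib[symmetric])
  also have "\<dots> \<le> (x / (x + y)) powr s + (y / (x + y)) powr s"
    using assms t by (intro add_mono le) auto
  also have "\<dots> = (x powr s + y powr s) / (x + y) powr s"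
    using assms t by (simp add: powr_divide add_divide_distrib)
  finally show ?thesis using t by (simp add: le_divide_eq)
qed

text \<open>Exchanges a ratio for its s-th power but keeps the logarithm. This suits secrecy, where
  the moment may grow exponentially and its logarithm stays linear in n.\<close>

lemma log_one_plus_le:
  assumes "0 \<le> z" "0 < s" "s \<le> (1::real)"
  shows "log 2 (1 + z) \<le> log 2 (1 + z powr s) / s"
proof -
  have "(1 + z) powr s \<le> 1 + z powr s" using powr_add_le[of 1 z s] assms by simp
  moreover have "0 < (1 + z) powr s" "0 < 1 + z powr s" using assms powr_ge_zero[of z s] by (simp, linarith)
  ultimately have "log 2 ((1 + z) powr s) \<le> log 2 (1 + z powr s)" by simp
  then have "s * log 2 (1 + z) \<le> log 2 (1 + z powr s)" using assms by (simp add: log_powr)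
  then show ?thesis using assms by (simp add: le_divide_eq mult.commute)
qed

text \<open>Drops the logarithm as well. This suits the source error, where the moment itself
  decays.\<close>

lemma log_one_plus_le_moment:
  assumes "0 \<le> z" "0 < s" "s \<le> (1::real)"
  shows "log 2 (1 + z) \<le> z powr s / (s * ln 2)"
proof -
  have "log 2 (1 + z powr s) \<le> log 2 1 + ((1 + z powr s) / 1 - 1) / ln 2"
    using powr_ge_zero[of z s] by (intro log2_le_tangent) linarith+
  then have "log 2 (1 + z powr s) / s \<le> (z powr s / ln 2) / s" using assms by (intro divide_right_mono) auto
  then show ?thesis using log_one_plus_le[OF assms] by (simp add: mult.commute)
qed

lemma log2_ex_jensen:
  assumes fin: "finite (set_pmf p)" and pos: "\<And>a. a \<in> set_pmf p \<Longrightarrow> 1 \<le> g a"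
  shows "ex p (\<lambda>a. log 2 (g a)) \<le> log 2 (ex p g)"
proof -
  have "ex p (\<lambda>_. 1) \<le> ex p g" using pos by (intro ex_mono) auto
  then have m: "0 < ex p g" using fin by (simp add: ex_const)
  have "ex p (\<lambda>a. log 2 (g a)) \<le> ex p (\<lambda>a. log 2 (ex p g) + (g a / ex p g - 1) / ln 2)"
    using pos m by (intro ex_mono log2_le_tangent) (auto intro: less_le_trans[of 0 1])
  also have "\<dots> = log 2 (ex p g)" using fin m by (simp add: ex_add ex_divide ex_diff ex_const)
  finally show ?thesis .
qed

text \<open>Mutual information as an average divergence. If it vanishes, every conditional law
  equals the output law; this is what handles zero rates.\<close>

lemma Hp_bind_ge:
  assumes fin: "finite (set_pmf p)" "\<And>v. finite (set_pmf (W v))"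
  shows "Hp (bind_pmf p W) - ex p (\<lambda>v. Hp (W v)) = ex p (\<lambda>v. rel_ent (W v) (bind_pmf p W))"
    "0 \<le> ex p (\<lambda>v. rel_ent (W v) (bind_pmf p W))"
    "ex p (\<lambda>v. rel_ent (W v) (bind_pmf p W)) = 0 \<Longrightarrow> v \<in> set_pmf p \<Longrightarrow> W v = bind_pmf p W"
proof -
  let ?Q = "bind_pmf p W"
  have finQ: "finite (set_pmf ?Q)" using fin by auto
  have sub: "set_pmf (W v) \<subseteq> set_pmf ?Q" if "v \<in> set_pmf p" for v using that by auto
  have "Hp ?Q = ex p (\<lambda>v. ex (W v) (\<lambda>x. - log 2 (pmf ?Q x)))"
    unfolding Hp_def by (rule ex_bind) (use fin in auto)
  then show "Hp ?Q - ex p (\<lambda>v. Hp (W v)) = ex p (\<lambda>v. rel_ent (W v) ?Q)"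
    unfolding rel_ent_def by (simp add: ex_diff ex_minus Hp_def)
  have nn: "0 \<le> rel_ent (W v) ?Q" if "v \<in> set_pmf p" for v
    by (rule l1_dist_le_rel_ent(1)[OF finQ sub[OF that]])
  then show "0 \<le> ex p (\<lambda>v. rel_ent (W v) ?Q)" by (rule ex_nonneg)
  assume z: "ex p (\<lambda>v. rel_ent (W v) ?Q) = 0" and v: "v \<in> set_pmf p"
  have "pmf p v * rel_ent (W v) ?Q = 0"
    using z v fin nn unfolding ex_def by (subst (asm) sum_nonneg_eq_0_iff) auto
  then have "rel_ent (W v) ?Q = 0" using v by (simp add: set_pmf_iff)
  then have "l1_dist (W v) ?Q \<le> 0" using l1_dist_le_rel_ent(2)[OF finQ sub[OF v]] by simp
  then have "l1_dist (W v) ?Q = 0" using l1_dist_nonneg[of "W v" ?Q] by simp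
  then have eq: "\<forall>a\<in>set_pmf (W v) \<union> set_pmf ?Q. pmf (W v) a = pmf ?Q a"
    unfolding l1_dist_def using fin finQ by (subst (asm) sum_nonneg_eq_0_iff) auto
  show "W v = ?Q"
  proof (rule pmf_eqI)
    fix a show "pmf (W v) a = pmf ?Q a"
    proof (cases "a \<in> set_pmf (W v) \<union> set_pmf ?Q")
      case False
      then have "a \<notin> set_pmf (W v)" "a \<notin> set_pmf ?Q" by blast+
      then show ?thesis by (simp only: set_pmf_iff not_not)
    qed (use eq in blast)
  qed
qed

text \<open>A pair \<open>(v, x)\<close> moves through \<open>n\<close> uses of the channel independently, so exponential moments of the
  information density are \<open>n\<close>-th powers.\<close>

lemma density_moment:
  assumes fin: "finite (set_pmf p)" "\<And>v. finite (set_pmf (W v))"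
  shows "ex (replicate_pmf n p) (\<lambda>vs. ex (dmc W vs)
      (\<lambda>xs. (pmf (dmc V (map f vs)) xs / pmf (replicate_pmf n Q) xs) powr s))
    = (ex p (\<lambda>v. ex (W v) (\<lambda>x. (pmf (V (f v)) x / pmf Q x) powr s))) ^ n"
proof -
  \<comment> \<open>With \<open>length xs\<close> in place of n the integrand satisfies the
    recursion that \<open>ex_multiplicative\<close> asks for.\<close>
  let ?F = "\<lambda>vs xs. (pmf (dmc V (map f vs)) xs / pmf (replicate_pmf (length xs) Q) xs) powr s"
  have "ex (replicate_pmf n p) (\<lambda>vs. ex (dmc W vs)
      (\<lambda>xs. (pmf (dmc V (map f vs)) xs / pmf (replicate_pmf n Q) xs) powr s))
    = ex (replicate_pmf n p) (\<lambda>vs. ex (dmc W vs) (?F vs))"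
    by (intro ex_cong refl) (simp add: length_dmc set_replicate_pmf)
  also have "\<dots> = (ex p (\<lambda>v. ex (W v) (\<lambda>x. (pmf (V (f v)) x / pmf Q x) powr s))) ^ n"
  proof (rule ex_multiplicative[OF fin])
    fix v vs x xs
    show "?F (v # vs) (x # xs) = (pmf (V (f v)) x / pmf Q x) powr s * ?F vs xs"
      unfolding list.map list.size(4) add_Suc_right add_0_right One_nat_def pmf_dmc_Cons pmf_replicate_Cons
      by (simp add: powr_mult[symmetric])
  qed simp
  finally show ?thesis .
qed

subsection \<open>Block codes\<close>

lemma ex_dmc_nth:
  assumes "\<And>v. finite (set_pmf (W v))" "t < length vs"
  shows "ex (dmc W vs) (\<lambda>xs. h (xs ! t)) = ex (W (vs ! t)) h"
  using map_nth_dmc[OF assms(2), of W] ex_map[OF finite_dmc[of W vs], of "\<lambda>xs. xs ! t" h] assms(1) by simp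

lemma dmc_const:
  assumes "\<And>v. v \<in> set vs \<Longrightarrow> W v = Q" shows "dmc W vs = replicate_pmf (length vs) Q"
  using assms by (induction vs) (auto simp: map_pmf_def)

text \<open>Parallel memoryless channels followed by a letterwise function are again memoryless; the
  proof only reorders independent draws.\<close>

lemma dmc_select:
  "map_pmf (\<lambda>(xs, ys, zs). map g (zip xs (zip ys zs))) (pair_pmf (dmc a vs) (pair_pmf (dmc b vs) (dmc c (map f vs))))
    = dmc (\<lambda>v. map_pmf g (pair_pmf (a v) (pair_pmf (b v) (c (f v))))) vs"
proof (induction vs)
  case (Cons v vs)
  let ?A = "dmc a vs" and ?B = "dmc b vs" and ?C = "dmc c (map f vs)"
  let ?h = "\<lambda>x y z xs ys zs. return_pmf (g (x, y, z) # map g (zip xs (zip ys zs)))"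
  have "map_pmf (\<lambda>(xs, ys, zs). map g (zip xs (zip ys zs))) (pair_pmf (dmc a (v # vs)) (pair_pmf (dmc b (v # vs)) (dmc c (map f (v # vs)))))
    = bind_pmf (a v) (\<lambda>x. bind_pmf ?A (\<lambda>xs. bind_pmf (b v) (\<lambda>y. bind_pmf ?B (\<lambda>ys. bind_pmf (c (f v)) (\<lambda>z. bind_pmf ?C (?h x y z xs ys))))))"
    by (simp add: pair_pmf_def map_pmf_def bind_assoc_pmf bind_return_pmf)
  also have "\<dots> = bind_pmf (a v) (\<lambda>x. bind_pmf (b v) (\<lambda>y. bind_pmf ?A (\<lambda>xs. bind_pmf (c (f v)) (\<lambda>z. bind_pmf ?B (\<lambda>ys. bind_pmf ?C (?h x y z xs ys))))))"
    by (intro bind_pmf_cong refl) (subst bind_commute_pmf[of ?A "b v"], intro bind_pmf_cong refl bind_commute_pmf)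
  also have "\<dots> = bind_pmf (a v) (\<lambda>x. bind_pmf (b v) (\<lambda>y. bind_pmf (c (f v)) (\<lambda>z. bind_pmf ?A (\<lambda>xs. bind_pmf ?B (\<lambda>ys. bind_pmf ?C (?h x y z xs ys))))))"
    by (intro bind_pmf_cong refl bind_commute_pmf)
  also have "\<dots> = bind_pmf (a v) (\<lambda>x. bind_pmf (b v) (\<lambda>y. bind_pmf (c (f v)) (\<lambda>z. map_pmf ((#) (g (x, y, z)))
      (map_pmf (\<lambda>(xs, ys, zs). map g (zip xs (zip ys zs))) (pair_pmf ?A (pair_pmf ?B ?C))))))"
    by (simp add: pair_pmf_def map_pmf_def bind_assoc_pmf bind_return_pmf)
  also have "\<dots> = dmc (\<lambda>v. map_pmf g (pair_pmf (a v) (pair_pmf (b v) (c (f v))))) (v # vs)"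
    unfolding Cons by (simp add: pair_pmf_def map_pmf_def bind_assoc_pmf bind_return_pmf)
  finally show ?case .
qed simp

locale nletter = kernels P2 P1 a b c f
  for P2 :: "nat pmf" and P1 :: "nat \<Rightarrow> nat pmf"
    and a :: "nat \<Rightarrow> 'x::finite pmf" and b :: "nat \<Rightarrow> 'y::finite pmf" and c :: "nat \<Rightarrow> 'z::finite pmf"
    and f :: "nat \<Rightarrow> nat" +
  fixes R0 R1 R2 :: real and n :: nat
  assumes R: "0 \<le> R0" "0 \<le> R1" "0 \<le> R2" and n: "1 \<le> n"
begin

definition "Pv = bind_pmf P2 P1"
definition "QX = bind_pmf Pv a"
definition "A2 u = bind_pmf (P1 u) a"
definition "N12 = nat \<lfloor>2 powr (real n * R1)\<rfloor>"
text \<open>M1 carries both indices, so there are at most as many clouds as values of M1. The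
  integer division in \<open>N1\<close> then loses at most a factor 2.\<close>

definition "N2 = min N12 (nat \<lfloor>2 powr (real n * R2)\<rfloor>)"
definition "N1 = N12 div N2"
definition "KS = index_set (2 powr (real n * R0))"

lemma floor_powr:
  assumes "0 \<le> r"
  shows "1 \<le> nat \<lfloor>(2::real) powr r\<rfloor>" "2 powr r / 2 \<le> real (nat \<lfloor>(2::real) powr r\<rfloor>)"
proof -
  have 1: "1 \<le> (2::real) powr r" using assms by (simp add: ge_one_powr_ge_zero)
  then have f: "1 \<le> \<lfloor>(2::real) powr r\<rfloor>" by simp
  have "1 \<le> nat z" if "1 \<le> z" for z :: int using that by simp
  from this[OF f] show "1 \<le> nat \<lfloor>(2::real) powr r\<rfloor>" .
  have e: "real (nat z) = real_of_int z" if "1 \<le> z" for z :: int using that by simp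
  have "2 powr r < real_of_int \<lfloor>(2::real) powr r\<rfloor> + 1" by linarith
  moreover have "1 \<le> real_of_int \<lfloor>(2::real) powr r\<rfloor>" using f by (simp only: of_int_1_le_iff)
  ultimately show "2 powr r / 2 \<le> real (nat \<lfloor>(2::real) powr r\<rfloor>)" unfolding e[OF f] by linarith
qed

lemma N12: "1 \<le> N12" "2 powr (n * R1) / 2 \<le> real N12"
  unfolding N12_def using floor_powr[of "n * R1"] R by auto

lemma N2: "1 \<le> N2" "2 powr (n * min R1 R2) / 2 \<le> real N2"
proof -
  show "1 \<le> N2" unfolding N2_def using floor_powr[of "n * R2"] R N12 by auto
  have "2 powr (n * min R1 R2) / 2 \<le> real N12"
    by (rule order_trans[OF _ N12(2)]) (auto intro!: divide_right_mono powr_mono mult_left_mono)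
  moreover have "2 powr (n * min R1 R2) / 2 \<le> real (nat \<lfloor>2 powr (real n * R2)\<rfloor>)"
    by (rule order_trans[OF _ floor_powr(2)]) (use R in \<open>auto intro!: divide_right_mono powr_mono mult_left_mono\<close>)
  ultimately show "2 powr (n * min R1 R2) / 2 \<le> real N2"
    unfolding N2_def of_nat_min by (rule min.boundedI)
qed

lemma N1: "1 \<le> N1" "N2 * N1 \<le> N12" "2 powr (n * R1) / 4 \<le> real N2 * real N1"
proof -
  have le: "N2 \<le> N12" by (simp add: N2_def)
  show 1: "1 \<le> N1" unfolding N1_def using le N2(1) by (simp add: Suc_le_eq div_greater_zero_iff)
  show "N2 * N1 \<le> N12" unfolding N1_def by simp
  have "N12 < N2 * N1 + N2" unfolding N1_def
    using N2(1) by (metis add.commute less_le_trans mod_less_divisor mult_div_mod_eq nat_add_left_cancel_less zero_less_one)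
  also have "\<dots> \<le> N2 * N1 + N2 * N1" using 1 by simp
  finally have "real N12 \<le> 2 * (real N2 * real N1)" by (simp flip: of_nat_mult)
  then show "2 powr (n * R1) / 4 \<le> real N2 * real N1" using N12(2) by linarith
qed

lemma KS: "finite KS" "KS \<noteq> {}" "2 powr (n * R0) / 2 \<le> real (card KS)"
  unfolding KS_def card_index_set using floor_powr[of "n * R0"] R
  by (auto intro!: index_set_nonempty ge_one_powr_ge_zero)

lemma finPv [simp]: "finite (set_pmf Pv)" by (simp add: Pv_def)

sublocale os: oneshot "replicate_pmf n P2" "dmc P1" "map f" KS N2 N1 "dmc a" "dmc b" "dmc c"
proof
  show "map f vs = us" if "us \<in> set_pmf (replicate_pmf n P2)" "vs \<in> set_pmf (dmc P1 us)" for us vs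
    using that by (auto simp: set_replicate_pmf set_dmc list_all2_conv_all_nth sep intro!: nth_equalityI)
qed (use N1 N2 KS in \<open>auto simp: finite_dmc\<close>)

lemma os_P: "os.P = replicate_pmf n Pv"
  unfolding os.P_def Pv_def by (rule bind_replicate_dmc)

lemma os_PX: "os.PX = replicate_pmf n QX"
  unfolding os.PX_def os_P QX_def by (rule bind_replicate_dmc)

lemma a_subset: "v \<in> set_pmf Pv \<Longrightarrow> set_pmf (a v) \<subseteq> set_pmf QX" "v \<in> set_pmf Pv \<Longrightarrow> set_pmf (a v) \<subseteq> set_pmf (A2 (f v))"
  using sep by (auto simp: QX_def A2_def Pv_def)

lemma dmc_mono:
  assumes "xs \<in> set_pmf (dmc W vs)" "\<And>v. v \<in> set vs \<Longrightarrow> set_pmf (W v) \<subseteq> set_pmf (V v)"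
  shows "xs \<in> set_pmf (dmc V vs)"
  using assms(1) unfolding set_dmc by (auto simp: list_all2_conv_all_nth intro!: subsetD[OF assms(2)])

lemma dmc_map: "dmc W (map g vs) = dmc (\<lambda>v. W (g v)) vs"
  by (induction vs) auto

text \<open>The indicators \<open>e1\<close> and \<open>e2\<close> drop the contribution of an auxiliary variable that is independent of \<open>X\<close>;
  this is what allows zero rates.\<close>

lemma resolvability_bound:
  fixes e1 e2 s :: real
  assumes s: "0 < s" "s \<le> 1" and e: "e1 \<in> {0, 1}" "e2 \<in> {0, 1}"
    and e1: "e1 = 0 \<Longrightarrow> e2 = 0 \<and> (\<forall>v\<in>set_pmf Pv. a v = QX)"
    and e2: "e2 = 0 \<Longrightarrow> (\<forall>v\<in>set_pmf Pv. A2 (f v) = QX)"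
  shows "ex os.P (\<lambda>vs. ex (dmc a vs) (\<lambda>xs. log 2 (os.mean_X (dmc a) xs vs) - log 2 (pmf os.PX xs)))
    \<le> (e1 * (ex Pv (\<lambda>v. ex (a v) (\<lambda>x. (pmf (a v) x / pmf QX x) powr s))) ^ n / (real N2 * real N1) powr s
       + e2 * (ex Pv (\<lambda>v. ex (a v) (\<lambda>x. (pmf (A2 (f v)) x / pmf QX x) powr s))) ^ n / real N2 powr s) / (s * ln 2)"
proof -
  let ?N = "real N2 * real N1"
  let ?W = "\<lambda>vs xs. pmf (dmc a vs) xs" and ?V = "\<lambda>vs xs. pmf (dmc A2 (map f vs)) xs" and ?Q = "\<lambda>xs. pmf (replicate_pmf n QX) xs"
  have N: "0 < real N2" "0 < real N1" "0 < ?N" using N1 N2 by auto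
  have "ex os.P (\<lambda>vs. ex (dmc a vs) (\<lambda>xs. log 2 (os.mean_X (dmc a) xs vs) - log 2 (pmf os.PX xs)))
    \<le> ex (replicate_pmf n Pv) (\<lambda>vs. ex (dmc a vs) (\<lambda>xs. (e1 / ?N powr s * (?W vs xs / ?Q xs) powr s + e2 / real N2 powr s * (?V vs xs / ?Q xs) powr s) / (s * ln 2)))"
    unfolding os_P os_PX
  proof (intro ex_mono)
    fix vs xs assume vs: "vs \<in> set_pmf (replicate_pmf n Pv)" and xs: "xs \<in> set_pmf (dmc a vs)"
    have len: "length vs = n" and vsP: "\<And>v. v \<in> set vs \<Longrightarrow> v \<in> set_pmf Pv"
      using vs by (auto simp: set_replicate_pmf)
    have q_eq: "replicate_pmf n QX = dmc (\<lambda>_. QX) vs" using dmc_const[of vs "\<lambda>_. QX" QX] len by simp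
    have W: "0 < ?W vs xs" using xs by (rule pmf_positive)
    have Q: "0 < ?Q xs" unfolding q_eq
      by (rule pmf_positive, rule dmc_mono[OF xs]) (use a_subset(1) vsP in blast)
    have V: "0 < ?V vs xs" unfolding dmc_map
      by (rule pmf_positive, rule dmc_mono[OF xs]) (use a_subset(2) vsP in blast)
    define w where "w = ?W vs xs / ?Q xs"
    define v where "v = ?V vs xs / ?Q xs"
    have wv: "0 < w" "0 < v" using W Q V by (auto simp: w_def v_def)
    have m: "os.mean_X (dmc a) xs vs = (?W vs xs + (real N1 - 1) * ?V vs xs + (real N2 - 1) * real N1 * ?Q xs) / ?N"
      unfolding os.mean_X_def os_P bind_dmc_dmc bind_replicate_dmc QX_def A2_def[abs_def] by simp
    have ratio: "os.mean_X (dmc a) xs vs / ?Q xs = (w + (real N1 - 1) * v + (real N2 - 1) * real N1) / ?N"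
    proof -
      have gen: "(x + k * y + l * q) / m / q = (x / q + k * (y / q) + l) / m" if "m \<noteq> 0" "q \<noteq> 0" for x y k l m q :: real
        using that by (simp add: field_simps)
      show ?thesis unfolding m w_def v_def by (rule gen) (use N Q in auto)
    qed
    have v1: "v = 1" if "e2 = 0"
    proof -
      have "dmc A2 (map f vs) = dmc (\<lambda>_. QX) vs"
        unfolding dmc_map using e2[OF that] vsP dmc_const[of vs "\<lambda>v. A2 (f v)" QX] len by (simp add: q_eq[symmetric])
      then show ?thesis using Q by (simp add: v_def q_eq)
    qed
    have w1: "w = 1" if "e1 = 0"
    proof -
      have "dmc a vs = dmc (\<lambda>_. QX) vs"
        using e1[OF that] vsP dmc_const[of vs a QX] len by (simp add: q_eq[symmetric])
      then show ?thesis using Q by (simp add: w_def q_eq)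
    qed
    \<comment> \<open>The main term 1 accounts for the other clouds. A ratio that is identically 1
      merges into it, which is why its own term may carry the coefficient 0.\<close>
    have "(w + (real N1 - 1) * v + (real N2 - 1) * real N1) / ?N \<le> 1 + (e1 * (w / ?N) + e2 * (v / real N2))"
    proof -
      have "w + (real N1 - 1) * v + (real N2 - 1) * real N1 \<le> ?N + e1 * w + e2 * (v * real N1)"
      proof (cases "e2 = 0")
        case True
        then have "v = 1" by (rule v1)
        show ?thesis
        proof (cases "e1 = 0")
          case True
          then have "w = 1" by (rule w1)
          then show ?thesis using \<open>v = 1\<close> \<open>e2 = 0\<close> True by (simp add: algebra_simps)
        next
          case False
          then have "e1 = 1" using e by simp
          then show ?thesis using \<open>v = 1\<close> \<open>e2 = 0\<close> by (simp add: algebra_simps)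
        qed
      next
        case False
        then have "e2 = 1" "e1 = 1" using e e1 by auto
        then show ?thesis using wv N by (simp add: algebra_simps)
      qed
      then have "(w + (real N1 - 1) * v + (real N2 - 1) * real N1) / ?N \<le> (?N + e1 * w + e2 * (v * real N1)) / ?N"
        using N by (intro divide_right_mono) auto
      also have "\<dots> = 1 + (e1 * (w / ?N) + e2 * (v / real N2))"
        using N by (simp add: add_divide_distrib)
      finally show ?thesis .
    qed
    then have le: "os.mean_X (dmc a) xs vs / ?Q xs \<le> 1 + (e1 * (w / ?N) + e2 * (v / real N2))" unfolding ratio .
    have mp: "0 < os.mean_X (dmc a) xs vs" by (rule os.mean_X_pos[where W="dmc a", OF xs])
    have z: "0 \<le> e1 * (w / ?N)" "0 \<le> e2 * (v / real N2)" using e wv N by auto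
    have "log 2 (os.mean_X (dmc a) xs vs) - log 2 (?Q xs) = log 2 (os.mean_X (dmc a) xs vs / ?Q xs)"
      using mp Q by (simp add: log_divide)
    also have "\<dots> \<le> log 2 (1 + (e1 * (w / ?N) + e2 * (v / real N2)))"
      using mp Q le by (intro log_mono) auto
    also have "\<dots> \<le> (e1 * (w / ?N) + e2 * (v / real N2)) powr s / (s * ln 2)"
      using z s by (intro log_one_plus_le_moment) auto
    \<comment> \<open>Subadditivity of the s-th power separates two ratios whose moments are n-th
      powers.\<close>
    also have "\<dots> \<le> ((e1 * (w / ?N)) powr s + (e2 * (v / real N2)) powr s) / (s * ln 2)"
      using z s by (intro divide_right_mono powr_add_le) auto
    also have "\<dots> = (e1 / ?N powr s * w powr s + e2 / real N2 powr s * v powr s) / (s * ln 2)"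
      using e wv N by (auto simp: powr_divide)
    finally show "log 2 (os.mean_X (dmc a) xs vs) - log 2 (?Q xs)
      \<le> (e1 / ?N powr s * (?W vs xs / ?Q xs) powr s + e2 / real N2 powr s * (?V vs xs / ?Q xs) powr s) / (s * ln 2)"
      by (simp add: w_def v_def)
  qed
  also have "\<dots> = (e1 / ?N powr s * ex (replicate_pmf n Pv) (\<lambda>vs. ex (dmc a vs) (\<lambda>xs. (pmf (dmc a (map (\<lambda>v. v) vs)) xs / ?Q xs) powr s))
      + e2 / real N2 powr s * ex (replicate_pmf n Pv) (\<lambda>vs. ex (dmc a vs) (\<lambda>xs. (?V vs xs / ?Q xs) powr s))) / (s * ln 2)"
    by (simp only: ex_divide ex_add ex_cmult list.map_ident)
  also have "\<dots> = (e1 * (ex Pv (\<lambda>v. ex (a v) (\<lambda>x. (pmf (a v) x / pmf QX x) powr s))) ^ n / ?N powr s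
       + e2 * (ex Pv (\<lambda>v. ex (a v) (\<lambda>x. (pmf (A2 (f v)) x / pmf QX x) powr s))) ^ n / real N2 powr s) / (s * ln 2)"
    by (subst (1 2) density_moment) simp_all
  finally show ?thesis .
qed

definition sel_list :: "signal set \<Rightarrow> 'x list \<Rightarrow> 'y list \<Rightarrow> 'z list \<Rightarrow> ('x option \<times> 'y option \<times> 'z option) list" where
  "sel_list S xs ys zs = map (sel3 S) (zip xs (zip ys zs))"

definition "WS S v = map_pmf (sel3 S) (pair_pmf (a v) (pair_pmf (b v) (c (f v))))"
definition "QS S = bind_pmf Pv (WS S)"

lemma sel_kernel_dmc: "os.sel_kernel (sel_list S) = dmc (WS S)"
  unfolding os.sel_kernel_def[abs_def] sel_list_def WS_def[abs_def] by (intro ext dmc_select)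

text \<open>\<open>mean_S\<close> is at most the i.i.d. law times 1 + ratio /
  \<open>card KS\<close>. Jensen brings the expectation under the logarithm, where the s-th moment
  of the ratio is an n-th power.\<close>

lemma secrecy_bound:
  fixes s :: real
  assumes s: "0 < s" "s \<le> 1"
  shows "n * Hp (QS S) - log 2 (1 + (ex Pv (\<lambda>v. ex (WS S v) (\<lambda>x. (pmf (WS S v) x / pmf (QS S) x) powr s))) ^ n / real (card KS) powr s) / s
    \<le> - ex os.P (\<lambda>vs. ex (os.sel_kernel (sel_list S) vs) (\<lambda>l. log 2 (os.mean_S (os.sel_kernel (sel_list S)) l vs)))"
proof -
  let ?N = "real (card KS)"
  let ?R = "replicate_pmf n Pv" and ?D = "dmc (WS S)"
  let ?W = "\<lambda>vs l. pmf (?D vs) l" and ?Q = "\<lambda>l. pmf (replicate_pmf n (QS S)) l"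
  have N: "0 < ?N" using KS by (simp add: card_gt_0_iff)
  have finD: "finite (set_pmf (?D vs))" for vs by (rule finite_dmc) simp
  have "ex ?R (\<lambda>vs. ex (?D vs) (\<lambda>l. log 2 (os.mean_S ?D l vs)))
    \<le> ex ?R (\<lambda>vs. ex (?D vs) (\<lambda>l. - (- log 2 (?Q l)) + log 2 (1 + (?W vs l / ?Q l) powr s / ?N powr s) / s))"
  proof (intro ex_mono)
    fix vs l assume vs: "vs \<in> set_pmf ?R" and l: "l \<in> set_pmf (?D vs)"
    have len: "length vs = n" and vsP: "\<And>v. v \<in> set vs \<Longrightarrow> v \<in> set_pmf Pv"
      using vs by (auto simp: set_replicate_pmf)
    have q_eq: "replicate_pmf n (QS S) = dmc (\<lambda>_. QS S) vs" using dmc_const[of vs "\<lambda>_. QS S" "QS S"] len by simp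
    have W: "0 < ?W vs l" using l by (rule pmf_positive)
    have Q: "0 < ?Q l" unfolding q_eq
      by (rule pmf_positive, rule dmc_mono[OF l]) (use vsP in \<open>auto simp: QS_def\<close>)
    have "os.mean_S ?D l vs = (?W vs l + (?N - 1) * ?Q l) / ?N"
      unfolding os.mean_S_def os_P bind_replicate_dmc QS_def ..
    also have "\<dots> \<le> (?W vs l + ?N * ?Q l) / ?N"
      using N Q by (intro divide_right_mono) (auto simp: algebra_simps)
    also have "\<dots> = ?Q l * (1 + ?W vs l / ?Q l / ?N)"
    proof -
      have gen: "(w + m * q) / m = q * (1 + w / q / m)" if "m \<noteq> 0" "q \<noteq> 0" for w m q :: real
        using that by (simp add: field_simps)
      show ?thesis by (rule gen) (use N Q in auto)
    qed
    finally have le: "os.mean_S ?D l vs \<le> ?Q l * (1 + ?W vs l / ?Q l / ?N)" .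
    have z: "0 \<le> ?W vs l / ?Q l / ?N" using W Q N by simp
    then have p1: "0 < 1 + ?W vs l / ?Q l / ?N" by linarith
    have "log 2 (os.mean_S ?D l vs) \<le> log 2 (?Q l * (1 + ?W vs l / ?Q l / ?N))"
      using le os.mean_S_pos[where W="?D", OF l] by (intro log_mono) auto
    also have "\<dots> = log 2 (?Q l) + log 2 (1 + ?W vs l / ?Q l / ?N)" using Q p1 by (simp add: log_mult)
    also have "log 2 (1 + ?W vs l / ?Q l / ?N) \<le> log 2 (1 + (?W vs l / ?Q l / ?N) powr s) / s"
      by (rule log_one_plus_le[OF z s])
    also have "(?W vs l / ?Q l / ?N) powr s = (?W vs l / ?Q l) powr s / ?N powr s"
      using W Q N by (simp add: powr_divide powr_mult)
    finally show "log 2 (os.mean_S ?D l vs) \<le> - (- log 2 (?Q l)) + log 2 (1 + (?W vs l / ?Q l) powr s / ?N powr s) / s" by simp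
  qed
  also have "\<dots> = - ex ?R (\<lambda>vs. ex (?D vs) (\<lambda>l. - log 2 (?Q l)))
     + ex ?R (\<lambda>vs. ex (?D vs) (\<lambda>l. log 2 (1 + (?W vs l / ?Q l) powr s / ?N powr s))) / s"
    by (simp only: ex_add ex_minus ex_divide)
  also have "ex ?R (\<lambda>vs. ex (?D vs) (\<lambda>l. - log 2 (?Q l))) = n * Hp (QS S)"
    unfolding QS_def by (rule ex_dmc_log) auto
  also have "ex ?R (\<lambda>vs. ex (?D vs) (\<lambda>l. log 2 (1 + (?W vs l / ?Q l) powr s / ?N powr s)))
     \<le> log 2 (1 + (ex Pv (\<lambda>v. ex (WS S v) (\<lambda>x. (pmf (WS S v) x / pmf (QS S) x) powr s))) ^ n / ?N powr s)"
  proof -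
    let ?J = "bind_pmf ?R (\<lambda>vs. map_pmf (Pair vs) (?D vs))"
    let ?g = "\<lambda>(vs, l). 1 + (?W vs l / ?Q l) powr s / ?N powr s"
    have J: "ex ?J h = ex ?R (\<lambda>vs. ex (?D vs) (\<lambda>l. h (vs, l)))" for h
      using finD by (simp add: ex_bind ex_map)
    have finJ: "finite (set_pmf ?J)" using finD by auto
    have "ex ?J (\<lambda>w. log 2 (?g w)) \<le> log 2 (ex ?J ?g)"
      by (rule log2_ex_jensen[OF finJ]) auto
    also have "ex ?J ?g = 1 + ex ?R (\<lambda>vs. ex (?D vs) (\<lambda>l. (pmf (dmc (WS S) (map (\<lambda>v. v) vs)) l / ?Q l) powr s)) / ?N powr s"
      using finD by (simp add: J ex_add ex_const ex_divide)
    also have "\<dots> = 1 + (ex Pv (\<lambda>v. ex (WS S v) (\<lambda>x. (pmf (WS S v) x / pmf (QS S) x) powr s))) ^ n / ?N powr s"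
      by (subst density_moment) simp_all
    finally show ?thesis by (simp add: J)
  qed
  finally show ?thesis
    unfolding os_P sel_kernel_dmc using s by (simp add: divide_right_mono)
qed

definition letter_dist :: "('x \<Rightarrow> 'y \<Rightarrow> 'z \<Rightarrow> real) \<Rightarrow> nat \<Rightarrow> real" where
  "letter_dist d v = ex (a v) (\<lambda>x. ex (b v) (\<lambda>y. ex (c (f v)) (\<lambda>z. d x y z)))"

definition block_dist :: "('x \<Rightarrow> 'y \<Rightarrow> 'z \<Rightarrow> real) \<Rightarrow> 'x list \<Rightarrow> 'y list \<Rightarrow> 'z list \<Rightarrow> real" where
  "block_dist d xs ys zs = (1 / real n) * (\<Sum>t<n. d (xs ! t) (ys ! t) (zs ! t))"

lemma mean_dist_block:
  assumes "length vs = n"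
  shows "os.mean_dist (block_dist d) vs = (1 / n) * (\<Sum>t<n. letter_dist d (vs ! t))"
proof -
  have "ex (dmc a vs) (\<lambda>xs. ex (dmc b vs) (\<lambda>ys. ex (dmc c (map f vs)) (\<lambda>zs. d (xs ! t) (ys ! t) (zs ! t)))) = letter_dist d (vs ! t)"
    if t: "t < n" for t
  proof -
    have 1: "ex (dmc c (map f vs)) (\<lambda>zs. d x y (zs ! t)) = ex (c (f (vs ! t))) (\<lambda>z. d x y z)" for x y
      using ex_dmc_nth[of c t "map f vs" "d x y"] assms t by simp
    have 2: "ex (dmc b vs) (\<lambda>ys. ex (c (f (vs ! t))) (\<lambda>z. d x (ys ! t) z)) = ex (b (vs ! t)) (\<lambda>y. ex (c (f (vs ! t))) (\<lambda>z. d x y z))" for x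
      using ex_dmc_nth[of b t vs "\<lambda>y. ex (c (f (vs ! t))) (\<lambda>z. d x y z)"] assms t by simp
    show ?thesis
      unfolding 1 2 letter_dist_def
      using ex_dmc_nth[of a t vs "\<lambda>x. ex (b (vs ! t)) (\<lambda>y. ex (c (f (vs ! t))) (\<lambda>z. d x y z))"] assms t by simp
  qed
  then show ?thesis
    unfolding os.mean_dist_def block_dist_def ex_cmult ex_sum by simp
qed

lemma ex_mean_dist: "ex os.P (os.mean_dist (block_dist d)) = ex Pv (letter_dist d)"
proof -
  have "ex os.P (os.mean_dist (block_dist d)) = ex (replicate_pmf n Pv) (\<lambda>vs. (1 / n) * (\<Sum>t<n. letter_dist d (vs ! t)))"
    unfolding os_P by (intro ex_cong refl mean_dist_block) (simp add: set_replicate_pmf)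
  then show ?thesis unfolding ex_cmult using n by (simp add: ex_replicate_sum)
qed

text \<open>The variance of an average of n independent letters.\<close>

lemma ex_dev_block:
  "ex os.P (\<lambda>vs. (os.mean_dist (block_dist d) vs - ex os.P (os.mean_dist (block_dist d)))\<^sup>2)
    = ex Pv (\<lambda>v. (letter_dist d v - ex Pv (letter_dist d))\<^sup>2) / n"
proof -
  let ?m = "ex Pv (letter_dist d)"
  let ?h = "\<lambda>v. letter_dist d v - ?m"
  have "ex os.P (\<lambda>vs. (os.mean_dist (block_dist d) vs - ex os.P (os.mean_dist (block_dist d)))\<^sup>2)
    = ex (replicate_pmf n Pv) (\<lambda>vs. (1 / n)\<^sup>2 * (\<Sum>t<n. ?h (vs ! t))\<^sup>2)"
    unfolding ex_mean_dist unfolding os_P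
  proof (intro ex_cong refl)
    fix vs assume "vs \<in> set_pmf (replicate_pmf n Pv)"
    then have "os.mean_dist (block_dist d) vs - ?m = (1 / n) * (\<Sum>t<n. ?h (vs ! t))"
      using n by (simp add: mean_dist_block set_replicate_pmf sum_subtractf diff_divide_distrib)
    then show "(os.mean_dist (block_dist d) vs - ?m)\<^sup>2 = (1 / n)\<^sup>2 * (\<Sum>t<n. ?h (vs ! t))\<^sup>2"
      by (simp only: power_mult_distrib)
  qed
  also have "\<dots> = (1 / n)\<^sup>2 * (n * ex Pv (\<lambda>v. (?h v)\<^sup>2))"
    unfolding ex_cmult by (subst ex_replicate_sum_square) (simp_all add: ex_diff ex_const)
  finally show ?thesis using n by (simp add: power2_eq_square)
qed

end

section \<open>From codebooks to block systems\<close>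

context nletter
begin

text \<open>\<open>index_set\<close> starts at 1, hence the increments. Division of M1 - 1 by
  \<open>N1\<close> returns the cloud index and the satellite index.\<close>

definition to_block :: "'x list \<times> nat \<times> (nat \<times> nat) \<times> 'y list \<times> 'z list \<Rightarrow> ('x, 'y, 'z) block" where
  "to_block = (\<lambda>(x, k, \<omega>, y, z). Block x k (fst \<omega> * N1 + snd \<omega> + 1) (fst \<omega> + 1) y z)"

definition "block_sys bk = map_pmf to_block (os.sys bk)"

context
  fixes bk assumes bk: "bk \<in> set_pmf os.codebook"
begin

lemma fin_block_sys: "finite (set_pmf (block_sys bk))" by (simp add: block_sys_def)

lemma sys_elem:
  assumes "(x, k, \<omega>, y, z) \<in> set_pmf (os.sys bk)"
  shows "fst \<omega> < N2" "snd \<omega> < N1" "length x = n" "length y = n" "length z = n"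
proof -
  note s = os.sys_supp[OF bk assms]
  show "fst \<omega> < N2" "snd \<omega> < N1" using s(1) by (auto simp: os.\<Omega>_def)
  show "length x = n" using s(3) by (simp add: os_PX set_replicate_pmf)
  show "length y = n" "length z = n"
    using s(2) by (auto simp: os_P set_replicate_pmf dest!: length_dmc)
qed

lemma msg1_range:
  assumes "i < N2" "j < N1" shows "i * N1 + j + 1 \<le> N12" "(i * N1 + j) div N1 = i" "(i * N1 + j) mod N1 = j"
proof -
  have "i * N1 + j + 1 \<le> i * N1 + N1" using assms by simp
  also have "\<dots> = (i + 1) * N1" by simp
  also have "\<dots> \<le> N2 * N1" using assms by (intro mult_right_mono) auto
  finally show "i * N1 + j + 1 \<le> N12" using N1(2) by linarith
qed (use assms in auto)

lemma block_sys_valid: "valid_system R0 R1 R2 QX n (block_sys bk)"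
proof -
  have xk: "map_pmf (\<lambda>w. (srcs w, key w)) (block_sys bk) = pair_pmf (replicate_pmf n QX) (pmf_of_set (index_set (2 powr (real n * R0))))"
  proof -
    have "map_pmf (\<lambda>w. (srcs w, key w)) (block_sys bk) = map_pmf (\<lambda>(x, k, \<omega>, y, z). (x, k)) (os.sys bk)"
      by (simp add: block_sys_def pmf.map_comp o_def to_block_def case_prod_unfold)
    also have "\<dots> = pair_pmf (replicate_pmf n QX) (pmf_of_set KS)"
      unfolding os.sys_xk os.pxk_def os_PX ..
    finally show ?thesis unfolding KS_def .
  qed
  have rng: "msg1 w \<in> index_set (2 powr (real n * R1)) \<and> msg2 w \<in> index_set (2 powr (real n * R2)) \<and>
        length (recs2 w) = n \<and> length (recs3 w) = n" if w: "w \<in> set_pmf (block_sys bk)" for w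
  proof -
    obtain x k \<omega> y z where e: "(x, k, \<omega>, y, z) \<in> set_pmf (os.sys bk)" and w: "w = to_block (x, k, \<omega>, y, z)"
      using w by (auto simp: block_sys_def)
    note s = sys_elem[OF e]
    have "fst \<omega> * N1 + snd \<omega> + 1 \<le> N12" by (rule msg1_range[OF s(1,2)])
    moreover have "fst \<omega> + 1 \<le> nat \<lfloor>2 powr (real n * R2)\<rfloor>" using s(1) by (simp add: N2_def)
    ultimately show ?thesis using s by (simp add: w to_block_def index_set_def N12_def)
  qed
  have m1: "markov_chain (block_sys bk) srcs (\<lambda>w. (msg1 w, key w)) (\<lambda>w. (msg2 w, recs2 w))"
  proof -
    let ?B = "\<lambda>(x, k, \<omega>, y, z). (\<omega> :: nat \<times> nat, k :: nat)"
    let ?e = "\<lambda>(\<omega>, k :: nat). (fst \<omega> * N1 + snd \<omega> + 1, k)"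
    \<comment> \<open>The numbering of index pairs is injective only while the second index stays
      below \<open>N1\<close>.\<close>
    have "inj_on ?e (?B ` set_pmf (os.sys bk))"
    proof (rule inj_onI)
      fix p q assume p: "p \<in> ?B ` set_pmf (os.sys bk)" and q: "q \<in> ?B ` set_pmf (os.sys bk)" and eq: "?e p = ?e q"
      obtain \<omega> k \<omega>' k' where pq: "p = (\<omega>, k)" "q = (\<omega>', k')" by (metis surj_pair)
      have r: "fst \<omega> < N2" "snd \<omega> < N1" "fst \<omega>' < N2" "snd \<omega>' < N1" using p q pq sys_elem(1,2) by fastforce+
      have "fst \<omega> * N1 + snd \<omega> = fst \<omega>' * N1 + snd \<omega>'" using eq pq by simp
      then have "fst \<omega> = fst \<omega>'" "snd \<omega> = snd \<omega>'" using msg1_range(2,3)[OF r(1,2)] msg1_range(2,3)[OF r(3,4)] by metis+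
      then show "p = q" using eq pq by (simp add: prod_eq_iff)
    qed
    from markov_chain_fun_on[OF os.fin_sys os.sys_markov1 this, of "\<lambda>a _. a" "\<lambda>c _. (fst c + 1, snd c)"]
    show ?thesis by (simp add: block_sys_def markov_chain_map to_block_def case_prod_unfold)
  qed
  have m2: "markov_chain (block_sys bk) (\<lambda>w. (srcs w, msg1 w, recs2 w)) (\<lambda>w. (msg2 w, key w)) recs3"
  proof -
    have inj: "inj (\<lambda>(i :: nat, k :: nat). (i + 1, k))" by (auto simp: inj_def)
    from markov_chain_fun[OF os.fin_sys os.sys_markov2[OF bk] inj, of "\<lambda>(x, \<omega>, y) _. (x, fst \<omega> * N1 + snd \<omega> + 1, y)" "\<lambda>c _. c"]
    show ?thesis by (simp add: block_sys_def markov_chain_map to_block_def case_prod_unfold)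
  qed
  show ?thesis unfolding valid_system_def using xk rng m1 m2 by blast
qed

lemma block_sys_dist:
  "distortion2 d1 n (block_sys bk) = ex (os.sys bk) (\<lambda>(x, k, \<omega>, y, z). block_dist (\<lambda>x y z. d1 x y) x y z)"
  "distortion3 d2 n (block_sys bk) = ex (os.sys bk) (\<lambda>(x, k, \<omega>, y, z). block_dist (\<lambda>x y z. d2 x z) x y z)"
  unfolding distortion2_def distortion3_def block_sys_def block_dist_def
  by (simp_all add: to_block_def case_prod_unfold ex_eq_expectation)

text \<open>The message pair and the index determine each other, and the list of selected letters is
  a function of the selected block.\<close>

lemma block_sys_equivocation:
  "(ent (os.sys bk) (\<lambda>(x, k, \<omega>, y, z). (sel_list S x y z, \<omega>)) - ent (os.sys bk) (\<lambda>(x, k, \<omega>, y, z). \<omega>)) / n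
    \<le> equivocation S n (block_sys bk)"
proof -
  let ?p = "block_sys bk" and ?s = "os.sys bk"
  let ?M = "\<lambda>w. (msg1 w, msg2 w)" and ?sel = "\<lambda>w. select S (srcs w) (recs2 w) (recs3 w)"
  \<comment> \<open>Reads the letters off the optional blocks and decodes the index from M1.\<close>
  let ?h = "\<lambda>((o1, o2, o3), m1 :: nat, m2 :: nat).
      (map (\<lambda>t. (map_option (\<lambda>l. l ! t) o1, map_option (\<lambda>l. l ! t) o2, map_option (\<lambda>l. l ! t) o3)) [0..<n],
       ((m1 - 1) div N1, (m1 - 1) mod N1))"
  have "ent ?s (\<lambda>(x, k, \<omega>, y, z). (sel_list S x y z, \<omega>)) \<le> ent ?s (\<lambda>r. (?sel (to_block r), ?M (to_block r)))"
  proof (rule ent_mono[OF os.fin_sys, where g="?h"])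
    fix r assume r: "r \<in> set_pmf ?s"
    obtain x k i j y z where re: "r = (x, k, (i, j), y, z)" by (metis surj_pair)
    note s = sys_elem[OF r[unfolded re]]
    have "sel_list S x y z = map (\<lambda>t. select S (x ! t) (y ! t) (z ! t)) [0..<n]"
      using s by (auto simp: sel_list_def sel3_def intro!: nth_equalityI)
    then show "(\<lambda>(x, k, \<omega>, y, z). (sel_list S x y z, \<omega>)) r = ?h (?sel (to_block r), ?M (to_block r))"
      using msg1_range(2,3)[of i j] s by (auto simp: re to_block_def select_def)
  qed
  moreover have "ent ?s (\<lambda>r. ?M (to_block r)) \<le> ent ?s (\<lambda>(x, k, \<omega>, y, z). \<omega>)"
    by (rule ent_mono[OF os.fin_sys, where g="\<lambda>\<omega>. (fst \<omega> * N1 + snd \<omega> + 1, fst \<omega> + 1)"]) (auto simp: to_block_def)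
  moreover have "equivocation S n ?p = (ent ?s (\<lambda>r. (?sel (to_block r), ?M (to_block r))) - ent ?s (\<lambda>r. ?M (to_block r))) / n"
    unfolding equivocation_def cond_entropy2_ent[OF fin_block_sys] by (simp add: block_sys_def pmf.map_comp o_def)
  ultimately show ?thesis by (auto intro!: divide_right_mono)
qed

end

definition "resolv = ex os.P (\<lambda>vs. ex (dmc a vs) (\<lambda>xs. log 2 (os.mean_X (dmc a) xs vs) - log 2 (pmf os.PX xs)))"
definition "secr S = - ex os.P (\<lambda>vs. ex (os.sel_kernel (sel_list S) vs) (\<lambda>l. log 2 (os.mean_S (os.sel_kernel (sel_list S)) l vs)))"
definition "var d = ex Pv (\<lambda>v. (letter_dist d v - ex Pv (letter_dist d))\<^sup>2)"

lemma block_dist_bounded: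
  assumes "\<And>x y z. \<bar>d x y z\<bar> \<le> M" shows "\<bar>block_dist d xs ys zs\<bar> \<le> M"
proof -
  have "\<bar>\<Sum>t<n. d (xs ! t) (ys ! t) (zs ! t)\<bar> \<le> (\<Sum>t<n. M)"
    by (rule order_trans[OF sum_abs]) (intro sum_mono assms)
  then show ?thesis using n by (simp add: block_dist_def abs_mult field_simps)
qed

text \<open>X, D, V1 and V2 belong to one and the same codebook: its ideal equivocation, the
  divergence of its source law, and the spreads of its two distortions. X is of order n, hence the
  weight n \<alpha>.\<close>

lemma block_code_exists:
  fixes d1 :: "'x \<Rightarrow> 'y \<Rightarrow> real" and d2 :: "'x \<Rightarrow> 'z \<Rightarrow> real" and S
    and L M \<alpha> :: real
  assumes M: "\<And>x y. \<bar>d1 x y\<bar> \<le> M" "\<And>x z. \<bar>d2 x z\<bar> \<le> M" and \<alpha>: "0 \<le> \<alpha>"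
  defines "L \<equiv> log 2 (card (range (sel3 S :: 'x \<times> 'y \<times> 'z \<Rightarrow> _)))"
    and "\<delta>1 \<equiv> \<lambda>x y z. d1 x y" and "\<delta>2 \<equiv> \<lambda>x y z. d2 x z"
  shows "\<exists>p X D V1 V2. valid_system R0 R1 R2 QX n (p :: ('x, 'y, 'z) block pmf) \<and> 0 \<le> D \<and> 0 \<le> V1 \<and> 0 \<le> V2 \<and> X \<le> n * L \<and>
     secr S - n * \<alpha> * (resolv + var \<delta>1 / n + var \<delta>2 / n) \<le> X - n * \<alpha> * (D + V1 + V2) \<and>
     (X - 2 - 2 * sqrt D * (n * L)) / n \<le> equivocation S n p \<and>
     distortion2 d1 n p \<le> ex Pv (letter_dist \<delta>1) + sqrt V1 + M * (2 * sqrt D) \<and>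
     distortion3 d2 n p \<le> ex Pv (letter_dist \<delta>2) + sqrt V2 + M * (2 * sqrt D)"
proof -
  let ?g1 = "os.mean_dist (block_dist \<delta>1)" and ?g2 = "os.mean_dist (block_dist \<delta>2)"
  have "0 \<le> n * \<alpha>" using \<alpha> by simp
  from os.good_codebook[OF this, of "sel_list S" ?g1 ?g2]
  obtain bk where bk: "bk \<in> set_pmf os.codebook" and good:
    "secr S - n * \<alpha> * (resolv + var \<delta>1 / n + var \<delta>2 / n)
     \<le> ex (pmf_of_set os.\<Omega>) (\<lambda>\<omega>. Hp (os.out_S (os.sel_kernel (sel_list S)) bk \<omega>))
       - n * \<alpha> * (rel_ent (os.qxk bk) os.pxk + os.dev ?g1 bk + os.dev ?g2 bk)"
    unfolding ex_dev_block by (auto simp: secr_def resolv_def var_def)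
  let ?X = "ex (pmf_of_set os.\<Omega>) (\<lambda>\<omega>. Hp (os.out_S (os.sel_kernel (sel_list S)) bk \<omega>))"
  let ?D = "rel_ent (os.qxk bk) os.pxk"
  let ?A = "range (sel3 S :: 'x \<times> 'y \<times> 'z \<Rightarrow> _)"
  let ?T = "{l. set l \<subseteq> ?A \<and> length l = n}"
  have finT: "finite ?T" by (rule finite_lists_length_eq) simp
  have cardT: "log 2 (card ?T) = n * L"
  proof -
    have "card ?T = card ?A ^ n" by (rule card_lists_length_eq) simp
    moreover have "0 < real (card ?A)" by (simp add: card_gt_0_iff)
    ultimately show ?thesis unfolding L_def by (simp add: log_nat_power)
  qed
  have neT: "?T \<noteq> {}"
  proof -
    have "replicate n (sel3 S undefined) \<in> ?T" by (auto simp: set_replicate_conv_if)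
    then show ?thesis by blast
  qed
  have inT: "sel_list S x y z \<in> ?T" if "length x = n" "length y = n" "length z = n" for x y z
    using that unfolding sel_list_def by auto
  have X: "?X \<le> n * L"
  proof -
    have "?X \<le> ex (pmf_of_set os.\<Omega>) (\<lambda>_. log 2 (card ?T))"
    proof (intro ex_mono Hp_le_log_card[OF finT])
      fix \<omega> assume \<omega>: "\<omega> \<in> set_pmf (pmf_of_set os.\<Omega>)"
      show "set_pmf (os.out_S (os.sel_kernel (sel_list S)) bk \<omega>) \<subseteq> ?T"
      proof
        fix l assume "l \<in> set_pmf (os.out_S (os.sel_kernel (sel_list S)) bk \<omega>)"
        then obtain k where k: "k \<in> KS" and l: "l \<in> set_pmf (os.sel_kernel (sel_list S) (bk (k, \<omega>)))"
          by (auto simp: os.out_S_def)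
        have "length (bk (k, \<omega>)) = n"
          using os.codeword_supp[OF bk k, of \<omega>] \<omega> by (auto simp: os_P set_replicate_pmf)
        moreover obtain x y z where lx: "l = sel_list S x y z" and "x \<in> set_pmf (dmc a (bk (k, \<omega>)))"
          "y \<in> set_pmf (dmc b (bk (k, \<omega>)))" "z \<in> set_pmf (dmc c (map f (bk (k, \<omega>))))"
          using l by (auto simp: os.sel_kernel_def)
        ultimately show "l \<in> ?T" unfolding lx by (intro inT) (auto dest: length_dmc)
      qed
    qed
    then show ?thesis by (simp add: ex_const cardT)
  qed
  have ent: "?X - 2 - 2 * sqrt ?D * (n * L)
     \<le> ent (os.sys bk) (\<lambda>(x, k, \<omega>, y, z). (sel_list S x y z, \<omega>)) - ent (os.sys bk) (\<lambda>(x, k, \<omega>, y, z). \<omega>)"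
    unfolding cardT[symmetric]
    by (rule os.sys_cond_ent[OF bk finT neT inT])
      (auto simp: os_PX os_P set_replicate_pmf dest!: length_dmc)
  have "(?X - 2 - 2 * sqrt ?D * (n * L)) / n \<le> equivocation S n (block_sys bk)"
    by (rule order_trans[OF _ block_sys_equivocation[OF bk]]) (use ent in \<open>auto intro!: divide_right_mono\<close>)
  moreover have "distortion2 d1 n (block_sys bk) \<le> ex Pv (letter_dist \<delta>1) + sqrt (os.dev ?g1 bk) + M * (2 * sqrt ?D)"
    unfolding block_sys_dist[OF bk] ex_mean_dist[symmetric] \<delta>1_def
    by (rule os.sys_dist[OF bk block_dist_bounded]) (rule M)
  moreover have "distortion3 d2 n (block_sys bk) \<le> ex Pv (letter_dist \<delta>2) + sqrt (os.dev ?g2 bk) + M * (2 * sqrt ?D)"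
    unfolding block_sys_dist[OF bk] ex_mean_dist[symmetric] \<delta>2_def
    by (rule os.sys_dist[OF bk block_dist_bounded]) (rule M)
  ultimately show ?thesis
    using block_sys_valid[OF bk] os.sys_l1(1)[OF bk] os.dev_nonneg X good by blast
qed

text \<open>Rounding leaves codebook sizes of at least \<open>x / q\<close>; for s \<le> 1 this
  costs at most the factor q.\<close>

lemma powr_inverse_le:
  fixes N x q s J :: real
  assumes "0 < q" "x / q \<le> N" "0 < x" "0 < s" "s \<le> 1" "1 \<le> q" "0 \<le> m" "m \<le> J"
  shows "m / N powr s \<le> q * (J / x powr s)"
proof -
  have N: "0 < N" using assms by (intro less_le_trans[OF _ assms(2)]) auto
  have "(x / q) powr s \<le> N powr s" using assms by (intro powr_mono2) auto
  then have "x powr s / q powr s \<le> N powr s" using assms by (simp add: powr_divide)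
  moreover have "q powr s \<le> q powr 1" using assms by (intro powr_mono) auto
  then have qs: "q powr s \<le> q" using assms by simp
  ultimately have "x powr s \<le> N powr s * q"
    using assms by (simp add: divide_le_eq) (meson mult_left_mono order_trans powr_ge_zero)
  then have "m * x powr s \<le> J * (N powr s * q)" using assms by (intro mult_mono) auto
  then show ?thesis using N assms by (simp add: field_simps)
qed

text \<open>The factors 4 and 2 are the rounding losses of N2 N1 and N2. The terms decay
  geometrically once J1 < R1 and J2 < \<open>min R1 R2\<close>.\<close>

lemma resolv_le:
  fixes e1 e2 s :: real
  assumes s: "0 < s" "s \<le> 1" and e: "e1 \<in> {0, 1}" "e2 \<in> {0, 1}"
    and e1: "e1 = 0 \<Longrightarrow> e2 = 0 \<and> (\<forall>v\<in>set_pmf Pv. a v = QX)"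
    and e2: "e2 = 0 \<Longrightarrow> (\<forall>v\<in>set_pmf Pv. A2 (f v) = QX)"
    and m1: "ex Pv (\<lambda>v. ex (a v) (\<lambda>x. (pmf (a v) x / pmf QX x) powr s)) \<le> 2 powr (s * J1)"
    and m2: "ex Pv (\<lambda>v. ex (a v) (\<lambda>x. (pmf (A2 (f v)) x / pmf QX x) powr s)) \<le> 2 powr (s * J2)"
  shows "resolv \<le> (e1 * (4 * (2 powr (s * (J1 - R1))) ^ n) + e2 * (2 * (2 powr (s * (J2 - min R1 R2))) ^ n)) / (s * ln 2)"
proof -
  have pw: "(2 powr (s * J)) ^ n / (2 powr (n * r)) powr s = (2 powr (s * (J - r))) ^ n" for J r :: real
    by (simp add: powr_powr powr_realpow[symmetric] powr_diff[symmetric] algebra_simps)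
  let ?m1 = "ex Pv (\<lambda>v. ex (a v) (\<lambda>x. (pmf (a v) x / pmf QX x) powr s))"
  let ?m2 = "ex Pv (\<lambda>v. ex (a v) (\<lambda>x. (pmf (A2 (f v)) x / pmf QX x) powr s))"
  have n1: "0 \<le> ?m1" "0 \<le> ?m2" by (auto intro!: ex_nonneg)
  have 1: "?m1 ^ n / (real N2 * real N1) powr s \<le> 4 * (2 powr (s * (J1 - R1))) ^ n"
    unfolding pw[symmetric] using m1 n1 N1(3) s by (intro powr_inverse_le power_mono) auto
  have 2: "?m2 ^ n / real N2 powr s \<le> 2 * (2 powr (s * (J2 - min R1 R2))) ^ n"
    unfolding pw[symmetric] using m2 n1 N2(2) s by (intro powr_inverse_le power_mono) auto
  have "resolv \<le> (e1 * ?m1 ^ n / (real N2 * real N1) powr s + e2 * ?m2 ^ n / real N2 powr s) / (s * ln 2)"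
    unfolding resolv_def by (rule resolvability_bound[OF s e e1 e2])
  also have "\<dots> \<le> (e1 * (4 * (2 powr (s * (J1 - R1))) ^ n) + e2 * (2 * (2 powr (s * (J2 - min R1 R2))) ^ n)) / (s * ln 2)"
    unfolding times_divide_eq_right[symmetric] using s e 1 2
    by (intro divide_right_mono add_mono mult_left_mono) auto
  finally show ?thesis .
qed

lemma secr_ge:
  fixes s \<eta> IS :: real
  assumes s: "0 < s" "s \<le> 1" and \<eta>: "0 \<le> \<eta>"
    and mS: "ex Pv (\<lambda>v. ex (WS S v) (\<lambda>x. (pmf (WS S v) x / pmf (QS S) x) powr s)) \<le> 2 powr (s * (IS + \<eta>))"
  shows "n * (Hp (QS S) - max 0 (IS - R0)) - n * \<eta> - 2 / s \<le> secr S"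
proof -
  let ?m = "ex Pv (\<lambda>v. ex (WS S v) (\<lambda>x. (pmf (WS S v) x / pmf (QS S) x) powr s))"
  \<comment> \<open>Truncation at 0 gives \<open>1 \<le> 2 powr ?y\<close>, so 1 plus the moment
    term is at most \<open>4 * 2 powr ?y\<close>; the factor 4 becomes the additive 2 under the
    logarithm.\<close>
  let ?y = "n * (s * max 0 (IS + \<eta> - R0))"
  have n1: "0 \<le> ?m" by (auto intro!: ex_nonneg)
  have "?m ^ n / real (card KS) powr s \<le> 2 * ((2 powr (s * (IS + \<eta>))) ^ n / (2 powr (n * R0)) powr s)"
    using mS n1 KS(3) s by (intro powr_inverse_le power_mono) auto
  also have "(2 powr (s * (IS + \<eta>))) ^ n / (2 powr (n * R0)) powr s = 2 powr (n * (s * (IS + \<eta> - R0)))"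
    by (simp add: powr_powr powr_realpow[symmetric] powr_diff[symmetric] algebra_simps)
  also have "\<dots> \<le> 2 powr ?y" using s by (intro powr_mono mult_left_mono) auto
  finally have le: "?m ^ n / real (card KS) powr s \<le> 2 * 2 powr ?y" by simp
  have y0: "0 \<le> ?y" using s by simp
  then have "1 \<le> (2::real) powr ?y" by (simp add: ge_one_powr_ge_zero)
  then have "1 + ?m ^ n / real (card KS) powr s \<le> 4 * 2 powr ?y" using le by linarith
  moreover have "0 < 1 + ?m ^ n / real (card KS) powr s" using n1 by (intro add_pos_nonneg) auto
  ultimately have "log 2 (1 + ?m ^ n / real (card KS) powr s) \<le> log 2 (4 * 2 powr ?y)" by (intro log_mono) auto
  also have "\<dots> = 2 + ?y"
  proof -
    have "(4::real) * 2 powr ?y = 2 powr 2 * 2 powr ?y" by simp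
    then show ?thesis unfolding powr_add[symmetric] by (simp only: log_powr_cancel)
  qed
  finally have "log 2 (1 + ?m ^ n / real (card KS) powr s) / s \<le> (2 + ?y) / s" using s by (intro divide_right_mono) auto
  also have "\<dots> = 2 / s + n * max 0 (IS + \<eta> - R0)" using s by (simp add: add_divide_distrib)
  also have "\<dots> \<le> 2 / s + n * (max 0 (IS - R0) + \<eta>)" using \<eta> by (intro add_left_mono mult_left_mono) auto
  finally show ?thesis
    using secrecy_bound[OF s, of S] unfolding secr_def by (simp add: algebra_simps)
qed

end

text \<open>Links the mean log-ratios behind the exponents with the tuple: they are I(X;V1), I(X;V2)
  and I(S;V1). The last two claims are the cases of zero information.\<close>

lemma single_letter_identities:
  fixes a :: "nat \<Rightarrow> 'x::finite pmf" and b :: "nat \<Rightarrow> 'y::finite pmf" and c :: "nat \<Rightarrow> 'z::finite pmf"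
  assumes "nletter P2 P1 f R0 R1 R2 n"
  defines "t \<equiv> tuple_of P2 P1 a b c" and "Pv \<equiv> bind_pmf P2 P1" and "QX \<equiv> bind_pmf (bind_pmf P2 P1) a"
  shows "ex Pv (\<lambda>v. ex (a v) (\<lambda>x. log 2 (pmf (a v) x / pmf QX x))) = Hp QX - hX1 t"
    and "ex Pv (\<lambda>v. ex (a v) (\<lambda>x. log 2 (pmf (bind_pmf (P1 (f v)) a) x / pmf QX x))) = Hp QX - hX2 t"
    and "hX1 t \<le> hX2 t"
    and "Hp (nletter.QS P2 P1 a b c f S) = HS S (fst t)"
    and "ex Pv (\<lambda>v. ex (nletter.WS a b c f S v) (\<lambda>x. log 2 (pmf (nletter.WS a b c f S v) x / pmf (nletter.QS P2 P1 a b c f S) x)))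
      = HS S (fst t) - sel_sum S (hX1 t) (hY1 t) (hZ2 t)"
    and "ex Pv (nletter.letter_dist a b c f (\<lambda>x y z. d1 x y)) = dist1 d1 t"
    and "ex Pv (nletter.letter_dist a b c f (\<lambda>x y z. d2 x z)) = dist2 d2 t"
    and "Hp QX - hX1 t = 0 \<Longrightarrow> v \<in> set_pmf Pv \<Longrightarrow> a v = QX"
    and "Hp QX - hX2 t = 0 \<Longrightarrow> v \<in> set_pmf Pv \<Longrightarrow> bind_pmf (P1 (f v)) a = QX"
proof -
  interpret kernels P2 P1 a b c f by (rule nletter.axioms(1)[OF assms(1)])
  interpret I: nletter P2 P1 a b c f R0 R1 R2 n by (rule assms(1))
  have PP: "ex Pv g = ex P2 (\<lambda>u. ex (P1 u) g)" for g unfolding Pv_def by (rule ex_bind_P)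
  have fPv: "finite (set_pmf Pv)" by (simp add: Pv_def)
  have t1: "hX1 t = ex Pv (\<lambda>v. Hp (a v))" by (simp add: t_def tuple_of_def PP)
  have t2: "hX2 t = ex P2 (\<lambda>u. Hp (bind_pmf (P1 u) a))" by (simp add: t_def tuple_of_def)
  have QX2: "QX = bind_pmf P2 (\<lambda>u. bind_pmf (P1 u) a)" by (simp add: QX_def bind_assoc_pmf)
  have QXv: "QX = bind_pmf Pv a" by (simp add: QX_def Pv_def)
  have fs: "f v = u" if "u \<in> set_pmf P2" "v \<in> set_pmf (P1 u)" for u v by (rule sep[OF that])
  have re: "ex p (\<lambda>x. log 2 (pmf p x / pmf r x)) = rel_ent p r" if "set_pmf p \<subseteq> set_pmf r" for p r :: "'q pmf"
    unfolding rel_ent_def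
  proof (intro ex_cong refl)
    fix x assume "x \<in> set_pmf p"
    then have "0 < pmf p x" "0 < pmf r x" using that by (auto intro: pmf_positive)
    then show "log 2 (pmf p x / pmf r x) = log 2 (pmf p x) - log 2 (pmf r x)" by (simp add: log_divide)
  qed
  have "ex Pv (\<lambda>v. ex (a v) (\<lambda>x. log 2 (pmf (a v) x / pmf QX x))) = ex Pv (\<lambda>v. rel_ent (a v) QX)"
    by (intro ex_cong refl re) (auto simp: QXv)
  then show "ex Pv (\<lambda>v. ex (a v) (\<lambda>x. log 2 (pmf (a v) x / pmf QX x))) = Hp QX - hX1 t"
    unfolding t1 QXv Hp_bind_ge(1)[OF fPv, of a, simplified] .
  have "ex Pv (\<lambda>v. ex (a v) (\<lambda>x. log 2 (pmf (bind_pmf (P1 (f v)) a) x / pmf QX x)))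
     = ex P2 (\<lambda>u. ex (bind_pmf (P1 u) a) (\<lambda>x. log 2 (pmf (bind_pmf (P1 u) a) x / pmf QX x)))"
    unfolding PP by (intro ex_cong refl) (simp add: fs ex_bind cong: ex_cong)
  also have "\<dots> = ex P2 (\<lambda>u. rel_ent (bind_pmf (P1 u) a) QX)"
    by (intro ex_cong refl re) (auto simp: QX2)
  finally show "ex Pv (\<lambda>v. ex (a v) (\<lambda>x. log 2 (pmf (bind_pmf (P1 (f v)) a) x / pmf QX x))) = Hp QX - hX2 t"
    unfolding t2 QX2 Hp_bind_ge(1)[OF fin2, of "\<lambda>u. bind_pmf (P1 u) a", simplified] .
  show "hX1 t \<le> hX2 t"
    unfolding t1 t2 PP
  proof (rule ex_mono)
    fix u
    show "ex (P1 u) (\<lambda>v. Hp (a v)) \<le> Hp (bind_pmf (P1 u) a)"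
      using Hp_bind_ge(1,2)[OF fin1[of u], of a] by simp
  qed
  have W3: "W3 q = bind_pmf Pv (\<lambda>v. pair_pmf (a v) (pair_pmf (b v) (c (f v))))"
  proof -
    have "W3 q = map_pmf snd (map_pmf (\<lambda>w. (aux1 w, (src w, rec2 w, rec3 w))) q)"
      by (simp add: W3_def pmf.map_comp o_def)
    then show ?thesis
      unfolding map_q_aux1[of "\<lambda>x y z. (x, y, z)"] by (simp add: map_bind_pmf pmf.map_comp o_def case_prod_unfold Pv_def)
  qed
  have rep: "represents t q" unfolding t_def by (rule represents_tuple_of)
  have QSW: "I.QS S = map_pmf (sel3 S) (W3 q)"
    unfolding I.QS_def I.WS_def[abs_def] W3 by (simp add: map_bind_pmf Pv_def I.Pv_def)
  show HQ: "Hp (I.QS S) = HS S (fst t)"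
    using rep by (simp add: represents_def HS_vecp QSW)
  have WSs: "Hp (I.WS S v) = sel_sum S (Hp (a v)) (Hp (b v)) (Hp (c (f v)))" for v
    unfolding I.WS_def sel3_def by (rule Hp_select) auto
  have PvN: "nletter.Pv P2 P1 = Pv" by (simp add: Pv_def I.Pv_def)
  have "ex Pv (\<lambda>v. Hp (I.WS S v)) = sel_sum S (hX1 t) (hY1 t) (hZ2 t)"
    unfolding WSs ex_sel_sum unfolding PP by (simp add: t_def tuple_of_def ex_const fs cong: ex_cong)
  moreover have "ex Pv (\<lambda>v. ex (I.WS S v) (\<lambda>x. log 2 (pmf (I.WS S v) x / pmf (I.QS S) x))) = ex Pv (\<lambda>v. rel_ent (I.WS S v) (I.QS S))"
    by (intro ex_cong refl re) (auto simp: I.QS_def PvN)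
  moreover have "\<dots> = Hp (I.QS S) - ex Pv (\<lambda>v. Hp (I.WS S v))"
    unfolding I.QS_def PvN using Hp_bind_ge(1)[OF fPv, of "I.WS S"] by simp
  ultimately show "ex Pv (\<lambda>v. ex (I.WS S v) (\<lambda>x. log 2 (pmf (I.WS S v) x / pmf (I.QS S) x))) = HS S (fst t) - sel_sum S (hX1 t) (hY1 t) (hZ2 t)"
    using HQ by simp
  have D: "ex Pv (I.letter_dist d) = ex q (\<lambda>w. d (src w) (rec2 w) (rec3 w))" for d
  proof -
    have "ex q (\<lambda>w. d (src w) (rec2 w) (rec3 w)) = ex (W3 q) (\<lambda>(x, y, z). d x y z)"
      unfolding W3_def by (subst ex_map) (simp_all add: case_prod_unfold)
    also have "\<dots> = ex Pv (I.letter_dist d)"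
      unfolding W3 using fPv by (subst ex_bind) (auto simp: ex_pair I.letter_dist_def[abs_def])
    finally show ?thesis ..
  qed
  show "ex Pv (I.letter_dist (\<lambda>x y z. d1 x y)) = dist1 d1 t" "ex Pv (I.letter_dist (\<lambda>x y z. d2 x z)) = dist2 d2 t"
    unfolding D represents_dist1[OF fin_q rep] represents_dist2[OF fin_q rep] by (simp_all add: ex_eq_expectation)
  show "a v = QX" if "Hp QX - hX1 t = 0" "v \<in> set_pmf Pv"
    unfolding QXv by (rule Hp_bind_ge(3)[OF fPv]) (use that Hp_bind_ge(1)[OF fPv, of a] in \<open>auto simp: t1 QXv\<close>)
  show "bind_pmf (P1 (f v)) a = QX" if z: "Hp QX - hX2 t = 0" and v: "v \<in> set_pmf Pv"
  proof -
    obtain u where u: "u \<in> set_pmf P2" "v \<in> set_pmf (P1 u)" using v by (auto simp: Pv_def)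
    have "bind_pmf (P1 u) a = QX"
      unfolding QX2 by (rule Hp_bind_ge(3)[OF fin2, of "\<lambda>u. bind_pmf (P1 u) a"])
        (use z u Hp_bind_ge(1)[OF fin2, of "\<lambda>u. bind_pmf (P1 u) a"] in \<open>auto simp: t2 QX2\<close>)
    then show ?thesis using fs[OF u] by simp
  qed
qed

lemma moment_bound_channel:
  assumes fin: "finite (set_pmf p)" "\<And>v. finite (set_pmf (W v))"
    and pos: "\<And>v x. v \<in> set_pmf p \<Longrightarrow> x \<in> set_pmf (W v) \<Longrightarrow> 0 < h v x" and \<eta>: "0 < \<eta>"
  shows "\<exists>\<delta>>0. \<forall>s. 0 < s \<longrightarrow> s < \<delta> \<longrightarrow>
    ex p (\<lambda>v. ex (W v) (\<lambda>x. h v x powr s)) \<le> 2 powr (s * (ex p (\<lambda>v. ex (W v) (\<lambda>x. log 2 (h v x))) + \<eta>))"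
proof -
  let ?J = "bind_pmf p (\<lambda>v. map_pmf (Pair v) (W v))"
  have J: "ex ?J g = ex p (\<lambda>v. ex (W v) (\<lambda>x. g (v, x)))" for g
    using fin by (simp add: ex_bind ex_map)
  have "finite (set_pmf ?J)" using fin by auto
  moreover have "0 < (case w of (v, x) \<Rightarrow> h v x)" if "w \<in> set_pmf ?J" for w using that pos by auto
  ultimately have "\<exists>\<delta>>0. \<forall>s. 0 < s \<longrightarrow> s < \<delta> \<longrightarrow> ex ?J (\<lambda>w. (case w of (v, x) \<Rightarrow> h v x) powr s)
      \<le> 2 powr (s * (ex ?J (\<lambda>w. log 2 (case w of (v, x) \<Rightarrow> h v x)) + \<eta>))"
    by (rule moment_bound[OF _ _ \<eta>])
  then show ?thesis by (simp add: J)
qed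

text \<open>Since X is at most n L, the single inequality \<open>sec\<close> bounds the sum of the
  penalties by (L + 2) / \<alpha> + E. Reading it once more with the penalties dropped bounds X from
  below.\<close>

lemma combine_bounds:
  fixes X D V1 V2 L s v e \<alpha> \<kappa> \<eta>' E :: real and n :: nat
  assumes n: "1 \<le> n" and XL: "X \<le> n * L" and nn: "0 \<le> D" "0 \<le> V1" "0 \<le> V2" "0 \<le> v" "0 \<le> L"
    and sec: "n * v - n * \<eta>' - 2 / s - n * \<alpha> * E \<le> X - n * \<alpha> * (D + V1 + V2)"
    and \<alpha>: "0 < \<alpha>" and \<eta>': "\<eta>' \<le> 1" and s: "2 / s \<le> n" and k: "(L + 2) / \<alpha> + E \<le> \<kappa>"
  shows "D \<le> \<kappa>" "V1 \<le> \<kappa>" "V2 \<le> \<kappa>" "v - \<eta>' - 2 / s / n - \<alpha> * E - 2 / n - 2 * sqrt \<kappa> * L \<le> (X - 2 - 2 * sqrt D * (n * L)) / n"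
proof -
  have n0: "0 < real n" using n by simp
  have "n * \<alpha> * (D + V1 + V2) \<le> n * L + n * \<eta>' + 2 / s + n * \<alpha> * E"
    using sec XL mult_nonneg_nonneg[of "real n" v] nn by linarith
  \<comment> \<open>The two bounds \<open>\<eta>' \<le> 1\<close> and \<open>2 / s \<le> n\<close>
    account for the 2 in L + 2.\<close>
  also have "\<dots> \<le> n * L + n * 1 + n + n * \<alpha> * E"
    using \<eta>' s n0 \<alpha> by (intro add_mono mult_left_mono) auto
  also have "\<dots> = n * \<alpha> * ((L + 2) / \<alpha> + E)" using \<alpha> by (simp add: field_simps)
  finally have "D + V1 + V2 \<le> (L + 2) / \<alpha> + E" using n0 \<alpha> by simp
  then show D: "D \<le> \<kappa>" and "V1 \<le> \<kappa>" "V2 \<le> \<kappa>" using k nn by auto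
  have "0 \<le> n * \<alpha> * (D + V1 + V2)" using \<alpha> nn by simp
  then have "n * v - n * \<eta>' - 2 / s - n * \<alpha> * E \<le> X" using sec by linarith
  moreover have "2 * sqrt D * (n * L) \<le> 2 * sqrt \<kappa> * (n * L)" using D nn by (intro mult_right_mono) auto
  ultimately have "(n * v - n * \<eta>' - 2 / s - n * \<alpha> * E - 2 - 2 * sqrt \<kappa> * (n * L)) / n \<le> (X - 2 - 2 * sqrt D * (n * L)) / n"
    by (intro divide_right_mono) auto
  then show "v - \<eta>' - 2 / s / n - \<alpha> * E - 2 / n - 2 * sqrt \<kappa> * L \<le> (X - 2 - 2 * sqrt D * (n * L)) / n"
    using n0 by (simp add: diff_divide_distrib)
qed

text \<open>Order of choices: the accuracy r fixes the weight \<alpha>, the rate gaps and the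
  required accuracy fix s, and only then is n taken large, so that \<alpha> E n becomes
  negligible.\<close>

lemma achievable:
  fixes t :: "('x::finite, 'y::finite, 'z::finite) tuple"
  assumes R: "0 \<le> R0" "0 \<le> R1" "0 \<le> R2" and \<eta>: "0 < \<eta>" and t: "t \<in> region" and mX: "\<And>x. margX t x = pmf PX x"
    and s1: "Hp PX - hX1 t < R1 \<or> Hp PX - hX1 t = 0" and s2: "Hp PX - hX2 t < R2 \<or> Hp PX - hX2 t = 0"
  shows "\<exists>n p. 1 \<le> n \<and> valid_system R0 R1 R2 PX n (p :: ('x, 'y, 'z) block pmf) \<and>
    tuple_value R0 S t - \<eta> \<le> equivocation S n p \<and>
    distortion2 d1 n p \<le> dist1 d1 t + \<eta> \<and> distortion3 d2 n p \<le> dist2 d2 t + \<eta>"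
proof -
  obtain P2 P1 a b c where kern: "kernels P2 P1 (fst \<circ> prod_decode)" and tt: "t = tuple_of P2 P1 a b c"
    by (rule region_eq_tuple_of[OF t])
  let ?f = "fst \<circ> prod_decode"
  interpret kernels P2 P1 a b c ?f by (rule kern)
  have nl: "nletter P2 P1 ?f R0 R1 R2 n" if "1 \<le> n" for n
    by unfold_locales (use R that in auto)
  interpret M: nletter P2 P1 a b c ?f R0 R1 R2 1 by (rule nl) simp
  have PX: "M.QX = PX"
  proof (rule pmf_eqI)
    fix x
    have "pmf PX x = pmf (map_pmf src q) x"
      using represents_margX[OF fin_q represents_tuple_of, of x] mX[of x] by (simp add: tt)
    then show "pmf M.QX x = pmf PX x" by (simp add: map_q_src M.QX_def M.Pv_def bind_assoc_pmf)
  qed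
  have PXe: "bind_pmf M.Pv a = PX" using PX by (simp add: M.QX_def)
  note id = single_letter_identities[OF nl[OF order_refl], of a b c, folded tt, folded M.Pv_def, unfolded PXe, folded M.A2_def]
  define I1 I2 IS where "I1 = Hp PX - hX1 t" and "I2 = Hp PX - hX2 t" and "IS = HS S (fst t) - sel_sum S (hX1 t) (hY1 t) (hZ2 t)"
  \<comment> \<open>A term is kept only where a strict inequality makes it decay. If I1 < R1 fails
    then I1 = 0, so X is independent of V1 and hence of V2, and both terms disappear.\<close>
  define e1 :: real where "e1 = (if I1 < R1 then 1 else 0)"
  define e2 :: real where "e2 = (if I1 < R1 \<and> I2 < R2 then 1 else 0)"
  have A2c: "M.A2 (?f v) = PX" if c: "\<forall>v\<in>set_pmf M.Pv. a v = PX" and v: "v \<in> set_pmf M.Pv" for v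
  proof -
    obtain u where u: "u \<in> set_pmf P2" "v \<in> set_pmf (P1 u)" using v by (auto simp: M.Pv_def)
    have "M.A2 u = bind_pmf (P1 u) (\<lambda>_. PX)"
      unfolding M.A2_def using c u by (intro bind_pmf_cong refl) (auto simp: M.Pv_def)
    then show ?thesis using sep[OF u] by simp
  qed
  have e1c: "e1 = 0 \<Longrightarrow> e2 = 0 \<and> (\<forall>v\<in>set_pmf M.Pv. a v = M.QX)"
    using s1 id(8) by (auto simp: e1_def e2_def I1_def PX split: if_splits)
  have e2c: "e2 = 0 \<Longrightarrow> (\<forall>v\<in>set_pmf M.Pv. M.A2 (?f v) = M.QX)"
    using s1 s2 id(8,9) A2c by (auto simp: e2_def I1_def I2_def PX split: if_splits)
  have I21: "I2 \<le> I1" using id(3) by (simp add: I1_def I2_def)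
  define \<eta>' where "\<eta>' = min 1 (\<eta> / 8)"
  have \<eta>': "0 < \<eta>'" "\<eta>' \<le> 1" "\<eta>' \<le> \<eta> / 8" using \<eta> by (auto simp: \<eta>'_def)
  \<comment> \<open>Half of the gap to the rate, which leaves the exponents negative; where a term
    is dropped, any positive value serves.\<close>
  define \<eta>1 where "\<eta>1 = (if I1 < R1 then (R1 - I1) / 2 else 1)"
  define \<eta>2 where "\<eta>2 = (if I1 < R1 \<and> I2 < R2 then (min R1 R2 - I2) / 2 else 1)"
  have \<eta>12: "0 < \<eta>1" "0 < \<eta>2" using I21 by (auto simp: \<eta>1_def \<eta>2_def)
  have fPv: "finite (set_pmf M.Pv)" by (simp add: M.Pv_def)
  have subs: "set_pmf (a v) \<subseteq> set_pmf PX" "set_pmf (a v) \<subseteq> set_pmf (M.A2 (?f v))" "set_pmf (M.WS S v) \<subseteq> set_pmf (M.QS S)"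
    if "v \<in> set_pmf M.Pv" for v
    using M.a_subset that unfolding PX by (auto simp: M.QS_def)
  obtain \<delta>1 where \<delta>1: "0 < \<delta>1" "\<And>s. 0 < s \<Longrightarrow> s < \<delta>1 \<Longrightarrow>
      ex M.Pv (\<lambda>v. ex (a v) (\<lambda>x. (pmf (a v) x / pmf PX x) powr s)) \<le> 2 powr (s * (I1 + \<eta>1))"
    using moment_bound_channel[of M.Pv a "\<lambda>v x. pmf (a v) x / pmf PX x", OF fPv _ _ \<eta>12(1)] subs id(1)
    by (auto simp: I1_def pmf_positive subset_iff)
  obtain \<delta>2 where \<delta>2: "0 < \<delta>2" "\<And>s. 0 < s \<Longrightarrow> s < \<delta>2 \<Longrightarrow>
      ex M.Pv (\<lambda>v. ex (a v) (\<lambda>x. (pmf (M.A2 (?f v)) x / pmf PX x) powr s)) \<le> 2 powr (s * (I2 + \<eta>2))"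
    using moment_bound_channel[of M.Pv a "\<lambda>v x. pmf (M.A2 (?f v)) x / pmf PX x", OF fPv _ _ \<eta>12(2)] subs id(2)
    by (auto simp: I2_def pmf_positive subset_iff)
  obtain \<delta>3 where \<delta>3: "0 < \<delta>3" "\<And>s. 0 < s \<Longrightarrow> s < \<delta>3 \<Longrightarrow>
      ex M.Pv (\<lambda>v. ex (M.WS S v) (\<lambda>x. (pmf (M.WS S v) x / pmf (M.QS S) x) powr s)) \<le> 2 powr (s * (IS + \<eta>'))"
    using moment_bound_channel[of M.Pv "M.WS S" "\<lambda>v x. pmf (M.WS S v) x / pmf (M.QS S) x", OF fPv _ _ \<eta>'(1)] subs(3) id(5)[of S]
    by (auto simp: IS_def pmf_positive subset_iff)
  define s where "s = min 1 (min \<delta>1 (min \<delta>2 \<delta>3)) / 2"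
  have s: "0 < s" "s \<le> 1" "s < \<delta>1" "s < \<delta>2" "s < \<delta>3" using \<delta>1 \<delta>2 \<delta>3 by (auto simp: s_def min_def)
  define \<rho>1 where "\<rho>1 = 2 powr (s * (I1 + \<eta>1 - R1))"
  define \<rho>2 where "\<rho>2 = 2 powr (s * (I2 + \<eta>2 - min R1 R2))"
  define L where "L = log 2 (card (range (sel3 S :: 'x \<times> 'y \<times> 'z \<Rightarrow> _)))"
  have L0: "0 \<le> L" unfolding L_def by (simp add: Suc_le_eq card_gt_0_iff)
  define Mb where "Mb = (\<Sum>x\<in>UNIV. \<Sum>y\<in>UNIV. \<bar>d1 x y\<bar>) + (\<Sum>x\<in>UNIV. \<Sum>z\<in>UNIV. \<bar>d2 x z\<bar>)"
  have elem: "\<bar>d x y\<bar> \<le> (\<Sum>x\<in>UNIV. \<Sum>y\<in>UNIV. \<bar>d x y\<bar>)" for d :: "'p::finite \<Rightarrow> 'r::finite \<Rightarrow> real" and x y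
  proof -
    have "\<bar>d x y\<bar> \<le> (\<Sum>y\<in>UNIV. \<bar>d x y\<bar>)" by (rule member_le_sum) auto
    also have "\<dots> \<le> (\<Sum>x\<in>UNIV. \<Sum>y\<in>UNIV. \<bar>d x y\<bar>)" by (rule member_le_sum) (auto intro: sum_nonneg)
    finally show ?thesis .
  qed
  have Mb: "\<bar>d1 x y\<bar> \<le> Mb" "\<bar>d2 x z\<bar> \<le> Mb" "0 \<le> Mb" for x y z
    using elem[of d1 x y] elem[of d2 x z] unfolding Mb_def by (auto intro!: add_nonneg_nonneg sum_nonneg order_trans[OF elem])
  \<comment> \<open>Once the penalties are at most r^2, they cost up to 2 r L in equivocation and r
    + 2 Mb r in distortion; this choice keeps both within \<eta>.\<close>
  define r where "r = \<eta> / (4 * (L + Mb + 1))"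
  have r: "0 < r" "2 * r * L \<le> \<eta> / 2" "r + 2 * Mb * r \<le> \<eta>"
  proof -
    have p: "0 < L + Mb + 1" using L0 Mb(3) by linarith
    then show "0 < r" using \<eta> by (simp add: r_def)
    have "4 * (\<eta> / (4 * w) * w) = \<eta>" if "0 < w" for w :: real using that by simp
    from this[OF p] have "4 * (r * (L + Mb + 1)) = \<eta>" by (simp only: r_def)
    then have e: "4 * (r * L + r * Mb + r) = \<eta>" by (simp add: distrib_left)
    have "0 \<le> r * L" "0 \<le> r * Mb" using \<open>0 < r\<close> L0 Mb(3) by auto
    then show "2 * r * L \<le> \<eta> / 2" "r + 2 * Mb * r \<le> \<eta>" using e \<open>0 < r\<close> by (simp_all add: mult.commute mult.left_commute)
  qed
  \<comment> \<open>Makes (L + 2) / \<alpha> half of r^2; the other half is left for E n.\<close>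
  define \<alpha> where "\<alpha> = 2 * (L + 2) / r\<^sup>2"
  have \<alpha>: "0 < \<alpha>" "(L + 2) / \<alpha> = r\<^sup>2 / 2" using L0 r(1) by (auto simp: \<alpha>_def field_simps)
  let ?\<delta>1 = "\<lambda>x y z. d1 x y" and ?\<delta>2 = "\<lambda>x y z. d2 x z"
  define C where "C = M.var ?\<delta>1 + M.var ?\<delta>2"
  define E where "E n = (e1 * (4 * \<rho>1 ^ n) + e2 * (2 * \<rho>2 ^ n)) / (s * ln 2) + C / real n" for n
  have geo: "(\<lambda>n. \<epsilon> * (k * \<rho> ^ n)) \<longlonglongrightarrow> 0" if "0 \<le> \<rho>" "\<epsilon> \<noteq> 0 \<Longrightarrow> \<rho> < 1" for \<epsilon> k \<rho> :: real
  proof (cases "\<epsilon> = 0")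
    case False
    then have "(\<lambda>n. \<rho> ^ n) \<longlonglongrightarrow> 0" using that by (intro LIMSEQ_realpow_zero) auto
    from tendsto_mult_right_zero[OF this, of "\<epsilon> * k"] show ?thesis by (simp add: mult.assoc)
  qed simp
  have \<rho>: "0 \<le> \<rho>1" "e1 \<noteq> 0 \<Longrightarrow> \<rho>1 < 1" "0 \<le> \<rho>2" "e2 \<noteq> 0 \<Longrightarrow> \<rho>2 < 1"
  proof -
    have lt: "2 powr (s * y) < 1" if "y < 0" for y
      using that s(1) by (intro powr_less_one) (auto simp: mult_pos_neg)
    show "0 \<le> \<rho>1" "0 \<le> \<rho>2" by (auto simp: \<rho>1_def \<rho>2_def)
    show "\<rho>1 < 1" if "e1 \<noteq> 0" unfolding \<rho>1_def
      by (rule lt) (use that in \<open>auto simp: e1_def \<eta>1_def field_simps split: if_splits\<close>)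
    show "\<rho>2 < 1" if "e2 \<noteq> 0"
    proof -
      have *: "I1 < R1" "I2 < R2" using that by (auto simp: e2_def split: if_splits)
      then have "I2 < min R1 R2" using I21 by auto
      then show ?thesis unfolding \<rho>2_def by (intro lt) (use * in \<open>auto simp: \<eta>2_def field_simps\<close>)
    qed
  qed
  have E0: "E \<longlonglongrightarrow> 0"
  proof -
    have "(\<lambda>n. (e1 * (4 * \<rho>1 ^ n) + e2 * (2 * \<rho>2 ^ n)) / (s * ln 2) + C / real n) \<longlonglongrightarrow> (0 + 0) / (s * ln 2) + 0"
      using s by (intro tendsto_add tendsto_divide geo \<rho> tendsto_const lim_const_over_n) auto
    then show ?thesis unfolding E_def[abs_def] by simp
  qed
  have "\<forall>\<^sub>F n in sequentially. E n < r\<^sup>2 / 2" using r(1) by (intro order_tendstoD(2)[OF E0]) simp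
  moreover have "\<forall>\<^sub>F n in sequentially. E n < \<eta> / 8 / \<alpha>" using \<eta> \<alpha>(1) by (intro order_tendstoD(2)[OF E0]) simp
  moreover have "\<forall>\<^sub>F n in sequentially. 2 / s / real n < min 1 (\<eta> / 8)"
    using \<eta> by (intro order_tendstoD(2)[OF lim_const_over_n]) auto
  moreover have "\<forall>\<^sub>F n in sequentially. 2 / real n < \<eta> / 8"
    using \<eta> by (intro order_tendstoD(2)[OF lim_const_over_n]) auto
  moreover have "\<forall>\<^sub>F n in sequentially. 1 \<le> n" by (rule eventually_ge_at_top)
  ultimately have "\<forall>\<^sub>F n in sequentially. E n < r\<^sup>2 / 2 \<and> E n < \<eta> / 8 / \<alpha> \<and> 2 / s / real n < min 1 (\<eta> / 8) \<and> 2 / real n < \<eta> / 8 \<and> 1 \<le> n"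
    by eventually_elim simp
  then obtain n where nE: "E n < r\<^sup>2 / 2" "E n < \<eta> / 8 / \<alpha>" "2 / s / real n < min 1 (\<eta> / 8)" "2 / real n < \<eta> / 8" and n: "1 \<le> n"
    by (metis (no_types, lifting) eventually_happens trivial_limit_sequentially)
  interpret N: nletter P2 P1 a b c ?f R0 R1 R2 n by (rule nl[OF n])
  have res: "N.resolv + M.var ?\<delta>1 / n + M.var ?\<delta>2 / n \<le> E n"
  proof -
    have "N.resolv \<le> (e1 * (4 * (2 powr (s * (I1 + \<eta>1 - R1))) ^ n) + e2 * (2 * (2 powr (s * (I2 + \<eta>2 - min R1 R2))) ^ n)) / (s * ln 2)"
      by (rule N.resolv_le[OF s(1,2) _ _ e1c e2c]) (use \<delta>1(2)[OF s(1,3)] \<delta>2(2)[OF s(1,4)] in \<open>auto simp: e1_def e2_def PX\<close>)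
    then show ?thesis unfolding E_def C_def \<rho>1_def \<rho>2_def by (simp add: add_divide_distrib)
  qed
  have sec: "n * (Hp (M.QS S) - max 0 (IS - R0)) - n * \<eta>' - 2 / s \<le> N.secr S"
    by (rule N.secr_ge[OF s(1,2) _ \<delta>3(2)[OF s(1,5)]]) (use \<eta>' in simp)
  have val: "Hp (M.QS S) - max 0 (IS - R0) = tuple_value R0 S t"
    unfolding tuple_value_def IS_def id(4) by simp
  obtain p X D V1 V2 where p: "valid_system R0 R1 R2 M.QX n (p :: ('x, 'y, 'z) block pmf)" and nn: "0 \<le> D" "0 \<le> V1" "0 \<le> V2"
    and XL: "X \<le> n * L"
    and X: "N.secr S - n * \<alpha> * (N.resolv + M.var ?\<delta>1 / n + M.var ?\<delta>2 / n) \<le> X - n * \<alpha> * (D + V1 + V2)"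
    and eq: "(X - 2 - 2 * sqrt D * (n * L)) / n \<le> equivocation S n p"
    and ds: "distortion2 d1 n p \<le> ex M.Pv (M.letter_dist ?\<delta>1) + sqrt V1 + Mb * (2 * sqrt D)"
      "distortion3 d2 n p \<le> ex M.Pv (M.letter_dist ?\<delta>2) + sqrt V2 + Mb * (2 * sqrt D)"
    using N.block_code_exists[where ?d1.0=d1 and ?d2.0=d2 and M=Mb and S=S, OF Mb(1,2) less_imp_le[OF \<alpha>(1)], folded L_def]
    by (elim exE conjE) (rule that; assumption)
  have n0: "0 < real n" using n by simp
  have "n * \<alpha> * (N.resolv + M.var ?\<delta>1 / n + M.var ?\<delta>2 / n) \<le> n * \<alpha> * E n"
    using res \<alpha>(1) by (intro mult_left_mono) auto
  then have sX: "n * tuple_value R0 S t - n * \<eta>' - 2 / s - n * \<alpha> * E n \<le> X - n * \<alpha> * (D + V1 + V2)"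
    using X sec unfolding val by linarith
  have sn: "2 / s \<le> n"
  proof -
    have "2 / s / real n < 1" using nE(3) by simp
    then have "2 / s < 1 * real n" by (simp only: pos_divide_less_eq[OF n0])
    then show ?thesis by simp
  qed
  have k: "(L + 2) / \<alpha> + E n \<le> r\<^sup>2" using \<alpha>(2) nE(1) by linarith
  note cb = combine_bounds[OF n XL nn tuple_value_nonneg[OF R(1) t] L0 sX \<alpha>(1) \<eta>'(2) sn k]
  have sq: "sqrt D \<le> r" "sqrt V1 \<le> r" "sqrt V2 \<le> r"
    using cb(1-3) r(1) by (auto intro!: real_le_lsqrt)
  have "\<alpha> * E n \<le> \<alpha> * (\<eta> / 8 / \<alpha>)" using nE(2) \<alpha>(1) by (intro mult_left_mono) auto
  also have "\<dots> = \<eta> / 8" using \<alpha>(1) by simp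
  finally have "tuple_value R0 S t - \<eta> \<le> equivocation S n p"
    using cb(4) eq nE(3,4) \<eta>'(3) r(1,2) by simp
  moreover have "Mb * (2 * sqrt D) \<le> 2 * Mb * r" using sq(1) Mb(3) by (simp add: mult_left_mono)
  then have "distortion2 d1 n p \<le> dist1 d1 t + \<eta>" "distortion3 d2 n p \<le> dist2 d2 t + \<eta>"
    using ds sq r(3) unfolding id(6) id(7) by linarith+
  ultimately show ?thesis using p n unfolding PX by blast
qed

text \<open>V1 and V2 constant: nothing is learned about X, so both mutual informations are zero. It
  serves as the direction in which rates are relaxed.\<close>

lemma erasure_point:
  fixes PX :: "'x::finite pmf"
  shows "\<exists>t :: ('x, 'y::finite, 'z::finite) tuple.
    t \<in> region \<and> (\<forall>x. margX t x = pmf PX x) \<and> hX1 t = Hp PX \<and> hX2 t = Hp PX"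
proof -
  let ?a = "\<lambda>_ :: nat. PX" and ?b = "\<lambda>_ :: nat. return_pmf undefined :: 'y pmf" and ?c = "\<lambda>_ :: nat. return_pmf undefined :: 'z pmf"
  interpret kernels "return_pmf 0" "\<lambda>_. return_pmf 0" ?a ?b ?c "\<lambda>_. 0" by unfold_locales auto
  let ?t = "tuple_of (return_pmf 0) (\<lambda>_. return_pmf 0) ?a ?b ?c"
  show ?thesis
  proof (intro exI[of _ ?t] conjI allI)
    show "?t \<in> region" by (rule tuple_of_in_region) auto
    show "margX ?t x = pmf PX x" for x
      unfolding represents_margX[OF fin_q represents_tuple_of] by (simp add: map_q_src bind_return_pmf)
    show "hX1 ?t = Hp PX" "hX2 ?t = Hp PX" by (simp_all add: tuple_of_def bind_return_pmf)
  qed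
qed

lemma region_entropy_le:
  assumes "t \<in> region" "\<And>x. margX t x = pmf PX x"
  shows "hX1 t \<le> hX2 t" "hX2 t \<le> Hp PX"
proof -
  obtain P2 P1 a b c where k: "kernels P2 P1 (fst \<circ> prod_decode)" and t: "t = tuple_of P2 P1 a b c"
    by (rule region_eq_tuple_of[OF assms(1)])
  interpret kernels P2 P1 a b c "fst \<circ> prod_decode" by (rule k)
  have "map_pmf src q = PX"
    by (rule pmf_eqI) (use assms(2) represents_margX[OF fin_q represents_tuple_of] in \<open>simp add: t\<close>)
  then have PX: "PX = bind_pmf P2 (\<lambda>u. bind_pmf (P1 u) a)" by (simp add: map_q_src)
  show "hX1 t \<le> hX2 t"
    unfolding t tuple_of_def fst_conv snd_conv
  proof (intro ex_mono)
    show "ex (P1 u) (\<lambda>v. Hp (a v)) \<le> Hp (bind_pmf (P1 u) a)" for u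
      using Hp_bind_ge(1,2)[of "P1 u" a] by simp
  qed
  show "hX2 t \<le> Hp PX"
    unfolding t tuple_of_def fst_conv snd_conv PX
    using Hp_bind_ge(1,2)[OF fin2, of "\<lambda>u. bind_pmf (P1 u) a"] by simp
qed

section \<open>Perturbation of tuples and comparison with the operational supremum\<close>

lemma dist1_mix: "dist1 d ((1 - l) *\<^sub>R t + l *\<^sub>R t') = (1 - l) * dist1 d t + l * dist1 d t'"
  unfolding dist1_def by (simp add: sum_distrib_left distrib_right sum.distrib mult.assoc)

lemma dist2_mix: "dist2 d ((1 - l) *\<^sub>R t + l *\<^sub>R t') = (1 - l) * dist2 d t + l * dist2 d t'"
  unfolding dist2_def by (simp add: sum_distrib_left distrib_right sum.distrib mult.assoc)

lemma margX_mix: "margX ((1 - l) *\<^sub>R t + l *\<^sub>R t') x = (1 - l) * margX t x + l * margX t' x"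
  unfolding margX_def by (simp add: sum_distrib_left sum.distrib)

lemma region_mix:
  assumes "t \<in> region" "t' \<in> region" "0 \<le> l" "l \<le> 1"
  shows "(1 - l) *\<^sub>R t + l *\<^sub>R t' \<in> region"
  using convexD[OF convex_region assms(1,2), of "1 - l" l] assms(3,4) by simp

lemma sup_equivocation_le:
  fixes PX :: "'x::finite pmf" and d1 :: "'x \<Rightarrow> 'y::finite \<Rightarrow> real" and d2 :: "'x \<Rightarrow> 'z::finite \<Rightarrow> real"
  assumes R: "0 \<le> R0" "0 \<le> R1" "0 \<le> R2"
  shows "sup_equivocation R0 R1 R2 PX d1 d2 S D1 D2 \<le> (SUP t\<in>feasible R1 R2 PX d1 d2 D1 D2. ereal (tuple_value R0 S t))"
  unfolding sup_equivocation_def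
proof (rule Sup_least)
  fix e assume "e \<in> {ereal (equivocation S n p) | n (p :: ('x, 'y, 'z) block pmf).
            1 \<le> n \<and> valid_system R0 R1 R2 PX n p \<and> distortion2 d1 n p \<le> D1 \<and> distortion3 d2 n p \<le> D2}"
  then obtain n and p :: "('x, 'y, 'z) block pmf" where e: "e = ereal (equivocation S n p)" and n: "1 \<le> n"
    and v: "valid_system R0 R1 R2 PX n p" and d: "distortion2 d1 n p \<le> D1" "distortion3 d2 n p \<le> D2" by blast
  interpret valid_block R0 R1 R2 PX n p by unfold_locales (use R n v in auto)
  obtain t where t: "t \<in> feasible R1 R2 PX d1 d2 (distortion2 d1 n p) (distortion3 d2 n p)" "equivocation S n p \<le> tuple_value R0 S t"
    using converse_tuple[of d1 d2] by blast
  have "t \<in> feasible R1 R2 PX d1 d2 D1 D2" using t(1) d by (auto simp: feasible_def)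
  then show "e \<le> (SUP t\<in>feasible R1 R2 PX d1 d2 D1 D2. ereal (tuple_value R0 S t))"
    unfolding e using t(2) by (intro SUP_upper2) auto
qed

text \<open>Mixing in a little of a law with constant \<open>V1\<close> and \<open>V2\<close> makes positive rate constraints strict;
  a vanishing rate forces the corresponding auxiliary variable to be independent of \<open>X\<close>.\<close>

lemma sup_equivocation_ge:
  fixes PX :: "'x::finite pmf" and d1 :: "'x \<Rightarrow> 'y::finite \<Rightarrow> real" and d2 :: "'x \<Rightarrow> 'z::finite \<Rightarrow> real"
  assumes R: "0 \<le> R0" "0 \<le> R1" "0 \<le> R2" and t: "t \<in> feasible R1 R2 PX d1 d2 D1 D2" and \<epsilon>: "0 < \<epsilon>"
  shows "ereal (tuple_value R0 S t) \<le> sup_equivocation R0 R1 R2 PX d1 d2 S (D1 + \<epsilon>) (D2 + \<epsilon>)"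
proof (rule ereal_le_epsilon2)
  fix \<eta> :: real assume \<eta>: "0 < \<eta>"
  obtain t0 :: "('x, 'y, 'z) tuple" where t0: "t0 \<in> region" "\<And>x. margX t0 x = pmf PX x" "hX1 t0 = Hp PX" "hX2 t0 = Hp PX"
    using erasure_point[of PX, where ?'y='y and ?'z='z] by blast
  note tf = t[unfolded feasible_def mem_Collect_eq]
  have tr: "t \<in> region" and tX: "margX t x = pmf PX x" for x using tf by auto
  define v where "v = tuple_value R0 S t"
  have v0: "0 \<le> v" unfolding v_def by (rule tuple_value_nonneg[OF R(1) tr])
  \<comment> \<open>The fractions limit the loss of value to \<eta> / 2 and the increase of each
    distortion to \<epsilon> / 2; the other halves are left for \<open>achievable\<close>.\<close>
  define l where "l = min 1 (min (\<eta> / 2 / (v + 1)) (\<epsilon> / 2 / (\<bar>dist1 d1 t0 - dist1 d1 t\<bar> + \<bar>dist2 d2 t0 - dist2 d2 t\<bar> + 1)))"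
  have l: "0 < l" "l \<le> 1" "l * v \<le> \<eta> / 2" "l * (dist1 d1 t0 - dist1 d1 t) \<le> \<epsilon> / 2" "l * (dist2 d2 t0 - dist2 d2 t) \<le> \<epsilon> / 2"
  proof -
    have aux: "l * y \<le> k" if "l \<le> k / (z + 1)" "y \<le> z" "0 \<le> z" "0 \<le> l" for y z k :: real
    proof -
      have "l * y \<le> l * (z + 1)" using that by (intro mult_left_mono) auto
      also have "\<dots> \<le> k" using that by (simp add: le_divide_eq)
      finally show ?thesis .
    qed
    show l0: "0 < l" "l \<le> 1" unfolding l_def using \<eta> \<epsilon> v0 by (auto intro!: divide_pos_pos add_nonneg_pos)
    show "l * v \<le> \<eta> / 2" by (rule aux[where z=v]) (use l0 v0 in \<open>auto simp: l_def\<close>)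
    show "l * (dist1 d1 t0 - dist1 d1 t) \<le> \<epsilon> / 2" "l * (dist2 d2 t0 - dist2 d2 t) \<le> \<epsilon> / 2"
      by (rule aux[where z="\<bar>dist1 d1 t0 - dist1 d1 t\<bar> + \<bar>dist2 d2 t0 - dist2 d2 t\<bar>"]; use l0 in \<open>auto simp: l_def\<close>)+
  qed
  define u where "u = (1 - l) *\<^sub>R t + l *\<^sub>R t0"
  have ur: "u \<in> region" unfolding u_def by (rule region_mix) (use tr t0 l in auto)
  have uX: "margX u x = pmf PX x" for x unfolding u_def margX_mix t0(2) tX by (simp add: algebra_simps)
  have h1: "Hp PX - hX1 u = (1 - l) * (Hp PX - hX1 t)" by (simp add: u_def t0 algebra_simps)
  have h2: "Hp PX - hX2 u = (1 - l) * (Hp PX - hX2 t)" by (simp add: u_def t0 algebra_simps)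
  have strict: "(1 - l) * I < r \<or> (1 - l) * I = 0" if "0 \<le> I" "I \<le> r" for I r :: real
  proof (cases "I = 0")
    case False
    then have "(1 - l) * I < 1 * I" using that l by (intro mult_strict_right_mono) auto
    then show ?thesis using that by simp
  qed simp
  have s: "Hp PX - hX1 u < R1 \<or> Hp PX - hX1 u = 0" "Hp PX - hX2 u < R2 \<or> Hp PX - hX2 u = 0"
    unfolding h1 h2 using region_entropy_le[OF tr tX] tf by (intro strict; simp)+
  have "0 < min (\<eta> / 2) (\<epsilon> / 2)" using \<eta> \<epsilon> by simp
  from achievable[OF R this ur uX s, of S d1 d2]
  obtain n and p :: "('x, 'y, 'z) block pmf" where n: "1 \<le> n" and p: "valid_system R0 R1 R2 PX n p"
    and e: "tuple_value R0 S u - min (\<eta> / 2) (\<epsilon> / 2) \<le> equivocation S n p"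
    and d: "distortion2 d1 n p \<le> dist1 d1 u + min (\<eta> / 2) (\<epsilon> / 2)" "distortion3 d2 n p \<le> dist2 d2 u + min (\<eta> / 2) (\<epsilon> / 2)"
    by blast
  have "dist1 d1 u = dist1 d1 t + l * (dist1 d1 t0 - dist1 d1 t)" "dist2 d2 u = dist2 d2 t + l * (dist2 d2 t0 - dist2 d2 t)"
    unfolding u_def dist1_mix dist2_mix by (simp_all add: algebra_simps)
  then have "distortion2 d1 n p \<le> D1 + \<epsilon>" "distortion3 d2 n p \<le> D2 + \<epsilon>"
    using d l(4,5) tf by linarith+
  then have "ereal (equivocation S n p) \<le> sup_equivocation R0 R1 R2 PX d1 d2 S (D1 + \<epsilon>) (D2 + \<epsilon>)"
    unfolding sup_equivocation_def using n p by (intro Sup_upper) blast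
  moreover have "(1 - l) * v \<le> tuple_value R0 S u"
    unfolding u_def v_def by (rule tuple_value_mono_mix) (use tr t0 l R in auto)
  then have "v \<le> equivocation S n p + \<eta>" using e l(3) by (simp add: left_diff_distrib)
  ultimately show "ereal (tuple_value R0 S t) \<le> sup_equivocation R0 R1 R2 PX d1 d2 S (D1 + \<epsilon>) (D2 + \<epsilon>) + ereal \<eta>"
    unfolding v_def[symmetric] by (metis add_right_mono ereal_less_eq(3) order_trans plus_ereal.simps(1))
qed

theorem mainTheorem3:
  fixes R0 R1 R2 D1 D2 :: real
    and PX :: "'x::finite pmf"
    and d1 :: "'x \<Rightarrow> 'y::finite \<Rightarrow> real"
    and d2 :: "'x \<Rightarrow> 'z::finite \<Rightarrow> real"
    and S :: "signal set"
  assumes "0 \<le> R0" "0 \<le> R1" "0 \<le> R2"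
  shows
    "(letter_laws R1 R2 PX d1 d2 D1 D2 \<noteq> {} \<longrightarrow>
        (\<exists>q\<in>letter_laws R1 R2 PX d1 d2 D1 D2. \<forall>q'\<in>letter_laws R1 R2 PX d1 d2 D1 D2.
           secrecy_value R0 S q' \<le> secrecy_value R0 S q)) \<and>
     ((\<exists>\<epsilon>>0. letter_laws R1 R2 PX d1 d2 (D1 - \<epsilon>) (D2 - \<epsilon>) \<noteq> {}) \<longrightarrow>
        sup_equivocation R0 R1 R2 PX d1 d2 S D1 D2
          = (SUP q\<in>letter_laws R1 R2 PX d1 d2 D1 D2. ereal (secrecy_value R0 S q))) \<and>
     (INF \<epsilon>\<in>{0<..}. sup_equivocation R0 R1 R2 PX d1 d2 S (D1 + \<epsilon>) (D2 + \<epsilon>))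
       = (SUP q\<in>letter_laws R1 R2 PX d1 d2 D1 D2. ereal (secrecy_value R0 S q))"
proof -
  let ?F = "feasible R1 R2 PX d1 d2"
  let ?V = "\<lambda>D1 D2. SUP t\<in>?F D1 D2. ereal (tuple_value R0 S t)"
  let ?E = "sup_equivocation R0 R1 R2 PX d1 d2 S"
  have V: "(SUP q\<in>letter_laws R1 R2 PX d1 d2 D1 D2. ereal (secrecy_value R0 S q)) = ?V D1 D2" for D1 D2
  proof -
    have "(\<lambda>q. ereal (secrecy_value R0 S q)) ` letter_laws R1 R2 PX d1 d2 D1 D2 = ereal ` (secrecy_value R0 S ` letter_laws R1 R2 PX d1 d2 D1 D2)"
      by (simp add: image_image)
    also have "\<dots> = (\<lambda>t. ereal (tuple_value R0 S t)) ` ?F D1 D2"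
      unfolding secrecy_value_image by (simp add: image_image)
    finally show ?thesis by (simp only:)
  qed
  have slack: "?E D1 D2 = ?V D1 D2" if ex: "\<exists>\<epsilon>>0. letter_laws R1 R2 PX d1 d2 (D1 - \<epsilon>) (D2 - \<epsilon>) \<noteq> {}"
  proof (rule antisym[OF sup_equivocation_le[OF assms]])
    obtain \<epsilon> where \<epsilon>: "0 < \<epsilon>" and ne: "?F (D1 - \<epsilon>) (D2 - \<epsilon>) \<noteq> {}"
      using ex letter_laws_empty_iff by blast
    then obtain t0 where t0: "t0 \<in> ?F (D1 - \<epsilon>) (D2 - \<epsilon>)" by blast
    show "?V D1 D2 \<le> ?E D1 D2"
    proof (rule SUP_least, rule ereal_le_epsilon2)
      fix t and \<eta> :: real assume t: "t \<in> ?F D1 D2" and \<eta>: "0 < \<eta>"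
      define v where "v = tuple_value R0 S t"
      have tr: "t \<in> region" "t0 \<in> region" using t t0 by (auto simp: feasible_def)
      have v0: "0 \<le> v" unfolding v_def by (rule tuple_value_nonneg[OF assms(1) tr(1)])
      \<comment> \<open>Small enough that the mixture loses at most \<eta> of the value.\<close>
      define l where "l = min 1 (\<eta> / (v + 1))"
      have l: "0 < l" "l \<le> 1" unfolding l_def using \<eta> v0 by (auto intro!: divide_pos_pos)
      have "l * v \<le> l * (v + 1)" using l by (intro mult_left_mono) auto
      also have "\<dots> \<le> \<eta> / (v + 1) * (v + 1)" using v0 by (intro mult_right_mono) (auto simp: l_def)
      finally have lv: "l * v \<le> \<eta>" using v0 by simp
      define u where "u = (1 - l) *\<^sub>R t + l *\<^sub>R t0"
      have mixle: "(1 - l) * p + l * q \<le> (1 - l) * p' + l * q'" if "p \<le> p'" "q \<le> q'" for p q p' q' :: real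
        using that l by (intro add_mono mult_left_mono) auto
      \<comment> \<open>The admixture of \<open>t0\<close> gains room l \<epsilon> in both
        distortions, exactly the excess that \<open>sup_equivocation_ge\<close> then spends.\<close>
      have "u \<in> ?F (D1 - l * \<epsilon>) (D2 - l * \<epsilon>)"
        unfolding feasible_def mem_Collect_eq
      proof (intro conjI allI)
        note tf = t[unfolded feasible_def mem_Collect_eq] and t0f = t0[unfolded feasible_def mem_Collect_eq]
        show "u \<in> region" unfolding u_def by (rule region_mix) (use tr l in auto)
        show "margX u x = pmf PX x" for x unfolding u_def margX_mix using tf t0f by (simp add: algebra_simps)
        show "dist1 d1 u \<le> D1 - l * \<epsilon>" unfolding u_def dist1_mix
          using mixle[of "dist1 d1 t" D1 "dist1 d1 t0" "D1 - \<epsilon>"] tf t0f by (simp add: algebra_simps)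
        show "dist2 d2 u \<le> D2 - l * \<epsilon>" unfolding u_def dist2_mix
          using mixle[of "dist2 d2 t" D2 "dist2 d2 t0" "D2 - \<epsilon>"] tf t0f by (simp add: algebra_simps)
        show "Hp PX - hX1 u \<le> R1" 
          using mixle[of "Hp PX - hX1 t" R1 "Hp PX - hX1 t0" R1] tf t0f by (simp add: u_def algebra_simps)
        show "Hp PX - hX2 u \<le> R2" 
          using mixle[of "Hp PX - hX2 t" R2 "Hp PX - hX2 t0" R2] tf t0f by (simp add: u_def algebra_simps)
      qed
      moreover have "0 < l * \<epsilon>" using l \<epsilon> by simp
      ultimately have "ereal (tuple_value R0 S u) \<le> ?E (D1 - l * \<epsilon> + l * \<epsilon>) (D2 - l * \<epsilon> + l * \<epsilon>)"
        by (rule sup_equivocation_ge[OF assms])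
      then have "ereal (tuple_value R0 S u) \<le> ?E D1 D2" by simp
      moreover have "(1 - l) * v \<le> tuple_value R0 S u"
        unfolding u_def v_def by (rule tuple_value_mono_mix) (use tr l assms in auto)
      then have "v \<le> tuple_value R0 S u + \<eta>" using lv by (simp add: left_diff_distrib)
      ultimately show "ereal (tuple_value R0 S t) \<le> ?E D1 D2 + ereal \<eta>"
        unfolding v_def[symmetric] by (metis add_right_mono ereal_less_eq(3) order_trans plus_ereal.simps(1))
    qed
  qed
  have limit: "(INF \<epsilon>\<in>{0<..}. ?E (D1 + \<epsilon>) (D2 + \<epsilon>)) = ?V D1 D2"
  proof (rule antisym)
    show "?V D1 D2 \<le> (INF \<epsilon>\<in>{0<..}. ?E (D1 + \<epsilon>) (D2 + \<epsilon>))"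
      by (intro SUP_least INF_greatest sup_equivocation_ge[OF assms]) auto
    show "(INF \<epsilon>\<in>{0<..}. ?E (D1 + \<epsilon>) (D2 + \<epsilon>)) \<le> ?V D1 D2"
    proof (rule dense_ge)
      fix y assume y: "?V D1 D2 < y"
      show "(INF \<epsilon>\<in>{0<..}. ?E (D1 + \<epsilon>) (D2 + \<epsilon>)) \<le> y"
      proof (cases y)
        case (real r)
        have "tuple_value R0 S t < r" if "t \<in> ?F D1 D2" for t
        proof -
          have "ereal (tuple_value R0 S t) \<le> ?V D1 D2" using that by (intro SUP_upper)
          also have "\<dots> < ereal r" using y real by simp
          finally show ?thesis by simp
        qed
        \<comment> \<open>A strict upper bound at the original levels persists at slightly larger
          ones, where the converse applies.\<close>
        from tuple_value_right_continuous[of R1 R2 PX d1 d2 D1 D2 R0 S r, OF this]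
        obtain \<epsilon> where \<epsilon>: "0 < \<epsilon>" and lt: "\<And>t. t \<in> ?F (D1 + \<epsilon>) (D2 + \<epsilon>) \<Longrightarrow> tuple_value R0 S t < r" by blast
        have "(INF \<epsilon>\<in>{0<..}. ?E (D1 + \<epsilon>) (D2 + \<epsilon>)) \<le> ?E (D1 + \<epsilon>) (D2 + \<epsilon>)" using \<epsilon> by (intro INF_lower) simp
        also have "\<dots> \<le> ?V (D1 + \<epsilon>) (D2 + \<epsilon>)" by (rule sup_equivocation_le[OF assms])
        also have "\<dots> \<le> ereal r" using lt by (intro SUP_least) (auto intro: less_imp_le)
        finally show ?thesis by (simp add: real)
      qed (use y in auto)
    qed
  qed
  show ?thesis
    unfolding V using secrecy_value_attains_max slack limit by blast
qed

end
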